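(* Let $M$ be a compact oriented 2-dimensional manifold with boundary $\partial M$, and let $\mathbf{R}:M\to\mathbb{R}^3$ be a smooth immersion which can be parametrized by curvature line coordinates near each point. Let $\mathbf{V}=\boldsymbol{\eta}+v_n\mathbf{N}$ be a smooth variation vector field along $\mathbf{R}$, with tangential component $\boldsymbol{\eta}$ and normal component $v_n=\mathbf{V}\cdot\mathbf{N}$. Then the first variation of the integral of the mean curvature under the deformation $\mathbf{r}=\mathbf{R}+t\mathbf{V}$ is $$\delta\int_M\mathcal{H}\,dA=-\int_M\mathcal{K}v_n\,dA+\int_{\partial M}\left(\frac12\nabla v_n+\mathcal{H}\boldsymbol{\eta}\right)\cdot\mathbf{t}\,ds,$$ where $\mathbf{t}$ is the outward-pointing unit conormal vector and $ds$ is the line element of $\partial M$.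
   Context: Local coordinates $(\alpha,\beta)$ are curvature line coordinates if the first and second fundamental forms are both diagonal in them; they are taken compatible with the orientation. $\mathbf{N}$ is the unit normal $\mathbf{R}_\alpha\times\mathbf{R}_\beta/\|\mathbf{R}_\alpha\times\mathbf{R}_\beta\|$, where subscripts denote partial derivatives. The principal curvatures $\kappa_1,\kappa_2$ are defined by $\mathbf{N}_\alpha=-\kappa_1\mathbf{R}_\alpha$, $\mathbf{N}_\beta=-\kappa_2\mathbf{R}_\beta$; $\mathcal{H}=\frac12(\kappa_1+\kappa_2)$ is the mean curvature and $\mathcal{K}=\kappa_1\kappa_2$ the Gaussian curvature. The area element is $dA=\|\mathbf{R}_\alpha\times\mathbf{R}_\beta\|\,d\alpha\,d\beta$, and $\nabla$ is the surface gradient with respect to the induced metric. For a quantity $Q$ depending on the immersion, $\delta Q=\frac{d}{dt}\big|_{t=0}Q(\mathbf{r}_t)$, where $\mathbf{r}_t=\mathbf{R}+t\mathbf{V}$, $|t|\ll1$ (mean curvature, with the same sign convention, and area element are those of $\mathbf{r}_t$). The unit conormal $\mathbf{t}$ is tangent to the surface and orthogonal to the boundary curve. *)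

theory Defs
  imports "HOL-Analysis.Analysis"
begin

section \<open>Smooth functions of several variables\<close>

text \<open>On an open set, k-fold continuous differentiability is continuity of all iterated
  directional derivatives.  On a set with boundary, smoothness means that the function extends
  smoothly to an open neighbourhood of each point.\<close>

primrec Ck_on_open :: "nat \<Rightarrow> ('e::euclidean_space) set \<Rightarrow> ('e \<Rightarrow> 'b::real_normed_vector) \<Rightarrow> bool" where
  "Ck_on_open 0 W f \<longleftrightarrow> continuous_on W f"
| "Ck_on_open (Suc k) W f \<longleftrightarrow> (\<forall>x\<in>W. f differentiable (at x)) \<and>
     (\<forall>v. Ck_on_open k W (\<lambda>x. frechet_derivative f (at x) v))"

definition smooth_fun_on :: "('e::euclidean_space) set \<Rightarrow> ('e \<Rightarrow> 'b::real_normed_vector) \<Rightarrow> bool" where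
  "smooth_fun_on S f \<longleftrightarrow> (\<forall>x\<in>S. \<exists>W g. open W \<and> x \<in> W \<and> (\<forall>k. Ck_on_open k W g) \<and> (\<forall>y\<in>W \<inter> S. g y = f y))"


section \<open>Oriented surfaces with boundary\<close>

text \<open>A coordinate system is a domain together with a coordinate map, of which only the values on
  the domain matter.\<close>

type_synonym 'a coords = "'a set \<times> ('a \<Rightarrow> real^2)"

abbreviation cdom :: "'a coords \<Rightarrow> 'a set" where "cdom c \<equiv> fst c"
abbreviation cmap :: "'a coords \<Rightarrow> 'a \<Rightarrow> real^2" where "cmap c \<equiv> snd c"
abbreviation cinv :: "'a coords \<Rightarrow> real^2 \<Rightarrow> 'a" where "cinv c \<equiv> inv_into (cdom c) (cmap c)"

definition half_plane :: "(real^2) set" where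
  "half_plane = {x. 0 \<le> x $ 2}"

definition local_coords :: "('a::t2_space) set \<Rightarrow> 'a coords \<Rightarrow> bool" where
  "local_coords M c \<longleftrightarrow> openin (top_of_set M) (cdom c) \<and>
     homeomorphism (cdom c) (cmap c ` cdom c) (cmap c) (cinv c)"

definition oriented_transition :: "'a coords \<Rightarrow> 'a coords \<Rightarrow> bool" where
  "oriented_transition c d \<longleftrightarrow>
     (let S = cmap c ` (cdom c \<inter> cdom d); \<tau> = cmap d \<circ> cinv c in
        smooth_fun_on S \<tau> \<and> (\<forall>x\<in>S. 0 < det (matrix (frechet_derivative \<tau> (at x within S)))))"

text \<open>Compact oriented smooth 2-manifold \<open>M\<close> with (possibly empty) boundary, given by an oriented
  atlas \<open>\<A>\<close> of half-plane charts.  Every interior point has such a chart too, whose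
  image misses the boundary line.\<close>

definition compact_oriented_surface :: "('a::t2_space) set \<Rightarrow> 'a coords set \<Rightarrow> bool" where
  "compact_oriented_surface M \<A> \<longleftrightarrow> compact M \<and> (\<Union>c\<in>\<A>. cdom c) = M \<and>
     (\<forall>c\<in>\<A>. local_coords M c \<and> openin (top_of_set half_plane) (cmap c ` cdom c)) \<and>
     (\<forall>c\<in>\<A>. \<forall>d\<in>\<A>. oriented_transition c d)"

definition surface_boundary :: "'a coords set \<Rightarrow> 'a set" where
  "surface_boundary \<A> = {p. \<exists>c\<in>\<A>. p \<in> cdom c \<and> cmap c p $ 2 = 0}"

text \<open>General local coordinates compatible with smooth structure and orientation.  Near a boundary
  point their image is not required to be a piece of the half-plane, so that no curve in \<open>\<partial>M\<close>
  is forced to be a coordinate line.\<close>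

definition oriented_coords :: "('a::t2_space) set \<Rightarrow> 'a coords set \<Rightarrow> 'a coords \<Rightarrow> bool" where
  "oriented_coords M \<A> c \<longleftrightarrow> local_coords M c \<and> (\<forall>d\<in>\<A>. oriented_transition d c)"

definition smooth_on_surface :: "'a coords set \<Rightarrow> ('a \<Rightarrow> 'b::real_normed_vector) \<Rightarrow> bool" where
  "smooth_on_surface \<A> f \<longleftrightarrow> (\<forall>c\<in>\<A>. smooth_fun_on (cmap c ` cdom c) (f \<circ> cinv c))"

text \<open>The differential at \<open>p\<close> of the coordinate representation of \<open>f\<close>.  The derivative is
  taken within the image of the coordinates, hence is one-sided at boundary points (where it is
  still unique).\<close>

definition differential :: "'a coords \<Rightarrow> ('a \<Rightarrow> 'b::real_normed_vector) \<Rightarrow> 'a \<Rightarrow> real^2 \<Rightarrow> 'b" where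
  "differential c f p = frechet_derivative (f \<circ> cinv c) (at (cmap c p) within cmap c ` cdom c)"

definition pderiv_in :: "'a coords \<Rightarrow> 2 \<Rightarrow> ('a \<Rightarrow> 'b::real_normed_vector) \<Rightarrow> 'a \<Rightarrow> 'b" where
  "pderiv_in c i f p = differential c f p (axis i 1)"

definition immersion :: "'a coords set \<Rightarrow> ('a \<Rightarrow> 'b::real_normed_vector) \<Rightarrow> bool" where
  "immersion \<A> R \<longleftrightarrow> smooth_on_surface \<A> R \<and> (\<forall>c\<in>\<A>. \<forall>p\<in>cdom c. inj (differential c R p))"

text \<open>A chosen chart around \<open>p\<close>; the notions defined through it do not depend on the choice.\<close>

definition chart_at :: "'a coords set \<Rightarrow> 'a \<Rightarrow> 'a coords" where
  "chart_at \<A> p = (SOME c. c \<in> \<A> \<and> p \<in> cdom c)"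


section \<open>Geometry of an immersion into Euclidean space\<close>

definition tangent_plane :: "'a coords set \<Rightarrow> ('a \<Rightarrow> real^3) \<Rightarrow> 'a \<Rightarrow> (real^3) set" where
  "tangent_plane \<A> R p = range (differential (chart_at \<A> p) R p)"

definition coord_cross :: "'a coords \<Rightarrow> ('a \<Rightarrow> real^3) \<Rightarrow> 'a \<Rightarrow> real^3" where
  "coord_cross c R p = cross3 (pderiv_in c 1 R p) (pderiv_in c 2 R p)"

definition unit_normal :: "'a coords set \<Rightarrow> ('a \<Rightarrow> real^3) \<Rightarrow> 'a \<Rightarrow> real^3" where
  "unit_normal \<A> R p =
     coord_cross (chart_at \<A> p) R p /\<^sub>R norm (coord_cross (chart_at \<A> p) R p)"

definition first_form :: "'a coords \<Rightarrow> ('a \<Rightarrow> real^3) \<Rightarrow> 2 \<Rightarrow> 2 \<Rightarrow> 'a \<Rightarrow> real" where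
  "first_form c R i j p = pderiv_in c i R p \<bullet> pderiv_in c j R p"

definition second_form :: "'a coords set \<Rightarrow> 'a coords \<Rightarrow> ('a \<Rightarrow> real^3) \<Rightarrow> 2 \<Rightarrow> 2 \<Rightarrow> 'a \<Rightarrow> real" where
  "second_form \<A> c R i j p = pderiv_in c i (pderiv_in c j R) p \<bullet> unit_normal \<A> R p"

definition curvature_line_coords :: "('a::t2_space) set \<Rightarrow> 'a coords set \<Rightarrow> ('a \<Rightarrow> real^3) \<Rightarrow> 'a coords \<Rightarrow> bool" where
  "curvature_line_coords M \<A> R c \<longleftrightarrow> oriented_coords M \<A> c \<and>
     (\<forall>p\<in>cdom c. \<forall>i j. i \<noteq> j \<longrightarrow> first_form c R i j p = 0 \<and> second_form \<A> c R i j p = 0)"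

text \<open>The relations \<open>N\<^sub>\<alpha> = -\<kappa>\<^sub>1 R\<^sub>\<alpha>\<close> and \<open>N\<^sub>\<beta> = -\<kappa>\<^sub>2 R\<^sub>\<beta>\<close>, read at a single point
  with \<open>v\<close> and \<open>w\<close> the coordinate directions of \<open>\<alpha>\<close> and \<open>\<beta>\<close>.  In this pointwise form
  they make sense for every immersion, in particular for all nearby members of a variation, which
  need not admit curvature line coordinates around umbilics.\<close>

definition principal_curvatures ::
    "'a coords set \<Rightarrow> ('a \<Rightarrow> real^3) \<Rightarrow> 'a \<Rightarrow> real \<Rightarrow> real \<Rightarrow> bool" where
  "principal_curvatures \<A> R p \<kappa>1 \<kappa>2 \<longleftrightarrow>
     (let dR = differential (chart_at \<A> p) R p;
          dN = differential (chart_at \<A> p) (unit_normal \<A> R) p in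
      \<exists>v w. v \<noteq> 0 \<and> w \<noteq> 0 \<and> dR v \<bullet> dR w = 0 \<and>
            dN v = - \<kappa>1 *\<^sub>R dR v \<and> dN w = - \<kappa>2 *\<^sub>R dR w)"

definition mean_curvature :: "'a coords set \<Rightarrow> ('a \<Rightarrow> real^3) \<Rightarrow> 'a \<Rightarrow> real" where
  "mean_curvature \<A> R p =
     (THE h. \<exists>\<kappa>1 \<kappa>2. principal_curvatures \<A> R p \<kappa>1 \<kappa>2 \<and> h = (\<kappa>1 + \<kappa>2) / 2)"

definition gaussian_curvature :: "'a coords set \<Rightarrow> ('a \<Rightarrow> real^3) \<Rightarrow> 'a \<Rightarrow> real" where
  "gaussian_curvature \<A> R p =
     (THE k. \<exists>\<kappa>1 \<kappa>2. principal_curvatures \<A> R p \<kappa>1 \<kappa>2 \<and> k = \<kappa>1 * \<kappa>2)"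

text \<open>The gradient for the induced metric, regarded as a tangent vector in \<open>\<real>\<^sup>3\<close>.\<close>

definition surface_gradient :: "'a coords set \<Rightarrow> ('a \<Rightarrow> real^3) \<Rightarrow> ('a \<Rightarrow> real) \<Rightarrow> 'a \<Rightarrow> real^3" where
  "surface_gradient \<A> R f p =
     (THE g. g \<in> tangent_plane \<A> R p \<and>
        (\<forall>v. g \<bullet> differential (chart_at \<A> p) R p v = differential (chart_at \<A> p) f p v))"

text \<open>In half-plane charts the boundary has tangent \<open>R\<^sub>1\<close>, and a tangent vector \<open>dR v\<close> points
  outward iff \<open>v\<close> has negative second component.\<close>

definition outward_conormal :: "'a coords set \<Rightarrow> ('a \<Rightarrow> real^3) \<Rightarrow> 'a \<Rightarrow> real^3" where
  "outward_conormal \<A> R p =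
     (THE n. norm n = 1 \<and> n \<bullet> pderiv_in (chart_at \<A> p) 1 R p = 0 \<and>
        (\<exists>v. v $ 2 < 0 \<and> n = differential (chart_at \<A> p) R p v))"

text \<open>The measures \<open>dA\<close> on \<open>M\<close> and \<open>ds\<close> on \<open>\<partial>M\<close> are the unique Borel measures with the
  familiar coordinate expressions in every chart.\<close>

definition area_measure :: "('a::t2_space) set \<Rightarrow> 'a coords set \<Rightarrow> ('a \<Rightarrow> real^3) \<Rightarrow> 'a measure" where
  "area_measure M \<A> R =
     (THE \<mu>. sets \<mu> = sets (restrict_space borel M) \<and>
        (\<forall>c\<in>\<A>. \<forall>B\<in>sets \<mu>. B \<subseteq> cdom c \<longrightarrow>
           emeasure \<mu> B =
             (\<integral>\<^sup>+x\<in>cmap c ` B. ennreal (norm (coord_cross c R (cinv c x))) \<partial>lborel)))"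

definition boundary_length_measure :: "('a::t2_space) coords set \<Rightarrow> ('a \<Rightarrow> real^3) \<Rightarrow> 'a measure" where
  "boundary_length_measure \<A> R =
     (THE \<mu>. sets \<mu> = sets (restrict_space borel (surface_boundary \<A>)) \<and>
        (\<forall>c\<in>\<A>. \<forall>B\<in>sets \<mu>. B \<subseteq> cdom c \<longrightarrow>
           emeasure \<mu> B =
             (\<integral>\<^sup>+s\<in>{s. vector [s, 0] \<in> cmap c ` B}.
                ennreal (norm (pderiv_in c 1 R (cinv c (vector [s, 0])))) \<partial>lborel)))"

end

theory Submission
  imports Defs
begin

text \<open>Let \<open>N\<close> be the unit normal. In a chart, the density of \<open>H dA\<close> is
  \<open>-(1/2) N \<bullet> (N\<^sub>1 \<times> R\<^sub>2 + R\<^sub>1 \<times> N\<^sub>2)\<close>, and its derivative at \<open>t = 0\<close> along \<open>R + t V\<close> is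
  \<open>-K v\<^sub>n\<close> times the area density, minus the exterior derivative of the 1-form
  \<open>\<theta> = (1/2) (det (N, \<delta>N, dR) + det (N, V, dN))\<close>: every triple product of three tangent vectors vanishes,
  \<open>N\<^sub>1 \<times> N\<^sub>2 = K R\<^sub>1 \<times> R\<^sub>2\<close>, and the mixed second derivatives cancel.
  On the boundary \<open>-\<theta>\<close> is \<open>((1/2) grad v\<^sub>n + H \<eta>) \<bullet> \<nu> ds\<close>, \<open>\<nu>\<close> the conormal, so Stokes' theorem gives the formula.
  Stokes' theorem itself is reduced to coordinate boxes by a partition of unity \<open>\<rho>\<^sub>i\<close>; the error terms
  \<open>d\<rho>\<^sub>i \<and> \<theta>\<close> add up to zero because, divided by the area form, they do not depend on the chart.\<close>

section \<open>Calculus on relatively open subsets of the half-plane\<close>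

text \<open>The obstacle is the dependence on t: \<open>mean_curvature\<close> is a definite
  description that makes sense only where \<open>R + t V\<close> is nondegenerate, and N carries a
  square root. With the unnormalised normal n = R_1 \<times> R_2 the density of H dA becomes - n
  \<bullet> (n_1 \<times> R_2 + R_1 \<times> n_2) / (2 n \<bullet> n), rational in t, and its
  denominator stays nonzero for small t on each of finitely many compact boxes. The form \<theta>
  arises by moving the derivatives off \<delta>N and V in N \<bullet> (d(\<delta>N) \<times> dR + dN
  \<times> dV). All derivatives are taken within relatively open subsets of the half-plane, so
  boundary points are treated like interior ones and no extension across the boundary has to be
  carried along.\<close>

abbreviation half_open :: "(real^2) set \<Rightarrow> bool" where
  "half_open S \<equiv> openin (top_of_set half_plane) S"

text \<open>The derivative is taken within \<open>S\<close>, hence one-sided at points of the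
  boundary line; that it is still determined there is
  \<open>half_open_derivative_unique\<close>.\<close>

definition pd :: "(real^2) set \<Rightarrow> 2 \<Rightarrow> (real^2 \<Rightarrow> 'b::real_normed_vector) \<Rightarrow> real^2 \<Rightarrow> 'b" where
  "pd S i f x = frechet_derivative f (at x within S) (axis i 1)"

text \<open>Modelled on \<open>Ck_on_open\<close>, but intrinsic to \<open>S\<close>: derivatives
  are taken within \<open>S\<close> and only along the two axes, and no extension beyond
  \<open>S\<close> enters.\<close>

primrec Ck :: "nat \<Rightarrow> (real^2) set \<Rightarrow> (real^2 \<Rightarrow> 'b::real_normed_vector) \<Rightarrow> bool" where
  "Ck 0 S f \<longleftrightarrow> continuous_on S f"
| "Ck (Suc k) S f \<longleftrightarrow> (\<forall>x\<in>S. f differentiable (at x within S)) \<and> (\<forall>i. Ck k S (pd S i f))"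

lemma half_open_ball:
  assumes "half_open S" "x \<in> S"
  obtains e where "e > 0" "\<And>y. 0 \<le> y $ 2 \<Longrightarrow> dist y x < e \<Longrightarrow> y \<in> S"
proof -
  obtain U where U: "open U" "S = half_plane \<inter> U"
    using assms(1) by (auto simp: openin_open)
  then obtain e where "e > 0" "ball x e \<subseteq> U"
    using assms(2) openE by (metis IntE)
  then show ?thesis
    using U by (intro that[of e]) (auto simp: half_plane_def subset_eq dist_commute)
qed

lemma half_open_nonneg: "half_open S \<Longrightarrow> x \<in> S \<Longrightarrow> 0 \<le> x $ 2"
  by (auto simp: openin_open half_plane_def)

text \<open>A derivative within a set is determined once the set contains arbitrarily short steps
  along every axis. From a boundary point the positive steps stay in the half-plane.\<close>

lemma half_open_derivative_unique:
  assumes S: "half_open S" "x \<in> S"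
    and f: "(f has_derivative f') (at x within S)" "(f has_derivative f'') (at x within S)"
  shows "f' = f''"
proof (rule frechet_derivative_unique_within[OF f])
  fix i :: "real^2" and e :: real
  assume i: "i \<in> Basis" and e: "e > 0"
  obtain d where d: "d > 0" "\<And>y. 0 \<le> y $ 2 \<Longrightarrow> dist y x < d \<Longrightarrow> y \<in> S"
    by (rule half_open_ball[OF S]) blast
  define m where "m = min d e / 2"
  have m: "0 < m" "m < d" "m < e" using d(1) e by (auto simp: m_def min_def)
  have "x + m *\<^sub>R i \<in> S"
  proof (rule d(2))
    have "0 \<le> i $ 2" using i by (auto simp: Basis_vec_def axis_def)
    then show "0 \<le> (x + m *\<^sub>R i) $ 2" using half_open_nonneg[OF S] m(1) by simp
    show "dist (x + m *\<^sub>R i) x < d" using m i by (simp add: dist_norm)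
  qed
  then show "\<exists>d. 0 < \<bar>d\<bar> \<and> \<bar>d\<bar> < e \<and> x + d *\<^sub>R i \<in> S"
    using m by (intro exI[of _ m]) auto
qed

lemma half_open_frechet_eq:
  assumes "half_open S" "x \<in> S" "(f has_derivative f') (at x within S)"
  shows "frechet_derivative f (at x within S) = f'"
  using half_open_derivative_unique[OF assms(1,2) _ assms(3)] assms(3)
  by (meson differentiableI frechet_derivative_works)

lemma pd_eqI:
  assumes "half_open S" "x \<in> S" "(f has_derivative f') (at x within S)"
  shows "pd S i f x = f' (axis i 1)"
  using half_open_frechet_eq[OF assms] by (simp add: pd_def)

lemma vec2_expand: "(v::real^2) = v $ 1 *\<^sub>R axis 1 1 + v $ 2 *\<^sub>R axis 2 1"
  by (simp add: vec_eq_iff forall_2 axis_def)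

lemma linear_vec2:
  assumes "linear (f :: real^2 \<Rightarrow> 'b::real_vector)"
  shows "f v = v $ 1 *\<^sub>R f (axis 1 1) + v $ 2 *\<^sub>R f (axis 2 1)"
  by (subst vec2_expand[of v]) (simp only: linear_add[OF assms] linear_scale[OF assms])

lemma frechet_derivative_pd:
  assumes "f differentiable (at x within S)"
  shows "frechet_derivative f (at x within S) v = v $ 1 *\<^sub>R pd S 1 f x + v $ 2 *\<^sub>R pd S 2 f x"
  unfolding pd_def by (intro linear_vec2 linear_frechet_derivative assms)

lemma Ck_SucD:
  assumes "Ck (Suc k) S f"
  shows "x \<in> S \<Longrightarrow> f differentiable (at x within S)" "Ck k S (pd S i f)"
  using assms by simp_all

lemma Ck_Suc_continuous: "Ck (Suc k) S f \<Longrightarrow> continuous_on S f"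
  by (auto simp: continuous_on_eq_continuous_within dest: differentiable_imp_continuous_within)

lemma Ck_SucI: "Ck (Suc k) S f \<Longrightarrow> Ck k S f"
proof (induction k arbitrary: f)
  case 0 then show ?case using Ck_Suc_continuous[of 0 S f] by simp
next
  case (Suc k)
  have "Ck k S (pd S i f)" for i using Suc.IH Suc.prems by simp
  then show ?case using Suc.prems by simp
qed

lemma Ck_continuous: "Ck k S f \<Longrightarrow> continuous_on S f"
  by (cases k) (auto dest: Ck_Suc_continuous simp del: Ck.simps(2))

lemma pd_cong:
  assumes "\<And>y. y \<in> S \<Longrightarrow> f y = g y" "x \<in> S"
  shows "pd S i f x = pd S i g x"
proof -
  have "(f has_derivative F) (at x within S) = (g has_derivative F) (at x within S)" for F
    using assms by (metis has_derivative_transform)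
  then show ?thesis by (simp add: pd_def frechet_derivative_def)
qed

lemma differentiable_cong_on:
  assumes "\<And>y. y \<in> S \<Longrightarrow> f y = g y" "x \<in> S" "f differentiable (at x within S)"
  shows "g differentiable (at x within S)"
  using assms by (metis differentiable_def has_derivative_transform)

lemma Ck_cong:
  assumes "\<And>x. x \<in> S \<Longrightarrow> f x = g x" "Ck k S f"
  shows "Ck k S g"
  using assms
proof (induction k arbitrary: f g)
  case 0 then show ?case using continuous_on_cong[of S S f g] by auto
next
  case (Suc k)
  have "Ck k S (pd S i g)" for i
    using Suc.IH[of "pd S i f" "pd S i g"] pd_cong[of S f g] Suc.prems by simp
  then show ?case using Suc.prems differentiable_cong_on[of S f g] by auto
qed

section \<open>Closure of \<open>Ck\<close> under algebraic operations\<close>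

lemma pd_const: 
  assumes "half_open S" "x \<in> S" shows "pd S i (\<lambda>x. c) x = 0"
  using pd_eqI[OF assms, of "\<lambda>x. c" "\<lambda>x. 0"] by simp

lemma Ck_const: "half_open S \<Longrightarrow> Ck k S (\<lambda>x. c)"
proof (induction k arbitrary: c)
  case (Suc k)
  have "Ck k S (pd S i (\<lambda>x. c))" for i
    by (rule Ck_cong[OF _ Suc.IH[of 0]]) (simp_all add: Suc.prems pd_const)
  then show ?case by simp
qed simp

lemma pd_linear:
  assumes "bounded_linear L" "half_open S" "x \<in> S" "f differentiable (at x within S)"
  shows "pd S i (\<lambda>x. L (f x)) x = L (pd S i f x)"
  using pd_eqI[OF assms(2,3) bounded_linear.has_derivative[OF assms(1) assms(4)[unfolded frechet_derivative_works]]]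
  by (simp add: pd_def)

lemma pd_add:
  assumes "half_open S" "x \<in> S" "f differentiable (at x within S)" "g differentiable (at x within S)"
  shows "pd S i (\<lambda>x. f x + g x) x = pd S i f x + pd S i g x"
  using pd_eqI[OF assms(1,2) has_derivative_add[OF assms(3,4)[unfolded frechet_derivative_works]]]
  by (simp add: pd_def)

lemma pd_bilinear:
  assumes "bounded_bilinear B" "half_open S" "x \<in> S" 
    and "f differentiable (at x within S)" "g differentiable (at x within S)"
  shows "pd S i (\<lambda>x. B (f x) (g x)) x = B (pd S i f x) (g x) + B (f x) (pd S i g x)"
  using pd_eqI[OF assms(2,3) bounded_bilinear.FDERIV[OF assms(1) assms(4,5)[unfolded frechet_derivative_works]]]
  by (simp add: pd_def add.commute)

lemma differentiable_bilinear:
  assumes "bounded_bilinear B" "f differentiable (at x within S)" "g differentiable (at x within S)"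
  shows "(\<lambda>x. B (f x) (g x)) differentiable (at x within S)"
  using bounded_bilinear.FDERIV[OF assms(1) assms(2,3)[unfolded frechet_derivative_works]]
  by (rule differentiableI)

lemma Ck_add:
  assumes "half_open S"
  shows "Ck k S f \<Longrightarrow> Ck k S g \<Longrightarrow> Ck k S (\<lambda>x. f x + g x)"
proof (induction k arbitrary: f g)
  case 0 then show ?case by (simp add: continuous_on_add)
next
  case (Suc k)
  have "Ck k S (pd S i (\<lambda>x. f x + g x))" for i
  proof (rule Ck_cong)
    show "Ck k S (\<lambda>x. pd S i f x + pd S i g x)"
      by (intro Suc.IH Ck_SucD(2) Suc.prems)
  qed (simp add: pd_add[OF assms] Ck_SucD(1)[OF Suc.prems(1)] Ck_SucD(1)[OF Suc.prems(2)])
  then show ?case using Suc.prems by (auto intro: differentiable_add)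
qed

lemma Ck_sum:
  assumes "half_open S" "\<And>i. i \<in> I \<Longrightarrow> Ck k S (f i)"
  shows "Ck k S (\<lambda>x. \<Sum>i\<in>I. f i x)"
  using assms(2)
proof (induction I rule: infinite_finite_induct)
  case (insert i I)
  then show ?case using Ck_add[OF assms(1), of k "f i" "\<lambda>x. \<Sum>i\<in>I. f i x"] by simp
qed (auto intro: Ck_const assms)

lemma Ck_bilinear:
  assumes B: "bounded_bilinear B" and S: "half_open S"
  shows "Ck k S f \<Longrightarrow> Ck k S g \<Longrightarrow> Ck k S (\<lambda>x. B (f x) (g x))"
proof (induction k arbitrary: f g)
  case 0 then show ?case by (simp add: bounded_bilinear.continuous_on[OF B])
next
  case (Suc k)
  have "Ck k S (pd S i (\<lambda>x. B (f x) (g x)))" for i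
  proof (rule Ck_cong)
    show "Ck k S (\<lambda>x. B (pd S i f x) (g x) + B (f x) (pd S i g x))"
      using Suc.prems by (intro Ck_add S Suc.IH) (auto dest: Ck_SucI simp del: Ck.simps(2) intro: Ck_SucD)
  qed (simp add: pd_bilinear[OF B S] Ck_SucD(1)[OF Suc.prems(1)] Ck_SucD(1)[OF Suc.prems(2)])
  then show ?case using Suc.prems by (auto intro: differentiable_bilinear[OF B])
qed

lemma Ck_linear:
  assumes L: "bounded_linear L" and S: "half_open S"
  shows "Ck k S f \<Longrightarrow> Ck k S (\<lambda>x. L (f x))"
proof (induction k arbitrary: f)
  case 0 then show ?case by (simp add: bounded_linear.continuous_on[OF L])
next
  case (Suc k)
  have "Ck k S (pd S i (\<lambda>x. L (f x)))" for i
    by (rule Ck_cong[OF _ Suc.IH[OF Ck_SucD(2)[OF Suc.prems, of i]]])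
       (simp add: pd_linear[OF L S] Ck_SucD(1)[OF Suc.prems])
  then show ?case using Suc.prems
    by (auto simp: differentiable_def) (metis bounded_linear.has_derivative[OF L])
qed

lemmas Ck_scaleR = Ck_bilinear[OF bounded_bilinear_scaleR]
lemmas Ck_mult = Ck_bilinear[OF bounded_bilinear_mult]
lemmas Ck_inner = Ck_bilinear[OF bounded_bilinear_inner]

lemma bounded_bilinear_cross: "bounded_bilinear (cross3 :: real^3 \<Rightarrow> real^3 \<Rightarrow> real^3)"
  using bilinear_cross bilinear_conv_bounded_bilinear by blast

lemmas Ck_cross = Ck_bilinear[OF bounded_bilinear_cross]

section \<open>The reciprocal norm\<close>

lemma has_derivative_inverse_norm:
  fixes f :: "real^2 \<Rightarrow> 'b::real_inner"
  assumes "f x \<noteq> 0" "(f has_derivative f') (at x within S)"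
  shows "((\<lambda>x. inverse (norm (f x))) has_derivative (\<lambda>v. - (inverse (norm (f x)) ^ 3 * (f x \<bullet> f' v)))) (at x within S)"
proof -
  have "((\<lambda>x. norm (f x)) has_derivative (\<lambda>v. sgn (f x) \<bullet> f' v)) (at x within S)"
    using has_derivative_compose[OF assms(2) has_derivative_norm[OF assms(1)]] by (simp add: inner_commute)
  from Deriv.has_derivative_inverse[OF _ this] show ?thesis
    using assms(1) by (simp add: sgn_div_norm power3_eq_cube mult.assoc inner_scaleR_left) (simp add: algebra_simps)
qed

lemma pd_inverse_norm:
  fixes f :: "real^2 \<Rightarrow> 'b::real_inner"
  assumes "half_open S" "x \<in> S" "f x \<noteq> 0" "f differentiable (at x within S)"
  shows "pd S i (\<lambda>x. inverse (norm (f x))) x = - (inverse (norm (f x)) ^ 3 * (f x \<bullet> pd S i f x))"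
  using pd_eqI[OF assms(1,2) has_derivative_inverse_norm[OF assms(3) assms(4)[unfolded frechet_derivative_works]]]
  by (simp add: pd_def)

text \<open>The derivative of the reciprocal norm is polynomial in the reciprocal norm itself,
  \<open>f\<close> and the derivative of \<open>f\<close>, so the induction hypothesis supplies the
  regularity of its own factor.\<close>

lemma Ck_inverse_norm:
  fixes f :: "real^2 \<Rightarrow> 'b::real_inner"
  assumes S: "half_open S" and nz: "\<And>x. x \<in> S \<Longrightarrow> f x \<noteq> 0"
  shows "Ck k S f \<Longrightarrow> Ck k S (\<lambda>x. inverse (norm (f x)))"
proof (induction k)
  case 0 then show ?case using nz by (auto intro!: continuous_intros)
next
  case (Suc k)
  let ?g = "\<lambda>x. inverse (norm (f x))"
  have g: "Ck k S ?g" using Suc Ck_SucI by blast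
  have *: "Ck k S (\<lambda>x. (-1) * ((?g x * (?g x * ?g x)) * (f x \<bullet> pd S i f x)))" for i
    by (intro Ck_mult Ck_inner S g Ck_const Ck_SucI[OF Suc.prems] Ck_SucD(2)[OF Suc.prems])
  have "Ck k S (pd S i ?g)" for i
    by (rule Ck_cong[OF _ *[of i]])
       (subst pd_inverse_norm[OF S _ nz Ck_SucD(1)[OF Suc.prems]], auto simp: power3_eq_cube mult.assoc)
  moreover have "?g differentiable (at x within S)" if "x \<in> S" for x
    using has_derivative_inverse_norm[of f x] nz[OF that] Ck_SucD(1)[OF Suc.prems that]
    by (auto simp: differentiable_def)
  ultimately show ?case by simp
qed

section \<open>Locality, and comparison with smooth extensions\<close>

lemma at_within_openin:
  assumes "openin (top_of_set S) T" "x \<in> T"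
  shows "at x within T = at x within S"
proof -
  obtain U where "open U" "T = S \<inter> U" using assms(1) by (auto simp: openin_open)
  then show ?thesis using assms(2) at_within_nhd[of x U T S] by auto
qed

lemma pd_openin: "openin (top_of_set S) T \<Longrightarrow> x \<in> T \<Longrightarrow> pd T i f x = pd S i f x"
  by (simp add: pd_def at_within_openin)

text \<open>A relatively open piece has the same one-sided derivatives as the whole set. This serves
  functions given by different formulas on different pieces, such as a bump seen from a foreign
  chart.\<close>

lemma Ck_local:
  assumes "\<And>x. x \<in> S \<Longrightarrow> \<exists>T. openin (top_of_set S) T \<and> x \<in> T \<and> Ck k T f" shows "Ck k S f"
  using assms
proof (induction k arbitrary: f)
  case 0
  have "continuous (at x within S) f" if x: "x \<in> S" for x
  proof -
    obtain T where T: "openin (top_of_set S) T" "x \<in> T" "continuous_on T f"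
      using 0[OF x] unfolding Ck.simps by blast
    then show ?thesis
      using at_within_openin[OF T(1,2)] by (auto simp: continuous_on_eq_continuous_within)
  qed
  then show ?case by (simp add: continuous_on_eq_continuous_within)
next
  case (Suc k)
  have "Ck k S (pd S i f)" for i
  proof (rule Suc.IH)
    fix x assume "x \<in> S"
    then obtain T where T: "openin (top_of_set S) T" "x \<in> T" "Ck (Suc k) T f" by (rule Suc.prems[THEN exE]) (elim conjE)
    have "Ck k T (pd S i f)"
      by (rule Ck_cong[OF _ Ck_SucD(2)[OF T(3), of i]]) (simp add: pd_openin[OF T(1)])
    with T show "\<exists>T. openin (top_of_set S) T \<and> x \<in> T \<and> Ck k T (pd S i f)" by (intro exI[of _ T] conjI)
  qed
  moreover have "f differentiable (at x within S)" if "x \<in> S" for x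
  proof -
    obtain T where T: "openin (top_of_set S) T" "x \<in> T" "Ck (Suc k) T f" using Suc.prems[OF \<open>x \<in> S\<close>] by (elim exE conjE)
    then show ?thesis using Ck_SucD(1)[OF T(3,2)] by (simp add: at_within_openin[OF T(1,2)])
  qed
  ultimately show ?case by simp
qed

text \<open>One extension serves a whole neighbourhood: its full derivative restricts to the
  derivative within \<open>S\<close> at every nearby point of \<open>S\<close>, which is what allows
  differentiation to be iterated.\<close>

lemma smooth_fun_on_differentiable:
  assumes "smooth_fun_on S f" "x \<in> S"
  obtains W g where "open W" "x \<in> W" "\<And>k. Ck_on_open k W g" "\<And>y. y \<in> W \<inter> S \<Longrightarrow> g y = f y"
    "\<And>y. y \<in> W \<inter> S \<Longrightarrow> (f has_derivative frechet_derivative g (at y)) (at y within S)"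
proof -
  obtain W g where W: "open W" "x \<in> W" "\<And>k. Ck_on_open k W g" "\<And>y. y \<in> W \<inter> S \<Longrightarrow> g y = f y"
  proof -
    from assms(1)[unfolded smooth_fun_on_def, rule_format, OF assms(2)] obtain W g where "open W \<and> x \<in> W \<and> (\<forall>k. Ck_on_open k W g) \<and> (\<forall>y\<in>W \<inter> S. g y = f y)"
      by (elim exE)
    then show ?thesis by (intro that[of W g]) simp_all
  qed
  have "(f has_derivative frechet_derivative g (at y)) (at y within S)" if y: "y \<in> W \<inter> S" for y
  proof -
    have "(g has_derivative frechet_derivative g (at y)) (at y)"
      using W(3)[of 1] y by (simp add: frechet_derivative_works[symmetric])
    then have "(g has_derivative frechet_derivative g (at y)) (at y within W \<inter> S)"
      by (rule has_derivative_at_withinI)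
    then have "(f has_derivative frechet_derivative g (at y)) (at y within W \<inter> S)"
      by (rule has_derivative_transform[rotated 2]) (use W y in auto)
    moreover have "at y within W \<inter> S = at y within S"
      using at_within_nhd[of y W "W \<inter> S" S] W y by auto
    ultimately show ?thesis by simp
  qed
  then show ?thesis using that W by blast
qed

text \<open>The axis derivatives of a local extension are again smooth, and uniqueness of the
  derivative within \<open>S\<close> identifies them with \<open>pd S i f\<close> on
  \<open>S\<close>.\<close>

lemma smooth_fun_on_pd:
  assumes S: "half_open S" and f: "smooth_fun_on S f"
  shows "smooth_fun_on S (pd S i f)"
  unfolding smooth_fun_on_def
proof
  fix x assume "x \<in> S"
  then obtain W g where W: "open W" "x \<in> W" "\<And>k. Ck_on_open k W g"
    "\<And>y. y \<in> W \<inter> S \<Longrightarrow> (f has_derivative frechet_derivative g (at y)) (at y within S)"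
    using smooth_fun_on_differentiable[OF f] by metis
  have "Ck_on_open k W (\<lambda>y. frechet_derivative g (at y) (axis i 1))" for k
    using W(3)[of "Suc k"] by simp
  moreover have "frechet_derivative g (at y) (axis i 1) = pd S i f y" if "y \<in> W \<inter> S" for y
    using pd_eqI[OF S _ W(4)[OF that]] that by simp
  ultimately show "\<exists>W g. open W \<and> x \<in> W \<and> (\<forall>k. Ck_on_open k W g) \<and> (\<forall>y\<in>W \<inter> S. g y = pd S i f y)"
    using W(1,2) by blast
qed

lemma smooth_fun_on_Ck:
  assumes S: "half_open S"
  shows "smooth_fun_on S f \<Longrightarrow> Ck k S f"
proof (induction k arbitrary: f)
  case 0
  have "continuous (at x within S) f" if "x \<in> S" for x
    using smooth_fun_on_differentiable[OF 0 that] that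
    by (metis IntI has_derivative_continuous)
  then show ?case by (simp add: continuous_on_eq_continuous_within)
next
  case (Suc k)
  have "f differentiable (at x within S)" if "x \<in> S" for x
    using smooth_fun_on_differentiable[OF Suc.prems that] that by (metis IntI differentiableI)
  then show ?case using Suc.IH smooth_fun_on_pd[OF S Suc.prems] by simp
qed

section \<open>Symmetry of mixed second derivatives\<close>

lemma has_real_derivative_line:
  fixes f :: "real^2 \<Rightarrow> real"
  assumes f: "f differentiable (at (p + t *\<^sub>R axis i 1) within S)" 
    and T: "\<And>s. s \<in> T \<Longrightarrow> p + s *\<^sub>R axis i 1 \<in> S"
  shows "((\<lambda>s. f (p + s *\<^sub>R axis i 1)) has_real_derivative pd S i f (p + t *\<^sub>R axis i 1)) (at t within T)"
proof -
  have 1: "((\<lambda>s. p + s *\<^sub>R axis i 1) has_derivative (\<lambda>h. h *\<^sub>R axis i 1)) (at t within T)"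
    by (auto intro!: derivative_eq_intros)
  have 2: "(f has_derivative frechet_derivative f (at (p + t *\<^sub>R axis i 1) within S)) (at (p + t *\<^sub>R axis i 1) within (\<lambda>s. p + s *\<^sub>R axis i 1) ` T)"
    using f T by (auto simp: frechet_derivative_works intro: has_derivative_subset)
  have 3: "frechet_derivative f (at (p + t *\<^sub>R axis i 1) within S) (h *\<^sub>R axis i 1) = pd S i f (p + t *\<^sub>R axis i 1) * h" for h
    using linear_scale[OF linear_frechet_derivative[OF f]] by (simp add: pd_def)
  show ?thesis
    using diff_chain_within[OF 1 2] by (simp add: has_field_derivative_def o_def 3 fun_eq_iff)
qed

text \<open>The squares point into the half-plane, so the argument also covers boundary points.\<close>

lemma mixed_difference:
  fixes f :: "real^2 \<Rightarrow> real"
  assumes f: "Ck 2 S f" and ij: "i \<noteq> (j::2)" and h: "h > 0"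
    and S: "\<And>s t. 0 \<le> s \<Longrightarrow> s \<le> h \<Longrightarrow> 0 \<le> t \<Longrightarrow> t \<le> h \<Longrightarrow> x + s *\<^sub>R axis i 1 + t *\<^sub>R axis j 1 \<in> S"
  obtains s t where "0 < s" "s < h" "0 < t" "t < h"
    "f (x + h *\<^sub>R axis i 1 + h *\<^sub>R axis j 1) - f (x + h *\<^sub>R axis i 1) - f (x + h *\<^sub>R axis j 1) + f x
      = h * h * pd S j (pd S i f) (x + s *\<^sub>R axis i 1 + t *\<^sub>R axis j 1)"
proof -
  have f2: "Ck (Suc (Suc 0)) S f" using f by (simp only: numeral_2_eq_2)
  have S': "x + t *\<^sub>R axis j 1 + s *\<^sub>R axis i 1 \<in> S" if "0 \<le> s" "s \<le> h" "0 \<le> t" "t \<le> h" for s t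
    using S[OF that] by (simp add: add_ac)
  define g where "g s = f (x + h *\<^sub>R axis j 1 + s *\<^sub>R axis i 1) - f (x + s *\<^sub>R axis i 1)" for s
  define g' where "g' s = pd S i f (x + h *\<^sub>R axis j 1 + s *\<^sub>R axis i 1) - pd S i f (x + s *\<^sub>R axis i 1)" for s
  have "(g has_real_derivative g' s) (at s within {0..h})" if s: "s \<in> {0..h}" for s
    unfolding g_def g'_def using S'[of _ h] S'[of _ 0] s h
    by (intro DERIV_diff has_real_derivative_line Ck_SucD(1)[OF f2]) auto
  then obtain s where s: "0 < s" "s < h" "g h - g 0 = (h - 0) * g' s"
    using mvt_simple[OF h, of g "\<lambda>s. (*) (g' s)"] by (auto simp: has_field_derivative_def mult.commute)
  define k where "k t = pd S i f (x + s *\<^sub>R axis i 1 + t *\<^sub>R axis j 1)" for t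
  have "(k has_real_derivative pd S j (pd S i f) (x + s *\<^sub>R axis i 1 + t *\<^sub>R axis j 1)) (at t within {0..h})" if t: "t \<in> {0..h}" for t
    unfolding k_def using S[of s] s t
    by (intro has_real_derivative_line Ck_SucD(1)[OF Ck_SucD(2)[OF f2]]) auto
  then obtain t where t: "0 < t" "t < h" "k h - k 0 = (h - 0) * pd S j (pd S i f) (x + s *\<^sub>R axis i 1 + t *\<^sub>R axis j 1)"
    using mvt_simple[OF h, of k "\<lambda>t. (*) (pd S j (pd S i f) (x + s *\<^sub>R axis i 1 + t *\<^sub>R axis j 1))"]
    by (auto simp: has_field_derivative_def mult.commute)
  have "g' s = k h - k 0" by (simp add: g'_def k_def add_ac)
  then show ?thesis
    using that[OF s(1,2) t(1,2)] s(3) t(3) by (simp add: g_def algebra_simps)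
qed

text \<open>One second difference over a small square equals h^2 times either mixed derivative, each
  taken at some point of the square. Continuity at the corner \<open>x\<close> then makes the two
  values agree up to any e.\<close>

lemma pd_commute_real:
  fixes f :: "real^2 \<Rightarrow> real"
  assumes S: "half_open S" and x: "x \<in> S" and f: "Ck 2 S f"
  shows "pd S 1 (pd S 2 f) x = pd S 2 (pd S 1 f) x"
proof -
  have f2: "Ck (Suc (Suc 0)) S f" using f by (simp only: numeral_2_eq_2)
  have cont: "continuous_on S (pd S i (pd S j f))" for i j
    using Ck_SucD(2)[OF Ck_SucD(2)[OF f2]] by simp
  obtain d where d: "d > 0" "\<And>y. 0 \<le> y $ 2 \<Longrightarrow> dist y x < d \<Longrightarrow> y \<in> S"
    by (rule half_open_ball[OF S x]) blast
  have "dist (pd S 1 (pd S 2 f) x) (pd S 2 (pd S 1 f) x) \<le> e" if e: "e > 0" for e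
  proof -
    obtain d1 where d1: "d1 > 0" "\<And>y. y \<in> S \<Longrightarrow> dist y x < d1 \<Longrightarrow> dist (pd S 1 (pd S 2 f) y) (pd S 1 (pd S 2 f) x) < e/2"
      using cont[of 1 2] x e unfolding continuous_on_iff by (metis half_gt_zero)
    obtain d2 where d2: "d2 > 0" "\<And>y. y \<in> S \<Longrightarrow> dist y x < d2 \<Longrightarrow> dist (pd S 2 (pd S 1 f) y) (pd S 2 (pd S 1 f) x) < e/2"
      using cont[of 2 1] x e unfolding continuous_on_iff by (metis half_gt_zero)
    \<comment> \<open>A point of the square of side h is within 2 h of its corner; the divisor 3
      makes this strictly less than each of the three radii.\<close>
    define h where "h = min d (min d1 d2) / 3"
    have h: "0 < h" "3 * h \<le> d" "3 * h \<le> d1" "3 * h \<le> d2" using d d1 d2 by (auto simp: h_def)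
    have near: "dist (x + s *\<^sub>R axis i 1 + t *\<^sub>R axis j 1) x < 3 * h" if "0 \<le> s" "s \<le> h" "0 \<le> t" "t \<le> h" for s t i j
    proof -
      have "norm (s *\<^sub>R axis i 1 + t *\<^sub>R (axis j 1 :: real^2)) \<le> s + t"
        using norm_triangle_ineq[of "s *\<^sub>R axis i 1" "t *\<^sub>R (axis j 1 :: real^2)"] that by simp
      then show ?thesis using that h by (simp add: dist_norm add.assoc)
    qed
    have inS: "x + s *\<^sub>R axis i 1 + t *\<^sub>R axis j 1 \<in> S" if "0 \<le> s" "s \<le> h" "0 \<le> t" "t \<le> h" for s t i j
      using near[OF that, of i j] h half_open_nonneg[OF S x] that
      by (intro d(2)) (auto simp: axis_def)
    obtain s t where 1: "0 < s" "s < h" "0 < t" "t < h"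
      "f (x + h *\<^sub>R axis 1 1 + h *\<^sub>R axis 2 1) - f (x + h *\<^sub>R axis 1 1) - f (x + h *\<^sub>R axis 2 1) + f x
      = h * h * pd S 2 (pd S 1 f) (x + s *\<^sub>R axis 1 1 + t *\<^sub>R axis 2 1)"
      using mixed_difference[OF f, of 1 2 h x] h(1) inS by auto
    obtain s' t' where 2: "0 < s'" "s' < h" "0 < t'" "t' < h"
      "f (x + h *\<^sub>R axis 2 1 + h *\<^sub>R axis 1 1) - f (x + h *\<^sub>R axis 2 1) - f (x + h *\<^sub>R axis 1 1) + f x
      = h * h * pd S 1 (pd S 2 f) (x + s' *\<^sub>R axis 2 1 + t' *\<^sub>R axis 1 1)"
      using mixed_difference[OF f, of 2 1 h x] h(1) inS by auto
    have "h * h * pd S 2 (pd S 1 f) (x + s *\<^sub>R axis 1 1 + t *\<^sub>R axis 2 1)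
        = h * h * pd S 1 (pd S 2 f) (x + s' *\<^sub>R axis 2 1 + t' *\<^sub>R axis 1 1)"
      using 1(5) 2(5) unfolding add.assoc[of x] add.commute[of "h *\<^sub>R axis 2 1" "h *\<^sub>R axis 1 1"]
      by linarith
    then have eq: "pd S 2 (pd S 1 f) (x + s *\<^sub>R axis 1 1 + t *\<^sub>R axis 2 1)
        = pd S 1 (pd S 2 f) (x + s' *\<^sub>R axis 2 1 + t' *\<^sub>R axis 1 1)"
      using h(1) by simp
    have "dist (pd S 2 (pd S 1 f) (x + s *\<^sub>R axis 1 1 + t *\<^sub>R axis 2 1)) (pd S 2 (pd S 1 f) x) < e/2"
      using near[of s t 1 2] inS[of s t 1 2] 1 h by (intro d2) auto
    moreover have "dist (pd S 1 (pd S 2 f) (x + s' *\<^sub>R axis 2 1 + t' *\<^sub>R axis 1 1)) (pd S 1 (pd S 2 f) x) < e/2"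
      using near[of s' t' 2 1] inS[of s' t' 2 1] 2 h by (intro d1) auto
    ultimately show ?thesis
      using eq unfolding dist_real_def by linarith
  qed
  then have "dist (pd S 1 (pd S 2 f) x) (pd S 2 (pd S 1 f) x) \<le> 0"
    by - (rule field_le_epsilon, simp)
  then show ?thesis by simp
qed

lemma pd_commute:
  fixes f :: "real^2 \<Rightarrow> 'b::euclidean_space"
  assumes S: "half_open S" and x: "x \<in> S" and f: "Ck 2 S f"
  shows "pd S 1 (pd S 2 f) x = pd S 2 (pd S 1 f) x"
proof (rule euclidean_eqI)
  fix b :: 'b assume "b \<in> Basis"
  have f2: "Ck (Suc (Suc 0)) S f" using f by (simp only: numeral_2_eq_2)
  have L: "bounded_linear (\<lambda>y. y \<bullet> b)" by (rule bounded_linear_inner_left)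
  have "pd S i (pd S j (\<lambda>y. f y \<bullet> b)) x = pd S i (pd S j f) x \<bullet> b" for i j
  proof -
    have "pd S i (pd S j (\<lambda>y. f y \<bullet> b)) x = pd S i (\<lambda>y. pd S j f y \<bullet> b) x"
      by (rule pd_cong[OF _ x]) (rule pd_linear[OF L S _ Ck_SucD(1)[OF f2]])
    also have "\<dots> = pd S i (pd S j f) x \<bullet> b"
      by (rule pd_linear[OF L S x Ck_SucD(1)[OF Ck_SucD(2)[OF f2] x]])
    finally show ?thesis .
  qed
  then show "pd S 1 (pd S 2 f) x \<bullet> b = pd S 2 (pd S 1 f) x \<bullet> b"
    using pd_commute_real[OF S x Ck_linear[OF L S f]] by metis
qed

section \<open>Change of charts\<close>

abbreviation cimg :: "'a coords \<Rightarrow> (real^2) set" where "cimg c \<equiv> cmap c ` cdom c"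

definition overlap :: "'a coords \<Rightarrow> 'a coords \<Rightarrow> (real^2) set" where
  "overlap c d = cmap c ` (cdom c \<inter> cdom d)"

definition tr :: "'a coords \<Rightarrow> 'a coords \<Rightarrow> real^2 \<Rightarrow> real^2" where
  "tr c d = cmap d \<circ> cinv c"

definition jac :: "'a coords \<Rightarrow> 'a coords \<Rightarrow> real^2 \<Rightarrow> real^2 \<Rightarrow> real^2" where
  "jac c d x = frechet_derivative (tr c d) (at x within overlap c d)"

lemma det_matrix_2:
  "det (matrix A) = A (axis 1 1) $ 1 * A (axis 2 1) $ 2 - A (axis 2 1) $ 1 * A (axis 1 1) $ (2::2)"
  for A :: "real^2 \<Rightarrow> real^2"
  by (simp add: det_2 matrix_def)

lemma cross_det:
  fixes L :: "real^2 \<Rightarrow> real^3" and A :: "real^2 \<Rightarrow> real^2"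
  assumes "linear L"
  shows "cross3 (L (A (axis 1 1))) (L (A (axis 2 1)))
    = det (matrix A) *\<^sub>R cross3 (L (axis 1 1)) (L (axis 2 1))"
proof -
  define a where "a = A (axis 1 1)"
  define b where "b = A (axis 2 1)"
  define u where "u = L (axis 1 1)"
  define v where "v = L (axis 2 1)"
  have "L a = a $ 1 *\<^sub>R u + a $ 2 *\<^sub>R v" "L b = b $ 1 *\<^sub>R u + b $ 2 *\<^sub>R v"
    unfolding u_def v_def by (rule linear_vec2[OF assms])+
  then show ?thesis
    unfolding det_matrix_2 a_def[symmetric] b_def[symmetric] u_def[symmetric] v_def[symmetric]
    by (simp add: cross_add_left cross_add_right cross_mult_left cross_mult_right cross_skew[of v u] algebra_simps)
qed

lemma cmap_overlap: "p \<in> cdom c \<Longrightarrow> p \<in> cdom d \<Longrightarrow> cmap c p \<in> overlap c d"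
  by (auto simp: overlap_def)

lemma overlapE:
  assumes "x \<in> overlap c d"
  obtains p where "p \<in> cdom c" "p \<in> cdom d" "x = cmap c p"
  using assms by (auto simp: overlap_def)

lemma linear_differential:
  assumes "(f \<circ> cinv c) differentiable (at (cmap c p) within cimg c)"
  shows "linear (differential c f p)"
  unfolding differential_def using assms by (rule linear_frechet_derivative)

locale surface =
  fixes M :: "'a::t2_space set" and \<A> :: "'a coords set"
  assumes compact_oriented_surface: "compact_oriented_surface M \<A>"
begin

lemma compact_M: "compact M"
  and Union_cdom: "(\<Union>c\<in>\<A>. cdom c) = M"
  using compact_oriented_surface by (auto simp: compact_oriented_surface_def)

context
  fixes c assumes c: "c \<in> \<A>"
begin

lemma chart_homeomorphism: "homeomorphism (cdom c) (cimg c) (cmap c) (cinv c)"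
  and openin_cdom: "openin (top_of_set M) (cdom c)"
  and half_open_cimg: "half_open (cimg c)"
  using c compact_oriented_surface by (auto simp: compact_oriented_surface_def local_coords_def)

lemma cdom_subset: "cdom c \<subseteq> M"
  using openin_cdom openin_imp_subset by blast

lemma cinv_cmap: "p \<in> cdom c \<Longrightarrow> cinv c (cmap c p) = p"
  using chart_homeomorphism by (auto simp: homeomorphism_def)

lemma cmap_cinv: "x \<in> cimg c \<Longrightarrow> cmap c (cinv c x) = x"
  using chart_homeomorphism by (auto simp: homeomorphism_def)

lemma cinv_cdom: "x \<in> cimg c \<Longrightarrow> cinv c x \<in> cdom c"
  by (simp add: inv_into_into)

lemma openin_overlap: "openin (top_of_set (cimg c)) (overlap c d)" if "d \<in> \<A>"
proof -
  have "openin (top_of_set M) (cdom d)"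
    using that compact_oriented_surface by (auto simp: compact_oriented_surface_def local_coords_def)
  then obtain U where "open U" "cdom d = M \<inter> U" by (auto simp: openin_open)
  then have "openin (top_of_set (cdom c)) (cdom c \<inter> cdom d)"
    using cdom_subset by (auto simp: openin_open)
  then show ?thesis
    unfolding overlap_def using homeomorphism_imp_open_map[OF chart_homeomorphism] by blast
qed

end

lemma half_open_overlap: "c \<in> \<A> \<Longrightarrow> d \<in> \<A> \<Longrightarrow> half_open (overlap c d)"
  using openin_overlap[of c d] half_open_cimg[of c] openin_trans by blast

context
  fixes c d assumes cd: "c \<in> \<A>" "d \<in> \<A>"
begin

lemma tr_cmap: "p \<in> cdom c \<Longrightarrow> tr c d (cmap c p) = cmap d p"
  by (simp add: tr_def cinv_cmap[OF cd(1)])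

lemma smooth_tr: "Ck k (overlap c d) (tr c d)"
  and det_jac_pos: "x \<in> overlap c d \<Longrightarrow> 0 < det (matrix (jac c d x))"
proof -
  have *: "oriented_transition c d" using cd compact_oriented_surface
    by (auto simp: compact_oriented_surface_def)
  show "Ck k (overlap c d) (tr c d)"
    using * by (intro smooth_fun_on_Ck half_open_overlap cd) (simp add: oriented_transition_def Let_def overlap_def tr_def)
  show "0 < det (matrix (jac c d x))" if "x \<in> overlap c d"
    using * that by (auto simp: oriented_transition_def Let_def overlap_def tr_def jac_def)
qed

lemma has_derivative_tr:
  assumes "x \<in> overlap c d"
  shows "(tr c d has_derivative jac c d x) (at x within cimg c)"
  using Ck_SucD(1)[OF smooth_tr assms] at_within_openin[OF openin_overlap[OF cd] assms]
  by (simp add: jac_def frechet_derivative_works)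

text \<open>On the overlap \<open>f \<circ> cinv c\<close> factors through the transition map, so
  the chain rule applies there; relative openness of the overlap makes the result a derivative
  within the whole chart image. Differentiability of \<open>f\<close> at the one point is enough, so
  the lemma also serves the unit normal.\<close>

lemma has_derivative_change_chart:
  assumes p: "p \<in> cdom c" "p \<in> cdom d"
    and f: "(f \<circ> cinv d) differentiable (at (cmap d p) within cimg d)"
  shows "((f \<circ> cinv c) has_derivative (\<lambda>v. differential d f p (jac c d (cmap c p) v))) (at (cmap c p) within cimg c)"
proof -
  let ?x = "cmap c p"
  have x: "?x \<in> overlap c d" using p by (rule cmap_overlap)
  have sub: "overlap c d \<subseteq> cimg c" by (auto simp: overlap_def)
  have 1: "(tr c d has_derivative jac c d ?x) (at ?x within overlap c d)"
    using has_derivative_subset[OF has_derivative_tr[OF x] sub] .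
  have "tr c d ` overlap c d \<subseteq> cimg d"
    by (auto simp: overlap_def tr_cmap)
  then have 2: "((f \<circ> cinv d) has_derivative differential d f p) (at (tr c d ?x) within tr c d ` overlap c d)"
    using f unfolding tr_cmap[OF p(1)] differential_def frechet_derivative_works
    by (rule has_derivative_subset[rotated])
  have 3: "((f \<circ> cinv d \<circ> tr c d) has_derivative (differential d f p \<circ> jac c d ?x)) (at ?x within overlap c d)"
    by (rule diff_chain_within[OF 1 2])
  have 4: "(f \<circ> cinv d \<circ> tr c d) y = (f \<circ> cinv c) y" if "y \<in> overlap c d" for y
    using that by (elim overlapE) (simp add: tr_cmap cinv_cmap[OF cd(1)] cinv_cmap[OF cd(2)])
  have "((f \<circ> cinv c) has_derivative (differential d f p \<circ> jac c d ?x)) (at ?x within overlap c d)"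
    by (rule has_derivative_transform[OF x _ 3]) (simp only: 4)
  then show ?thesis
    unfolding at_within_openin[OF openin_overlap[OF cd] x] by (simp add: o_def)
qed

lemma differential_change_chart:
  assumes p: "p \<in> cdom c" "p \<in> cdom d"
    and f: "(f \<circ> cinv d) differentiable (at (cmap d p) within cimg d)"
  shows "differential c f p v = differential d f p (jac c d (cmap c p) v)"
  unfolding differential_def[of c]
  by (subst half_open_frechet_eq[OF half_open_cimg[OF cd(1)] _ has_derivative_change_chart[OF assms]])
     (use p in auto)

lemma coord_cross_change_chart:
  assumes p: "p \<in> cdom c" "p \<in> cdom d"
    and f: "(f \<circ> cinv d) differentiable (at (cmap d p) within cimg d)"
  shows "coord_cross c f p = det (matrix (jac c d (cmap c p))) *\<^sub>R coord_cross d f p"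
proof -
  have "linear (differential d f p)"
    unfolding differential_def using f by (rule linear_frechet_derivative)
  from cross_det[OF this] show ?thesis
    unfolding coord_cross_def pderiv_in_def by (simp add: differential_change_chart[OF assms])
qed

end

text \<open>Otherwise the second coordinate of the inverse transition would attain its minimum \<open>0\<close> at an
  interior point, and its derivative there would be singular.\<close>

lemma boundary_chart_indep:
  assumes cd: "c \<in> \<A>" "d \<in> \<A>" and p: "p \<in> cdom c" "p \<in> cdom d" and 0: "cmap c p $ 2 = 0"
  shows "cmap d p $ 2 = 0"
proof (rule ccontr)
  assume ne: "cmap d p $ 2 \<noteq> 0"
  define y where "y = cmap d p"
  have y: "y \<in> overlap d c" using p by (auto simp: y_def overlap_def)
  have y2: "y $ 2 > 0"
    using ne half_open_nonneg[OF half_open_overlap[OF cd(2,1)] y] by (simp add: y_def)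
  obtain e where e: "e > 0" "\<And>z. 0 \<le> z $ 2 \<Longrightarrow> dist z y < e \<Longrightarrow> z \<in> overlap d c"
    by (rule half_open_ball[OF half_open_overlap[OF cd(2,1)] y]) blast
  define U where "U = ball y (min e (y $ 2))"
  have U: "open U" "y \<in> U" using e(1) y2 by (auto simp: U_def)
  have sub: "U \<subseteq> overlap d c"
  proof
    fix z assume z: "z \<in> U"
    have "\<bar>(z - y) $ 2\<bar> \<le> dist z y" using component_le_norm_cart[of "z - y" 2] by (simp add: dist_norm)
    then show "z \<in> overlap d c" using z e(2)[of z] by (auto simp: U_def dist_commute)
  qed
  have "(tr d c has_derivative jac d c y) (at y within U)"
    by (rule has_derivative_subset[OF has_derivative_tr[OF cd(2,1) y]]) (use sub in \<open>auto simp: overlap_def\<close>)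
  then have der: "((\<lambda>z. tr d c z $ 2) has_derivative (\<lambda>v. jac d c y v $ 2)) (at y)"
    using at_within_open[OF U(2,1)] bounded_linear.has_derivative[OF bounded_linear_vec_nth] by metis
  have "(\<lambda>v. jac d c y v $ 2) = (\<lambda>v. 0)"
  proof (rule differential_zero_maxmin[OF U(2,1) der])
    have "tr d c y $ 2 \<le> tr d c z $ 2" if z: "z \<in> U" for z
    proof -
      obtain q where q: "q \<in> cdom d" "q \<in> cdom c" "z = cmap d q" using subsetD[OF sub z] by (auto simp: overlap_def)
      have "0 \<le> cmap c q $ 2" using half_open_nonneg[OF half_open_cimg[OF cd(1)]] q by auto
      then show ?thesis
        using q 0 p by (simp add: y_def tr_cmap[OF cd(2,1)])
    qed
    then show "(\<forall>z\<in>U. tr d c z $ 2 \<le> tr d c y $ 2) \<or> (\<forall>z\<in>U. tr d c y $ 2 \<le> tr d c z $ 2)" by blast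
  qed
  then have "det (matrix (jac d c y)) = 0"
    by (simp add: det_matrix_2 fun_eq_iff)
  then show False using det_jac_pos[OF cd(2,1) y] by simp
qed

text \<open>The second coordinate of the transition is nonnegative and, by
  \<open>boundary_chart_indep\<close>, zero along the boundary line. Its derivative along the line
  is therefore zero and its inward derivative nonnegative; the positive determinant makes both
  diagonal entries strictly positive.\<close>

lemma jac_boundary:
  assumes cd: "c \<in> \<A>" "d \<in> \<A>" and p: "p \<in> cdom c" "p \<in> cdom d" and 0: "cmap c p $ 2 = 0"
  shows "jac c d (cmap c p) (axis 1 1) $ 2 = 0" "0 < jac c d (cmap c p) (axis 1 1) $ 1"
    "0 < jac c d (cmap c p) (axis 2 1) $ 2"
proof -
  define x where "x = cmap c p"
  define S where "S = overlap c d"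
  have x: "x \<in> S" using p by (auto simp: x_def overlap_def S_def)
  have S: "half_open S" unfolding S_def by (rule half_open_overlap[OF cd])
  have x2: "x $ 2 = 0" by (simp add: x_def 0)
  obtain e where e: "e > 0" "\<And>z. 0 \<le> z $ 2 \<Longrightarrow> dist z x < e \<Longrightarrow> z \<in> S"
    by (rule half_open_ball[OF S x]) blast
  define f where "f z = tr c d z $ 2" for z
  have "(tr c d has_derivative jac c d x) (at x within S)"
    by (rule has_derivative_subset[OF has_derivative_tr[OF cd x[unfolded S_def]]]) (auto simp: overlap_def S_def)
  then have der: "(f has_derivative (\<lambda>v. jac c d x v $ 2)) (at x within S)"
    unfolding f_def by (rule bounded_linear.has_derivative[OF bounded_linear_vec_nth])
  have pd: "pd S i f x = jac c d x (axis i 1) $ 2" for i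
    by (rule pd_eqI[OF S x der])
  have nonneg: "0 \<le> f z" if z: "z \<in> S" for z
  proof -
    obtain q where q: "q \<in> cdom c" "q \<in> cdom d" "z = cmap c q" using z by (auto simp: overlap_def S_def)
    then show ?thesis
      using half_open_nonneg[OF half_open_cimg[OF cd(2)]] by (auto simp: f_def tr_cmap[OF cd])
  qed
  have zero: "f z = 0" if z: "z \<in> S" "z $ 2 = 0" for z
  proof -
    obtain q where q: "q \<in> cdom c" "q \<in> cdom d" "z = cmap c q" using z by (auto simp: overlap_def S_def)
    then show ?thesis
      using boundary_chart_indep[OF cd q(1,2)] z by (auto simp: f_def tr_cmap[OF cd])
  qed
  have in1: "x + s *\<^sub>R axis 1 1 \<in> S" if "\<bar>s\<bar> < e" for s
    using that x2 by (intro e(2)) (auto simp: axis_def dist_norm norm_vec_def L2_set_def sum_2)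
  have in2: "x + s *\<^sub>R axis 2 1 \<in> S" if "0 \<le> s" "s < e" for s
    using that x2 by (intro e(2)) (auto simp: axis_def dist_norm norm_vec_def L2_set_def sum_2)
  have fd: "f differentiable (at (x + 0 *\<^sub>R axis i 1) within S)" for i
    using der by (auto simp: differentiable_def)
  have "((\<lambda>s. f (x + s *\<^sub>R axis 1 1)) has_real_derivative pd S 1 f (x + 0 *\<^sub>R axis 1 1)) (at 0 within {-e<..<e})"
    by (rule has_real_derivative_line[OF fd]) (use in1 in auto)
  then have d1: "((\<lambda>s. f (x + s *\<^sub>R axis 1 1)) has_real_derivative pd S 1 f x) (at 0 within {-e<..<e})"
    by simp
  have "((\<lambda>s. 0) has_real_derivative pd S 1 f x) (at 0 within {-e<..<e})"
    by (rule has_field_derivative_transform_within[OF d1 e(1)])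
       (use e(1) in1 zero x2 in \<open>auto simp: axis_def\<close>)
  then have "((\<lambda>s::real. 0::real) has_real_derivative pd S 1 f x) (at 0)"
    using at_within_open[of 0 "{-e<..<e}"] e(1) by simp
  then have "pd S 1 f x = 0" using DERIV_unique DERIV_const by blast
  then show a: "jac c d (cmap c p) (axis 1 1) $ 2 = 0" using pd by (simp add: x_def)
  \<comment> \<open>Only nonnegative parameters stay in the half-plane, so this derivative is
    one-sided and yields an inequality rather than a value.\<close>
  have "((\<lambda>s. f (x + s *\<^sub>R axis 2 1)) has_real_derivative pd S 2 f (x + 0 *\<^sub>R axis 2 1)) (at 0 within {0..<e})"
    by (rule has_real_derivative_line[OF fd]) (use in2 in auto)
  then have d2: "((\<lambda>s. f (x + s *\<^sub>R axis 2 1)) has_real_derivative pd S 2 f x) (at 0 within {0..<e})"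
    by simp
  have b: "0 \<le> pd S 2 f x"
  proof (rule ccontr)
    assume "\<not> 0 \<le> pd S 2 f x"
    then obtain \<delta> where \<delta>: "\<delta> > 0" "\<And>h. h > 0 \<Longrightarrow> 0 + h \<in> {0..<e} \<Longrightarrow> h < \<delta> \<Longrightarrow> f (x + 0 *\<^sub>R axis 2 1) > f (x + (0 + h) *\<^sub>R axis 2 1)"
      using has_real_derivative_neg_dec_right[OF d2] by (metis not_le)
    define h where "h = min e \<delta> / 2"
    have h: "0 < h" "h < e" "h < \<delta>" using e(1) \<delta>(1) by (auto simp: h_def)
    show False using \<delta>(2)[of h] h nonneg[OF in2[of h]] zero[OF x x2] by auto
  qed
  \<comment> \<open>With the lower left entry zero, the determinant is the product of the diagonal
    entries.\<close>
  have "0 < jac c d x (axis 1 1) $ 1 * jac c d x (axis 2 1) $ 2"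
    using det_jac_pos[OF cd x[unfolded S_def]] a unfolding det_matrix_2 x_def by simp
  then show "0 < jac c d (cmap c p) (axis 1 1) $ 1" "0 < jac c d (cmap c p) (axis 2 1) $ 2"
    using b pd[of 2] unfolding x_def by (auto simp: zero_less_mult_iff)
qed

end

section \<open>Area and length measures\<close>

text \<open>The finite cover is cut into disjoint pieces, each inside one \<open>D i\<close>, and
  the local measures of the pieces are added; compatibility makes the sum agree with every
  \<open>N i\<close>, also for indices outside the finite subcover. Two candidates agree on each
  piece, hence everywhere.\<close>

lemma glue_measures:
  fixes D :: "'i \<Rightarrow> 'a set" and N :: "'i \<Rightarrow> 'a measure"
  assumes I: "finite I" "I \<subseteq> A" "space Q \<subseteq> (\<Union>i\<in>I. D i)"
    and D: "\<And>i. i \<in> A \<Longrightarrow> D i \<inter> space Q \<in> sets Q"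
    and N: "\<And>i. i \<in> A \<Longrightarrow> sets (N i) = sets Q"
    and compat: "\<And>i j B. i \<in> A \<Longrightarrow> j \<in> A \<Longrightarrow> B \<in> sets Q \<Longrightarrow> B \<subseteq> D i \<Longrightarrow> B \<subseteq> D j
      \<Longrightarrow> emeasure (N i) B = emeasure (N j) B"
  shows "\<exists>!\<mu>. sets \<mu> = sets Q \<and> (\<forall>i\<in>A. \<forall>B\<in>sets \<mu>. B \<subseteq> D i \<longrightarrow> emeasure \<mu> B = emeasure (N i) B)"
proof -
  obtain n and f :: "nat \<Rightarrow> 'i" where f: "f ` {..<n} = I"
    using finite_imp_nat_seg_image_inj_on[OF I(1)] by (auto simp: lessThan_def)
  have fA: "f k \<in> A" if "k < n" for k using f I(2) that by auto
  define E where "E k = D (f k) \<inter> space Q - (\<Union>j<k. D (f j) \<inter> space Q)" for k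
  have E: "E k \<in> sets Q" if "k < n" for k
    unfolding E_def using that by (intro sets.Diff sets.finite_UN D fA) auto
  have ED: "E k \<subseteq> D (f k)" for k by (auto simp: E_def)
  have disj: "disjoint_family_on E {..<n}"
    unfolding disjoint_family_on_def
  proof (intro ballI impI)
    fix k l assume "k \<in> {..<n}" "l \<in> {..<n}" "k \<noteq> l"
    then show "E k \<inter> E l = {}" by (cases "k < l") (auto simp: E_def)
  qed
  have cover: "space Q \<subseteq> (\<Union>k<n. E k)"
  proof
    fix x assume x: "x \<in> space Q"
    then have "\<exists>k. k < n \<and> x \<in> D (f k)" using I(3) f by fastforce
    then obtain k where k: "k < n" "x \<in> D (f k)" "\<And>j. j < k \<Longrightarrow> \<not> (j < n \<and> x \<in> D (f j))"
      using exists_least_iff[of "\<lambda>k. k < n \<and> x \<in> D (f k)"] by auto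
    then show "x \<in> (\<Union>k<n. E k)" using x by (auto simp: E_def)
  qed
  have split: "emeasure \<nu> B = (\<Sum>k<n. emeasure \<nu> (B \<inter> E k))" if "sets \<nu> = sets Q" "B \<in> sets Q" for \<nu> B
    using that E disj cover sets.sets_into_space[OF that(2)] by (intro sum_emeasure_cover) auto
  define m where "m B = (\<Sum>k<n. emeasure (N (f k)) (B \<inter> E k))" for B
  define \<mu> where "\<mu> = measure_of (space Q) (sets Q) m"
  have sets_\<mu>: "sets \<mu> = sets Q" by (simp add: \<mu>_def)
  have "countably_additive (sets Q) m"
  proof (rule countably_additiveI)
    fix B :: "nat \<Rightarrow> 'a set" assume B: "range B \<subseteq> sets Q" "disjoint_family B" "(\<Union>i. B i) \<in> sets Q"
    have "(\<Sum>i. m (B i)) = (\<Sum>k<n. \<Sum>i. emeasure (N (f k)) (B i \<inter> E k))"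
      unfolding m_def by (rule suminf_sum) simp
    also have "\<dots> = (\<Sum>k<n. emeasure (N (f k)) (\<Union>i. B i \<inter> E k))"
    proof (intro sum.cong refl suminf_emeasure)
      fix k assume "k \<in> {..<n}"
      then show "range (\<lambda>i. B i \<inter> E k) \<subseteq> sets (N (f k))"
        using B(1) E N[OF fA] by auto
      show "disjoint_family (\<lambda>i. B i \<inter> E k)"
        using B(2) by (auto simp: disjoint_family_on_def)
    qed
    also have "\<dots> = m (\<Union>i. B i)" by (simp add: m_def)
    finally show "(\<Sum>i. m (B i)) = m (\<Union>i. B i)" .
  qed
  then have em: "emeasure \<mu> B = m B" if "B \<in> sets Q" for B
    unfolding \<mu>_def using that
    by (intro emeasure_measure_of_sigma sets.sigma_algebra_axioms) (auto simp: positive_def m_def)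
  have ex: "emeasure \<mu> B = emeasure (N i) B" if i: "i \<in> A" "B \<in> sets Q" "B \<subseteq> D i" for i B
  proof -
    have "m B = (\<Sum>k<n. emeasure (N i) (B \<inter> E k))"
      unfolding m_def using i E ED by (intro sum.cong refl compat fA) auto
    then show ?thesis using em[OF i(2)] split[OF N[OF i(1)] i(2)] by simp
  qed
  show ?thesis
  proof (rule ex1I[of _ \<mu>])
    show "sets \<mu> = sets Q \<and> (\<forall>i\<in>A. \<forall>B\<in>sets \<mu>. B \<subseteq> D i \<longrightarrow> emeasure \<mu> B = emeasure (N i) B)"
      using sets_\<mu> ex by auto
    fix \<nu> assume \<nu>: "sets \<nu> = sets Q \<and> (\<forall>i\<in>A. \<forall>B\<in>sets \<nu>. B \<subseteq> D i \<longrightarrow> emeasure \<nu> B = emeasure (N i) B)"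
    show "\<nu> = \<mu>"
    proof (rule measure_eqI)
      show "sets \<nu> = sets \<mu>" using \<nu> sets_\<mu> by simp
      fix B assume "B \<in> sets \<nu>"
      then have B: "B \<in> sets Q" using \<nu> by simp
      have "emeasure \<nu> (B \<inter> E k) = emeasure \<mu> (B \<inter> E k)" if "k < n" for k
      proof -
        have "B \<inter> E k \<in> sets Q" "B \<inter> E k \<subseteq> D (f k)" using B E[OF that] ED[of k] by auto
        then show ?thesis using \<nu> ex[OF fA[OF that]] fA[OF that] by metis
      qed
      then show "emeasure \<nu> B = emeasure \<mu> B"
        using split[of \<nu> B] split[of \<mu> B] \<nu> sets_\<mu> B by simp
    qed
  qed
qed

section \<open>Change of variables for nonnegative integrals\<close>

text \<open>Infinite values are included: for a nonnegative function the extended integral is the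
  ordinary one if the function is absolutely integrable, and infinite otherwise. Equivalent
  integrability and equal ordinary integrals thus settle both cases.\<close>

lemma nn_integral_eq_of_integral_eq:
  fixes f :: "'a::euclidean_space \<Rightarrow> real" and h :: "'b::euclidean_space \<Rightarrow> real"
  assumes f: "(\<lambda>y. indicator T y * f y) \<in> borel_measurable borel" "\<And>y. y \<in> T \<Longrightarrow> 0 \<le> f y"
    and h: "(\<lambda>x. indicator S x * h x) \<in> borel_measurable borel" "\<And>x. x \<in> S \<Longrightarrow> 0 \<le> h x"
    and iff: "f absolutely_integrable_on T \<longleftrightarrow> h absolutely_integrable_on S"
    and eq: "f absolutely_integrable_on T \<Longrightarrow> integral T f = integral S h"
  shows "(\<integral>\<^sup>+y\<in>T. ennreal (f y) \<partial>lborel) = (\<integral>\<^sup>+x\<in>S. ennreal (h x) \<partial>lborel)"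
proof -
  have *: "(\<integral>\<^sup>+y\<in>T. ennreal (f y) \<partial>lborel) = (if f absolutely_integrable_on T then ennreal (integral T f) else \<infinity>)"
    if f: "(\<lambda>y. indicator T y * f y) \<in> borel_measurable borel" "\<And>y. y \<in> T \<Longrightarrow> 0 \<le> f y"
    for f :: "'c::euclidean_space \<Rightarrow> real" and T
  proof -
    have 1: "(\<integral>\<^sup>+y\<in>T. ennreal (f y) \<partial>lborel) = (\<integral>\<^sup>+y. ennreal (indicator T y * f y) \<partial>lebesgue)"
      unfolding nn_integral_completion by (rule nn_integral_cong) (simp split: split_indicator)
    have m: "(\<lambda>y. indicator T y * f y) \<in> borel_measurable lebesgue"
      using f(1) by (simp add: measurable_completion)
    have 2: "AE y in lebesgue. 0 \<le> indicator T y * f y"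
      using f(2) by (auto split: split_indicator)
    show ?thesis
    proof (cases "f absolutely_integrable_on T")
      case True
      then have int: "integrable lebesgue (\<lambda>y. indicator T y * f y)" by (simp add: set_integrable_def)
      show ?thesis
        using nn_integral_eq_integral[OF int 2] set_lebesgue_integral_eq_integral(2)[OF True] True 1
        by (simp add: set_lebesgue_integral_def)
    next
      case False
      then have "\<not> integrable lebesgue (\<lambda>y. indicator T y * f y)" by (simp add: set_integrable_def)
      then show ?thesis
        using integrableI_nonneg[OF m 2] False 1 by (auto simp: top.not_eq_extremum[symmetric])
    qed
  qed
  show ?thesis
    using *[OF f] *[OF h] iff eq by simp
qed

lemma nn_integral_change_of_variables:
  fixes g :: "real^'m::{finite,wellorder} \<Rightarrow> real^'m::_" and f :: "real^'m::_ \<Rightarrow> real"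
  assumes f: "(\<lambda>y. indicator (g ` S) y * f y) \<in> borel_measurable borel" "\<And>y. y \<in> g ` S \<Longrightarrow> 0 \<le> f y"
    and h: "(\<lambda>x. indicator S x * h x) \<in> borel_measurable borel" 
    and S: "S \<in> sets borel"
    and der: "\<And>x. x \<in> S \<Longrightarrow> (g has_derivative g' x) (at x within S)" and inj: "inj_on g S"
    and eq: "\<And>x. x \<in> S \<Longrightarrow> h x = \<bar>det (matrix (g' x))\<bar> * f (g x)"
  shows "(\<integral>\<^sup>+y\<in>g ` S. ennreal (f y) \<partial>lborel) = (\<integral>\<^sup>+x\<in>S. ennreal (h x) \<partial>lborel)"
proof -
  have "S \<in> sets lebesgue" using S by simp
  \<comment> \<open>The multidimensional change of variables takes vector-valued integrands, so
    \<open>f\<close> enters as a function into \<open>real^1\<close>.\<close>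
  note cov = has_absolute_integral_change_of_variables[OF this der inj, of "\<lambda>y. vec (f y) :: real^1"]
  have "(\<lambda>x. \<bar>det (matrix (g' x))\<bar> * f (g x)) absolutely_integrable_on S \<and> integral S (\<lambda>x. \<bar>det (matrix (g' x))\<bar> * f (g x)) = b
    \<longleftrightarrow> f absolutely_integrable_on g ` S \<and> integral (g ` S) f = b" for b
    using cov[of "vec b"] by (simp add: absolutely_integrable_on_1_iff integral_on_1_eq)
  moreover have "h absolutely_integrable_on S \<longleftrightarrow> (\<lambda>x. \<bar>det (matrix (g' x))\<bar> * f (g x)) absolutely_integrable_on S"
    unfolding set_integrable_def by (intro arg_cong[of _ _ "integrable lebesgue"]) (auto simp: eq split: split_indicator)
  moreover have "integral S h = integral S (\<lambda>x. \<bar>det (matrix (g' x))\<bar> * f (g x))"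
    by (rule integral_cong) (rule eq)
  ultimately show ?thesis
    using f h eq by (intro nn_integral_eq_of_integral_eq) auto
qed

lemma nn_integral_change_of_variables_real:
  fixes g f :: "real \<Rightarrow> real"
  assumes f: "(\<lambda>y. indicator (g ` S) y * f y) \<in> borel_measurable borel" "\<And>y. y \<in> g ` S \<Longrightarrow> 0 \<le> f y"
    and h: "(\<lambda>x. indicator S x * h x) \<in> borel_measurable borel" 
    and S: "S \<in> sets borel"
    and der: "\<And>x. x \<in> S \<Longrightarrow> (g has_real_derivative g' x) (at x within S)" and inj: "inj_on g S"
    and eq: "\<And>x. x \<in> S \<Longrightarrow> h x = \<bar>g' x\<bar> * f (g x)"
  shows "(\<integral>\<^sup>+y\<in>g ` S. ennreal (f y) \<partial>lborel) = (\<integral>\<^sup>+x\<in>S. ennreal (h x) \<partial>lborel)"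
proof -
  have "S \<in> sets lebesgue" using S by simp
  note cov = has_absolute_integral_change_of_variables_1'[OF this der inj, of f]
  moreover have "h absolutely_integrable_on S \<longleftrightarrow> (\<lambda>x. \<bar>g' x\<bar> * f (g x)) absolutely_integrable_on S"
    unfolding set_integrable_def by (intro arg_cong[of _ _ "integrable lebesgue"]) (auto simp: eq split: split_indicator)
  moreover have "integral S h = integral S (\<lambda>x. \<bar>g' x\<bar> * f (g x))"
    by (rule integral_cong) (rule eq)
  ultimately show ?thesis
    using f h eq by (intro nn_integral_eq_of_integral_eq) auto
qed

section \<open>Push-forward measures and integrals over compact boxes\<close>

text \<open>Covers area and length at once: \<open>T\<close> is a chart image in the plane or a
  piece of the real line, and \<open>w\<close> the coordinate density.\<close>

definition param_measure :: "'a::t2_space set \<Rightarrow> 'e::euclidean_space set \<Rightarrow> ('e \<Rightarrow> real) \<Rightarrow> ('e \<Rightarrow> 'a) \<Rightarrow> 'a measure" where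
  "param_measure X T w \<phi> = distr (density (restrict_space lborel T) (\<lambda>x. ennreal (w x))) (restrict_space borel X) \<phi>"

lemma sets_param_measure [simp, measurable_cong]: "sets (param_measure X T w \<phi>) = sets (restrict_space borel X)"
  by (simp add: param_measure_def)

context
  fixes X :: "'a::t2_space set" and T :: "'e::euclidean_space set" and w :: "'e \<Rightarrow> real" and \<phi> :: "'e \<Rightarrow> 'a"
  assumes T: "T \<in> sets borel" and w: "continuous_on T w" "\<And>x. x \<in> T \<Longrightarrow> 0 \<le> w x"
    and \<phi>: "continuous_on T \<phi>" "\<phi> ` T \<subseteq> X"
begin

lemma param_measurable: "\<phi> \<in> measurable (restrict_space lborel T) (restrict_space borel X)"
proof (rule measurable_restrict_space2)
  show "\<phi> \<in> space (restrict_space lborel T) \<rightarrow> X" using \<phi>(2) by (auto simp: space_restrict_space)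
  have "\<phi> \<in> measurable (restrict_space borel T) borel" by (rule borel_measurable_continuous_on_restrict[OF \<phi>(1)])
  then show "\<phi> \<in> measurable (restrict_space lborel T) borel"
    by (simp cong: measurable_cong_sets add: sets_restrict_space)
qed

lemma weight_measurable: "w \<in> borel_measurable (restrict_space lborel T)"
proof -
  have "w \<in> measurable (restrict_space borel T) borel" by (rule borel_measurable_continuous_on_restrict[OF w(1)])
  then show ?thesis
    by (simp cong: measurable_cong_sets add: sets_restrict_space)
qed

lemma param_preimage_borel: "B \<in> sets (restrict_space borel X) \<Longrightarrow> {x\<in>T. \<phi> x \<in> B} \<in> sets borel"
  using measurable_sets[OF param_measurable, of B] T
  by (simp add: sets_restrict_space_iff space_restrict_space vimage_def Int_def conj_commute)

lemma emeasure_param_measure: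
  assumes B: "B \<in> sets (restrict_space borel X)"
  shows "emeasure (param_measure X T w \<phi>) B = (\<integral>\<^sup>+x\<in>{x\<in>T. \<phi> x \<in> B}. ennreal (w x) \<partial>lborel)"
proof -
  have [measurable]: "{x \<in> T. \<phi> x \<in> B} \<in> sets (restrict_space lborel T)"
    using param_preimage_borel[OF B] T by (simp add: sets_restrict_space_iff)
  have "emeasure (param_measure X T w \<phi>) B = emeasure (density (restrict_space lborel T) (\<lambda>x. ennreal (w x))) {x\<in>T. \<phi> x \<in> B}"
    unfolding param_measure_def using param_measurable B
    by (subst emeasure_distr) (auto simp: space_restrict_space vimage_def Int_def conj_commute)
  also have "\<dots> = (\<integral>\<^sup>+x. ennreal (w x) * indicator {x \<in> T. \<phi> x \<in> B} x \<partial>restrict_space lborel T)"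
    using weight_measurable by (subst emeasure_density) auto
  also have "\<dots> = (\<integral>\<^sup>+x\<in>{x\<in>T. \<phi> x \<in> B}. ennreal (w x) \<partial>lborel)"
    using T by (subst nn_integral_restrict_space) (auto intro!: nn_integral_cong split: split_indicator)
  finally show ?thesis .
qed

text \<open>The measure \<open>\<mu>\<close> is known only on subsets of \<open>D\<close>, but on
  \<open>X\<close> the function \<open>f\<close> is supported in the image of a compact box inside
  \<open>D\<close>. Cutting \<open>\<mu>\<close> and the push-forward down to \<open>D\<close> makes
  them equal and leaves the integral of \<open>f\<close> unchanged; for the push-forward it is a box
  integral.\<close>

lemma param_integral:
  fixes f :: "'a \<Rightarrow> real" and a b :: 'e
  assumes \<mu>: "sets \<mu> = sets (restrict_space borel X)" "D \<inter> X \<in> sets (restrict_space borel X)"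
      "\<And>B. B \<in> sets \<mu> \<Longrightarrow> B \<subseteq> D \<Longrightarrow> emeasure \<mu> B = emeasure (param_measure X T w \<phi>) B"
    and D: "\<phi> ` T \<subseteq> D" and inj: "inj_on \<phi> T"
    and ab: "cbox a b \<subseteq> T" and f0: "\<And>p. p \<in> X - \<phi> ` cbox a b \<Longrightarrow> f p = 0"
    and fc: "continuous_on (cbox a b) (\<lambda>x. f (\<phi> x))"
  shows "integrable \<mu> f" "integral\<^sup>L \<mu> f = integral (cbox a b) (\<lambda>x. f (\<phi> x) * w x)"
proof -
  let ?Q = "restrict_space borel X" and ?N = "param_measure X T w \<phi>"
  define K where "K = \<phi> ` cbox a b"
  have K: "compact K" "K \<subseteq> X" using ab \<phi> continuous_on_subset[OF \<phi>(1) ab]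
    by (auto simp: K_def intro!: compact_continuous_image)
  have KQ: "K \<in> sets ?Q"
    using borel_closed[OF compact_imp_closed[OF K(1)]] K(2) by (auto simp: sets_restrict_space)
  \<comment> \<open>On a compact box the injective continuous \<open>\<phi>\<close> has a continuous
    inverse, so continuity of \<open>f\<close> in the parameter gives continuity on
    \<open>K\<close>. Being zero on the rest of \<open>X\<close>, \<open>f\<close> is then
    measurable.\<close>
  have fK: "continuous_on K f"
  proof -
    define g where "g = the_inv_into (cbox a b) \<phi>"
    have inj': "inj_on \<phi> (cbox a b)" using inj ab by (rule inj_on_subset)
    have g: "continuous_on K g" unfolding K_def g_def
      by (intro continuous_on_inv_into continuous_on_subset[OF \<phi>(1) ab] inj') auto
    have "g ` K \<subseteq> cbox a b" unfolding K_def g_def using inj' by (auto simp: the_inv_into_f_f)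
    then have "continuous_on K (\<lambda>p. f (\<phi> (g p)))"
      using continuous_on_compose2[OF fc g] by blast
    then show ?thesis
      by (rule continuous_on_eq) (auto simp: K_def g_def the_inv_into_f_f[OF inj'])
  qed
  have fm: "f \<in> borel_measurable ?Q"
  proof -
    have "f \<in> measurable (restrict_space ?Q K) borel"
      using borel_measurable_continuous_on_restrict[OF fK] K(2)
      by (subst measurable_cong_sets[OF _ refl, of _ "restrict_space borel K"])
         (simp_all add: sets_restrict_restrict_space inf.absorb2)
    moreover have "{p \<in> X. p \<in> K} = K" using K(2) by auto
    ultimately have "(\<lambda>p. if p \<in> K then f p else 0) \<in> borel_measurable ?Q"
      using KQ by (subst measurable_If_restrict_space_iff) (auto simp: pred_def space_restrict_space intro: sets.sets_into_space)
    then show ?thesis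
      by (rule measurable_cong[THEN iffD1, rotated]) (auto simp: space_restrict_space f0 K_def)
  qed
  have fm\<mu>: "f \<in> borel_measurable \<mu>" using fm by (simp cong: measurable_cong_sets add: \<mu>(1))
  have ind': "(indicator D :: 'a \<Rightarrow> real) \<in> borel_measurable \<nu>" if "sets \<nu> = sets ?Q" for \<nu>
    using \<mu>(2) sets_eq_imp_space_eq[OF that] that
    by (simp add: borel_measurable_indicator_iff space_restrict_space Int_commute)
  have dens: "density \<mu> (\<lambda>p. ennreal (indicator D p)) = density ?N (\<lambda>p. ennreal (indicator D p))"
  proof (rule measure_eqI)
    show "sets (density \<mu> (\<lambda>p. ennreal (indicator D p))) = sets (density ?N (\<lambda>p. ennreal (indicator D p)))"
      by (simp add: \<mu>(1))
    fix B assume "B \<in> sets (density \<mu> (\<lambda>p. ennreal (indicator D p)))"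
    then have B: "B \<in> sets ?Q" by (simp add: \<mu>(1))
    have BX: "B \<subseteq> X" using sets.sets_into_space[OF B] by (simp add: space_restrict_space)
    have BD: "B \<inter> D \<in> sets ?Q"
    proof -
      have "B \<inter> D = B \<inter> (D \<inter> X)" using BX by auto
      then show ?thesis using B \<mu>(2) by auto
    qed
    have *: "emeasure (density \<nu> (\<lambda>p. ennreal (indicator D p))) B = emeasure \<nu> (B \<inter> D)" if "sets \<nu> = sets ?Q" for \<nu>
    proof -
      have "emeasure (density \<nu> (\<lambda>p. ennreal (indicator D p))) B = (\<integral>\<^sup>+p. ennreal (indicator D p) * indicator B p \<partial>\<nu>)"
        using ind'[OF that] B that by (intro emeasure_density) auto
      also have "\<dots> = (\<integral>\<^sup>+p. indicator (B \<inter> D) p \<partial>\<nu>)"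
        by (rule nn_integral_cong) (auto split: split_indicator)
      also have "\<dots> = emeasure \<nu> (B \<inter> D)" using BD that by (simp add: nn_integral_indicator)
      finally show ?thesis .
    qed
    show "emeasure (density \<mu> (\<lambda>p. ennreal (indicator D p))) B = emeasure (density ?N (\<lambda>p. ennreal (indicator D p))) B"
      unfolding *[OF \<mu>(1)] *[OF sets_param_measure] using BD \<mu>(1) by (intro \<mu>(3)) auto
  qed
  have fD: "indicator D p * f p = f p" if "p \<in> X" for p
    using f0[of p] that D ab by (auto split: split_indicator)
  have *: "(integrable \<nu> f \<longleftrightarrow> integrable (density \<nu> (\<lambda>p. ennreal (indicator D p))) f) \<and> integral\<^sup>L \<nu> f = integral\<^sup>L (density \<nu> (\<lambda>p. ennreal (indicator D p))) f"
    if s: "sets \<nu> = sets ?Q" for \<nu>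
  proof -
    have m: "f \<in> borel_measurable \<nu>" using fm by (simp cong: measurable_cong_sets add: s)
    have sp: "space \<nu> = X" using sets_eq_imp_space_eq[OF s] by (simp add: space_restrict_space)
    have "integrable \<nu> (\<lambda>p. indicator D p * f p) = integrable \<nu> f"
      by (rule Bochner_Integration.integrable_cong) (simp_all add: sp fD)
    moreover have "integral\<^sup>L \<nu> (\<lambda>p. indicator D p * f p) = integral\<^sup>L \<nu> f"
      by (rule Bochner_Integration.integral_cong) (simp_all add: sp fD)
    ultimately show ?thesis
      using integrable_density[OF m ind'[OF s]] integral_density[OF m ind'[OF s]] by simp
  qed
  have eqN: "integrable \<mu> f \<longleftrightarrow> integrable ?N f" "integral\<^sup>L \<mu> f = integral\<^sup>L ?N f"
    using *[OF \<mu>(1), unfolded dens] *[OF sets_param_measure[of X T w \<phi>]] by simp_all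
  have wf: "(\<lambda>x. f (\<phi> x)) \<in> borel_measurable (restrict_space lborel T)"
    using measurable_compose[OF param_measurable fm] .
  \<comment> \<open>For a parameter in \<open>T\<close> off the box, injectivity keeps
    \<open>\<phi> x\<close> out of the image of the box, so \<open>f\<close> is zero there.\<close>
  have box: "indicator T x *\<^sub>R (w x *\<^sub>R f (\<phi> x)) = indicator (cbox a b) x *\<^sub>R (f (\<phi> x) * w x)" for x
  proof (cases "x \<in> T - cbox a b")
    case True
    then have "\<phi> x \<notin> \<phi> ` cbox a b" using inj ab by (auto dest: inj_onD)
    then show ?thesis using True f0[of "\<phi> x"] \<phi>(2) by auto
  next
    case False
    then show ?thesis using ab by (auto split: split_indicator)
  qed
  have cont: "continuous_on (cbox a b) (\<lambda>x. f (\<phi> x) * w x)"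
    by (intro continuous_intros fc continuous_on_subset[OF w(1) ab])
  have int: "set_integrable lborel (cbox a b) (\<lambda>x. f (\<phi> x) * w x)"
    unfolding set_integrable_def by (rule borel_integrable_compact[OF _ cont]) simp
  have sp: "integrable ?N f \<longleftrightarrow> integrable (restrict_space lborel T) (\<lambda>x. w x *\<^sub>R f (\<phi> x))"
    "integral\<^sup>L ?N f = integral\<^sup>L (restrict_space lborel T) (\<lambda>x. w x *\<^sub>R f (\<phi> x))"
  proof -
    have ae: "AE x in restrict_space lborel T. 0 \<le> w x"
      using w(2) by (intro AE_I2) (simp add: space_restrict_space)
    have m2: "\<phi> \<in> measurable (density (restrict_space lborel T) (\<lambda>x. ennreal (w x))) ?Q"
      using param_measurable by (simp cong: measurable_cong_sets)
    show "integrable ?N f \<longleftrightarrow> integrable (restrict_space lborel T) (\<lambda>x. w x *\<^sub>R f (\<phi> x))"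
      unfolding param_measure_def
      using integrable_distr_eq[OF m2 fm] integrable_density[OF wf weight_measurable ae] by simp
    show "integral\<^sup>L ?N f = integral\<^sup>L (restrict_space lborel T) (\<lambda>x. w x *\<^sub>R f (\<phi> x))"
      unfolding param_measure_def
      using integral_distr[OF m2 fm] integral_density[OF wf weight_measurable ae] by simp
  qed
  have Tl: "T \<inter> space lborel \<in> sets lborel" using T by simp
  show "integrable \<mu> f"
    unfolding eqN sp integrable_restrict_space[OF Tl] box using int by (simp add: set_integrable_def)
  have "integral\<^sup>L \<mu> f = (LINT x:cbox a b|lborel. f (\<phi> x) * w x)"
    unfolding eqN sp integral_restrict_space[OF Tl] box by (simp add: set_lebesgue_integral_def)
  also have "\<dots> = integral (cbox a b) (\<lambda>x. f (\<phi> x) * w x)"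
    by (rule set_borel_integral_eq_integral(2)[OF int])
  finally show "integral\<^sup>L \<mu> f = integral (cbox a b) (\<lambda>x. f (\<phi> x) * w x)" .
qed

end

section \<open>Coordinate weights, and the area measure\<close>

definition area_weight :: "'a coords \<Rightarrow> ('a \<Rightarrow> real^3) \<Rightarrow> real^2 \<Rightarrow> real" where
  "area_weight c R x = norm (coord_cross c R (cinv c x))"

definition boundary_param :: "'a coords \<Rightarrow> real \<Rightarrow> 'a" where
  "boundary_param c s = cinv c (vector [s, 0])"

definition boundary_weight :: "'a coords \<Rightarrow> ('a \<Rightarrow> real^3) \<Rightarrow> real \<Rightarrow> real" where
  "boundary_weight c R s = norm (pderiv_in c 1 R (boundary_param c s))"

definition boundary_line :: "'a coords \<Rightarrow> real set" where
  "boundary_line c = {s. vector [s, 0] \<in> cimg c}"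

lemma vector_s0: "(vector [s, 0] :: real^2) = s *\<^sub>R axis 1 1"
  by (simp add: vec_eq_iff forall_2 axis_def)

lemma continuous_on_vector_s0: "continuous_on T (\<lambda>s. vector [s, 0] :: real^2)"
  unfolding vector_s0 by (intro continuous_intros)

context surface
begin

lemma finite_chart_cover:
  obtains I where "finite I" "I \<subseteq> \<A>" "M \<subseteq> (\<Union>c\<in>I. cdom c)"
proof -
  have "\<forall>U\<in>cdom ` \<A>. openin (top_of_set M) U" using openin_cdom by auto
  moreover have "M \<subseteq> \<Union> (cdom ` \<A>)" using Union_cdom by auto
  ultimately obtain D where "D \<subseteq> cdom ` \<A>" "finite D" "M \<subseteq> \<Union>D"
    using compact_M unfolding compact_eq_openin_cover by meson
  then show ?thesis using that by (metis finite_subset_image)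
qed

text \<open>Unlike \<^const>\<open>smooth_on_surface\<close>, which asks for smooth local extensions, this version is
  visibly stable under forming \<open>R + t V\<close>.\<close>

definition smooth_in_charts :: "('a \<Rightarrow> 'b::real_normed_vector) \<Rightarrow> bool" where
  "smooth_in_charts f \<longleftrightarrow> (\<forall>c\<in>\<A>. \<forall>k. Ck k (cimg c) (f \<circ> cinv c))"

lemma smooth_on_surface_in_charts: "smooth_on_surface \<A> f \<Longrightarrow> smooth_in_charts f"
  unfolding smooth_in_charts_def smooth_on_surface_def by (blast intro: smooth_fun_on_Ck half_open_cimg)

lemma smooth_rep: "smooth_in_charts f \<Longrightarrow> c \<in> \<A> \<Longrightarrow> Ck k (cimg c) (f \<circ> cinv c)"
  by (simp add: smooth_in_charts_def)

lemma smooth_rep_differentiable: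
  assumes "smooth_in_charts f" "c \<in> \<A>" "p \<in> cdom c"
  shows "(f \<circ> cinv c) differentiable (at (cmap c p) within cimg c)"
  using Ck_SucD(1)[OF smooth_rep[OF assms(1,2)]] assms(3) by blast

lemma pderiv_in_cinv:
  "c \<in> \<A> \<Longrightarrow> x \<in> cimg c \<Longrightarrow> pderiv_in c i f (cinv c x) = pd (cimg c) i (f \<circ> cinv c) x"
  by (simp add: pderiv_in_def differential_def pd_def cmap_cinv)

lemma coord_cross_cinv:
  "c \<in> \<A> \<Longrightarrow> x \<in> cimg c \<Longrightarrow>
    coord_cross c R (cinv c x) = cross3 (pd (cimg c) 1 (R \<circ> cinv c) x) (pd (cimg c) 2 (R \<circ> cinv c) x)"
  by (simp add: coord_cross_def pderiv_in_cinv)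

lemma continuous_area_weight:
  assumes "smooth_in_charts R" "c \<in> \<A>"
  shows "continuous_on (cimg c) (area_weight c R)"
proof -
  have "Ck 0 (cimg c) (pd (cimg c) i (R \<circ> cinv c))" for i
    by (rule Ck_SucD(2)[OF smooth_rep[OF assms]])
  then have "continuous_on (cimg c) (\<lambda>x. norm (cross3 (pd (cimg c) 1 (R \<circ> cinv c) x) (pd (cimg c) 2 (R \<circ> cinv c) x)))"
    by (intro continuous_intros continuous_on_cross) simp_all
  then show ?thesis
    by (rule continuous_on_eq) (simp add: area_weight_def coord_cross_cinv[OF assms(2)])
qed

lemma continuous_cinv: "c \<in> \<A> \<Longrightarrow> continuous_on (cimg c) (cinv c)"
  using chart_homeomorphism[of c] by (simp add: homeomorphism_def)

lemma borel_cimg: assumes "c \<in> \<A>" shows "cimg c \<in> sets borel"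
proof -
  obtain U where "open U" "cimg c = half_plane \<inter> U"
    using half_open_cimg[OF assms] by (auto simp: openin_open)
  moreover have "closed half_plane"
    unfolding half_plane_def by (intro closed_Collect_le continuous_intros)
  ultimately show ?thesis by auto
qed

lemma cdom_sets: "c \<in> \<A> \<Longrightarrow> X \<subseteq> M \<Longrightarrow> cdom c \<inter> X \<in> sets (restrict_space borel X)"
proof -
  assume *: "c \<in> \<A>" "X \<subseteq> M"
  obtain U where "open U" "cdom c = M \<inter> U"
    using openin_cdom[OF *(1)] by (auto simp: openin_open)
  then have "cdom c \<inter> X = X \<inter> U" "U \<in> sets borel" using *(2) by auto
  then show ?thesis by (auto simp: sets_restrict_space)
qed

lemma preimage_cinv:
  assumes "c \<in> \<A>" "B \<subseteq> cdom c"
  shows "{x \<in> cimg c. cinv c x \<in> B} = cmap c ` B"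
  using assms by (auto simp: cmap_cinv cinv_cmap image_iff)

lemma cinv_image_subset: "c \<in> \<A> \<Longrightarrow> cinv c ` cimg c \<subseteq> M"
  using cinv_cdom cdom_subset by blast

lemma inj_cinv: "c \<in> \<A> \<Longrightarrow> inj_on (cinv c) (cimg c)"
  by (rule inj_onI) (metis cmap_cinv)

definition "area_chart R c = param_measure M (cimg c) (area_weight c R) (cinv c)"

lemma emeasure_area_chart:
  assumes R: "smooth_in_charts R" and c: "c \<in> \<A>" and B: "B \<in> sets (restrict_space borel M)" "B \<subseteq> cdom c"
  shows "emeasure (area_chart R c) B = (\<integral>\<^sup>+x\<in>cmap c ` B. ennreal (area_weight c R x) \<partial>lborel)"
  unfolding area_chart_def
  using emeasure_param_measure[OF borel_cimg[OF c] continuous_area_weight[OF R c] _ continuous_cinv[OF c] cinv_image_subset[OF c] B(1)]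
    preimage_cinv[OF c B(2)] by (simp add: area_weight_def)

text \<open>Change of variables along \<open>tr c d\<close>: by
  \<open>coord_cross_change_chart\<close> the area weight picks up exactly the Jacobian
  determinant.\<close>

lemma area_chart_compatible:
  assumes R: "smooth_in_charts R" and c: "c \<in> \<A>" and d: "d \<in> \<A>"
    and B: "B \<in> sets (restrict_space borel M)" "B \<subseteq> cdom c" "B \<subseteq> cdom d"
  shows "emeasure (area_chart R c) B = emeasure (area_chart R d) B"
proof -
  have borel: "cmap c ` B \<in> sets borel" if "c \<in> \<A>" "B \<subseteq> cdom c" for c
    using param_preimage_borel[OF borel_cimg[OF that(1)] continuous_area_weight[OF R that(1)] _ continuous_cinv[OF that(1)] cinv_image_subset[OF that(1)] B(1)]
      preimage_cinv[OF that] by (simp add: area_weight_def)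
  have meas: "(\<lambda>x. indicator (cmap c ` B) x * area_weight c R x) \<in> borel_measurable borel" if "c \<in> \<A>" "B \<subseteq> cdom c" for c
    using borel_measurable_continuous_on_indicator[OF borel[OF that] continuous_on_subset[OF continuous_area_weight[OF R that(1)]]] that(2)
    by (simp add: image_mono)
  have im: "tr c d ` cmap c ` B = cmap d ` B"
    using B(2) by (force simp: image_image tr_cmap[OF c d])
  have "(\<integral>\<^sup>+x\<in>tr c d ` cmap c ` B. ennreal (area_weight d R x) \<partial>lborel) = (\<integral>\<^sup>+x\<in>cmap c ` B. ennreal (area_weight c R x) \<partial>lborel)"
  proof (rule nn_integral_change_of_variables)
    show "(\<lambda>y. indicator (tr c d ` cmap c ` B) y * area_weight d R y) \<in> borel_measurable borel"
      unfolding im by (rule meas[OF d B(3)])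
    show "(\<lambda>x. indicator (cmap c ` B) x * area_weight c R x) \<in> borel_measurable borel"
      by (rule meas[OF c B(2)])
    show "cmap c ` B \<in> sets borel" by (rule borel[OF c B(2)])
    show "0 \<le> area_weight d R y" for y by (simp add: area_weight_def)
    show "inj_on (tr c d) (cmap c ` B)"
    proof (rule inj_onI)
      fix x y assume "x \<in> cmap c ` B" "y \<in> cmap c ` B" and eq: "tr c d x = tr c d y"
      then obtain p q where p: "p \<in> B" "q \<in> B" "x = cmap c p" "y = cmap c q" by auto
      have *: "p \<in> cdom c" "q \<in> cdom c" "p \<in> cdom d" "q \<in> cdom d" using p B by auto
      have "cmap d p = cmap d q" using eq p(3,4) tr_cmap[OF c d *(1)] tr_cmap[OF c d *(2)] by simp
      then have "cinv d (cmap d p) = cinv d (cmap d q)" by (rule arg_cong)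
      then have "p = q" unfolding cinv_cmap[OF d *(3)] cinv_cmap[OF d *(4)] .
      then show "x = y" using p by simp
    qed
    fix x assume "x \<in> cmap c ` B"
    then obtain p where p: "p \<in> B" "x = cmap c p" by auto
    have x: "x \<in> overlap c d" using p B by (auto simp: overlap_def)
    show "(tr c d has_derivative jac c d x) (at x within cmap c ` B)"
      by (rule has_derivative_subset[OF has_derivative_tr[OF c d x]]) (use B(2) in auto)
    have pc: "p \<in> cdom c" "p \<in> cdom d" using p B by auto
    have "coord_cross c R p = det (matrix (jac c d (cmap c p))) *\<^sub>R coord_cross d R p"
      by (rule coord_cross_change_chart[OF c d pc smooth_rep_differentiable[OF R d pc(2)]])
    then show "area_weight c R x = \<bar>det (matrix (jac c d x))\<bar> * area_weight d R (tr c d x)"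
      using p pc by (simp add: area_weight_def tr_cmap[OF c d] cinv_cmap[OF c] cinv_cmap[OF d])
  qed
  then show ?thesis
    using emeasure_area_chart[OF R c B(1,2)] emeasure_area_chart[OF R d B(1,3)] im by simp
qed

text \<open>Gluing shows that the description defining the area measure has a unique solution.
  Smoothness is all that is asked of \<open>R\<close>, so the measure is available for each deformed
  map \<open>R + t V\<close>.\<close>

lemma area_measure:
  assumes R: "smooth_in_charts R"
  shows "sets (area_measure M \<A> R) = sets (restrict_space borel M)"
    and "\<And>c B. c \<in> \<A> \<Longrightarrow> B \<in> sets (area_measure M \<A> R) \<Longrightarrow> B \<subseteq> cdom c \<Longrightarrow>
      emeasure (area_measure M \<A> R) B = emeasure (area_chart R c) B"
proof -
  obtain I where I: "finite I" "I \<subseteq> \<A>" "M \<subseteq> (\<Union>c\<in>I. cdom c)" by (rule finite_chart_cover)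
  have "\<exists>!\<mu>. sets \<mu> = sets (restrict_space borel M) \<and>
    (\<forall>c\<in>\<A>. \<forall>B\<in>sets \<mu>. B \<subseteq> cdom c \<longrightarrow> emeasure \<mu> B = emeasure (area_chart R c) B)"
  proof (rule glue_measures[OF I(1,2)])
    show "space (restrict_space borel M) \<subseteq> (\<Union>c\<in>I. cdom c)"
      using I(3) by (simp add: space_restrict_space)
    show "cdom c \<inter> space (restrict_space borel M) \<in> sets (restrict_space borel M)" if "c \<in> \<A>" for c
      using cdom_sets[OF that subset_refl] by (simp add: space_restrict_space)
  qed (simp add: area_chart_def, rule area_chart_compatible[OF R])
  note * = theI'[OF this]
  have "area_measure M \<A> R = (THE \<mu>. sets \<mu> = sets (restrict_space borel M) \<and>
    (\<forall>c\<in>\<A>. \<forall>B\<in>sets \<mu>. B \<subseteq> cdom c \<longrightarrow> emeasure \<mu> B = emeasure (area_chart R c) B))"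
    unfolding area_measure_def
    by (intro arg_cong[of _ _ The] ext conj_cong ball_cong imp_cong refl)
       (simp add: emeasure_area_chart[OF R] area_weight_def)
  with * show "sets (area_measure M \<A> R) = sets (restrict_space borel M)"
    and "\<And>c B. c \<in> \<A> \<Longrightarrow> B \<in> sets (area_measure M \<A> R) \<Longrightarrow> B \<subseteq> cdom c \<Longrightarrow>
      emeasure (area_measure M \<A> R) B = emeasure (area_chart R c) B" by auto
qed

lemma area_integral:
  fixes f :: "'a \<Rightarrow> real"
  assumes R: "smooth_in_charts R" and c: "c \<in> \<A>" and ab: "cbox a b \<subseteq> cimg c"
    and f0: "\<And>p. p \<in> M - cinv c ` cbox a b \<Longrightarrow> f p = 0"
    and fc: "continuous_on (cbox a b) (\<lambda>x. f (cinv c x))"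
  shows "integrable (area_measure M \<A> R) f"
    "integral\<^sup>L (area_measure M \<A> R) f = integral (cbox a b) (\<lambda>x. f (cinv c x) * area_weight c R x)"
proof -
  have w: "0 \<le> area_weight c R x" for x by (simp add: area_weight_def)
  have D: "cinv c ` cimg c \<subseteq> cdom c" using cinv_cdom[OF c] by auto
  note * = param_integral[OF borel_cimg[OF c] continuous_area_weight[OF R c] w continuous_cinv[OF c] cinv_image_subset[OF c]
    area_measure(1)[OF R] cdom_sets[OF c subset_refl] area_measure(2)[OF R c, unfolded area_chart_def] D inj_cinv[OF c] ab f0 fc]
  from * show "integrable (area_measure M \<A> R) f"
    "integral\<^sup>L (area_measure M \<A> R) f = integral (cbox a b) (\<lambda>x. f (cinv c x) * area_weight c R x)"
    by auto
qed

section \<open>The length measure of the boundary\<close>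

lemma boundary_subset: "surface_boundary \<A> \<subseteq> M"
  using Union_cdom by (auto simp: surface_boundary_def)

lemma boundary_iff: "c \<in> \<A> \<Longrightarrow> p \<in> cdom c \<Longrightarrow> p \<in> surface_boundary \<A> \<longleftrightarrow> cmap c p $ 2 = 0"
  unfolding surface_boundary_def by (blast intro: boundary_chart_indep)

lemma boundary_lineD:
  assumes "c \<in> \<A>" "s \<in> boundary_line c"
  shows "boundary_param c s \<in> cdom c" "cmap c (boundary_param c s) = vector [s, 0]"
    "boundary_param c s \<in> surface_boundary \<A>"
proof -
  show 1: "boundary_param c s \<in> cdom c" and 2: "cmap c (boundary_param c s) = vector [s, 0]"
    using assms cinv_cdom cmap_cinv by (auto simp: boundary_line_def boundary_param_def)
  show "boundary_param c s \<in> surface_boundary \<A>"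
    using 1 2 boundary_iff[OF assms(1)] by simp
qed

lemma cmap_boundary:
  assumes "c \<in> \<A>" "p \<in> cdom c" "p \<in> surface_boundary \<A>"
  shows "cmap c p = vector [cmap c p $ 1, 0]" "cmap c p $ 1 \<in> boundary_line c" "boundary_param c (cmap c p $ 1) = p"
proof -
  show *: "cmap c p = vector [cmap c p $ 1, 0]"
    using boundary_iff[OF assms(1,2)] assms(3) by (simp add: vec_eq_iff forall_2)
  show "cmap c p $ 1 \<in> boundary_line c" "boundary_param c (cmap c p $ 1) = p"
    using assms(2) cinv_cmap[OF assms(1,2)] *[symmetric] by (auto simp: boundary_line_def boundary_param_def)
qed

lemma continuous_boundary_param: "c \<in> \<A> \<Longrightarrow> continuous_on (boundary_line c) (boundary_param c)"
  unfolding boundary_param_def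
  by (rule continuous_on_compose2[OF continuous_cinv continuous_on_vector_s0]) (auto simp: boundary_line_def)

lemma borel_boundary_line: "c \<in> \<A> \<Longrightarrow> boundary_line c \<in> sets borel"
proof -
  assume "c \<in> \<A>"
  have "(\<lambda>s. vector [s, 0] :: real^2) \<in> borel_measurable borel"
    by (rule borel_measurable_continuous_onI[OF continuous_on_vector_s0])
  from measurable_sets[OF this borel_cimg[OF \<open>c \<in> \<A>\<close>]] show ?thesis
    by (simp add: boundary_line_def vimage_def)
qed

lemma continuous_boundary_weight:
  assumes "smooth_in_charts R" "c \<in> \<A>"
  shows "continuous_on (boundary_line c) (boundary_weight c R)"
proof -
  have "Ck 0 (cimg c) (pd (cimg c) 1 (R \<circ> cinv c))"
    by (rule Ck_SucD(2)[OF smooth_rep[OF assms]])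
  then have "continuous_on (cimg c) (pd (cimg c) 1 (R \<circ> cinv c))" by simp
  then have "continuous_on (boundary_line c) (\<lambda>s. pd (cimg c) 1 (R \<circ> cinv c) (vector [s, 0]))"
    by (rule continuous_on_compose2[OF _ continuous_on_vector_s0]) (auto simp: boundary_line_def)
  then have "continuous_on (boundary_line c) (\<lambda>s. norm (pd (cimg c) 1 (R \<circ> cinv c) (vector [s, 0])))"
    by (intro continuous_intros)
  then show ?thesis
    by (rule continuous_on_eq)
       (auto simp: boundary_weight_def boundary_param_def boundary_line_def pderiv_in_cinv[OF assms(2)])
qed

lemma preimage_boundary_param:
  assumes c: "c \<in> \<A>" and B: "B \<subseteq> cdom c" "B \<subseteq> surface_boundary \<A>"
  shows "{s \<in> boundary_line c. boundary_param c s \<in> B} = {s. vector [s, 0] \<in> cmap c ` B}"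
proof (intro set_eqI iffI; clarify)
  fix s assume "s \<in> boundary_line c" "boundary_param c s \<in> B"
  then show "vector [s, 0] \<in> cmap c ` B" using boundary_lineD(2)[OF c] by (metis imageI)
next
  fix s p assume p: "vector [s, 0] = cmap c p" "p \<in> B"
  then have "s = cmap c p $ 1" by (metis vector_2(1))
  then show "s \<in> boundary_line c \<and> boundary_param c s \<in> B"
    using cmap_boundary(2,3)[OF c subsetD[OF B(1) p(2)] subsetD[OF B(2) p(2)]] p(2) by simp
qed

lemma boundary_param_image: "c \<in> \<A> \<Longrightarrow> boundary_param c ` boundary_line c \<subseteq> surface_boundary \<A>"
  by (intro image_subsetI boundary_lineD(3))

lemma inj_boundary_param: "c \<in> \<A> \<Longrightarrow> inj_on (boundary_param c) (boundary_line c)"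
  by (rule inj_onI) (metis boundary_lineD(2) vector_2(1))

definition "boundary_chart R c = param_measure (surface_boundary \<A>) (boundary_line c) (boundary_weight c R) (boundary_param c)"

lemma boundary_sets_subset: "B \<in> sets (restrict_space borel (surface_boundary \<A>)) \<Longrightarrow> B \<subseteq> surface_boundary \<A>"
  by (auto simp: sets_restrict_space)

lemma emeasure_boundary_chart:
  assumes R: "smooth_in_charts R" and c: "c \<in> \<A>"
    and B: "B \<in> sets (restrict_space borel (surface_boundary \<A>))" "B \<subseteq> cdom c"
  shows "emeasure (boundary_chart R c) B = (\<integral>\<^sup>+s\<in>{s. vector [s, 0] \<in> cmap c ` B}. ennreal (boundary_weight c R s) \<partial>lborel)"
  unfolding boundary_chart_def
  using emeasure_param_measure[OF borel_boundary_line[OF c] continuous_boundary_weight[OF R c] _ continuous_boundary_param[OF c] boundary_param_image[OF c] B(1)]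
    preimage_boundary_param[OF c B(2) boundary_sets_subset[OF B(1)]] by (simp add: boundary_weight_def)

text \<open>On the boundary the Jacobian maps the first axis to a multiple of itself, so boundary
  tangents of two charts are proportional; by \<open>jac_boundary\<close> the factor is
  positive.\<close>

lemma pderiv_boundary_change_chart:
  assumes R: "smooth_in_charts R" and cd: "c \<in> \<A>" "d \<in> \<A>" 
    and p: "p \<in> cdom c" "p \<in> cdom d" "p \<in> surface_boundary \<A>"
  shows "pderiv_in c 1 R p = (jac c d (cmap c p) (axis 1 1) $ 1) *\<^sub>R pderiv_in d 1 R p"
proof -
  have 0: "cmap c p $ 2 = 0" using p boundary_iff[OF cd(1)] by simp
  have "jac c d (cmap c p) (axis 1 1) = (jac c d (cmap c p) (axis 1 1) $ 1) *\<^sub>R axis 1 1"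
    using jac_boundary(1)[OF cd p(1,2) 0] by (simp add: vec_eq_iff forall_2 axis_def)
  then have "pderiv_in c 1 R p = differential d R p ((jac c d (cmap c p) (axis 1 1) $ 1) *\<^sub>R axis 1 1)"
    unfolding pderiv_in_def using differential_change_chart[OF cd p(1,2) smooth_rep_differentiable[OF R cd(2) p(2)]]
    by metis
  also have "\<dots> = (jac c d (cmap c p) (axis 1 1) $ 1) *\<^sub>R pderiv_in d 1 R p"
    unfolding pderiv_in_def by (rule linear_scale[OF linear_differential[OF smooth_rep_differentiable[OF R cd(2) p(2)]]])
  finally show ?thesis .
qed

text \<open>One-dimensional change of variables along \<open>g\<close>, the first coordinate of the
  transition restricted to the boundary line. Its derivative is exactly the factor by which the
  boundary tangents of the two charts differ.\<close>

lemma boundary_chart_compatible: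
  assumes R: "smooth_in_charts R" and c: "c \<in> \<A>" and d: "d \<in> \<A>"
    and B: "B \<in> sets (restrict_space borel (surface_boundary \<A>))" "B \<subseteq> cdom c" "B \<subseteq> cdom d"
  shows "emeasure (boundary_chart R c) B = emeasure (boundary_chart R d) B"
proof -
  define L where "L c = {s. vector [s, 0] \<in> cmap c ` B}" for c :: "'a coords"
  have Bb: "B \<subseteq> surface_boundary \<A>" by (rule boundary_sets_subset[OF B(1)])
  have borel: "L c \<in> sets borel" if "c \<in> \<A>" "B \<subseteq> cdom c" for c
    using param_preimage_borel[OF borel_boundary_line[OF that(1)] continuous_boundary_weight[OF R that(1)] _ continuous_boundary_param[OF that(1)] boundary_param_image[OF that(1)] B(1)]
      preimage_boundary_param[OF that Bb] by (simp add: boundary_weight_def L_def)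
  have meas: "(\<lambda>x. indicator (L c) x * boundary_weight c R x) \<in> borel_measurable borel" if "c \<in> \<A>" "B \<subseteq> cdom c" for c
  proof -
    have "L c \<subseteq> boundary_line c" using that by (auto simp: L_def boundary_line_def)
    then show ?thesis
      using borel_measurable_continuous_on_indicator[OF borel[OF that] continuous_on_subset[OF continuous_boundary_weight[OF R that(1)]]]
      by simp
  qed
  have LE: "\<exists>p\<in>B. s = cmap c p $ 1 \<and> vector [s, 0] = cmap c p" if "s \<in> L c" for s c
    using that unfolding L_def by (metis (no_types, lifting) imageE mem_Collect_eq vector_2(1))
  have Lmem: "cmap c p $ 1 \<in> L c" if "p \<in> B" "c \<in> \<A>" "B \<subseteq> cdom c" for p c
  proof -
    have "vector [cmap c p $ 1, 0] = cmap c p"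
      using cmap_boundary(1)[OF that(2) subsetD[OF that(3,1)] subsetD[OF Bb that(1)]] by (rule sym)
    then show ?thesis using that(1) by (simp add: L_def)
  qed
  define g where "g s = tr c d (vector [s, 0]) $ 1" for s
  have g: "g s = cmap d p $ 1" if "p \<in> B" "vector [s, 0] = cmap c p" for p s
    using that B(2) tr_cmap[OF c d] by (auto simp: g_def)
  have im: "g ` L c = L d"
  proof (intro set_eqI iffI)
    fix s assume "s \<in> g ` L c"
    then show "s \<in> L d" using LE g Lmem[OF _ d B(3)] by fastforce
  next
    fix s assume "s \<in> L d"
    then obtain p where p: "p \<in> B" "s = cmap d p $ 1" using LE by blast
    have "g (cmap c p $ 1) = s" unfolding p(2)
      by (rule g[OF p(1) cmap_boundary(1)[OF c subsetD[OF B(2) p(1)] subsetD[OF Bb p(1)], symmetric]])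
    then show "s \<in> g ` L c" using Lmem[OF p(1) c B(2)] by blast
  qed
  have "(\<integral>\<^sup>+x\<in>g ` L c. ennreal (boundary_weight d R x) \<partial>lborel) = (\<integral>\<^sup>+x\<in>L c. ennreal (boundary_weight c R x) \<partial>lborel)"
  proof (rule nn_integral_change_of_variables_real)
    show "(\<lambda>y. indicator (g ` L c) y * boundary_weight d R y) \<in> borel_measurable borel"
      unfolding im by (rule meas[OF d B(3)])
    show "(\<lambda>x. indicator (L c) x * boundary_weight c R x) \<in> borel_measurable borel"
      by (rule meas[OF c B(2)])
    show "L c \<in> sets borel" by (rule borel[OF c B(2)])
    show "0 \<le> boundary_weight d R y" for y by (simp add: boundary_weight_def)
    show "inj_on g (L c)"
    proof (rule inj_onI)
      fix s t assume "s \<in> L c" "t \<in> L c" and eq: "g s = g t"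
      then obtain p q where p: "p \<in> B" "q \<in> B" "s = cmap c p $ 1" "t = cmap c q $ 1" 
        "vector [s, 0] = cmap c p" "vector [t, 0] = cmap c q" using LE by meson
      have "cmap d p $ 1 = cmap d q $ 1" 
        using eq unfolding g[OF p(1,5)] g[OF p(2,6)] .
      then have "boundary_param d (cmap d p $ 1) = boundary_param d (cmap d q $ 1)" by (rule arg_cong)
      then have "p = q"
        unfolding cmap_boundary(3)[OF d subsetD[OF B(3) p(1)] subsetD[OF Bb p(1)]]
          cmap_boundary(3)[OF d subsetD[OF B(3) p(2)] subsetD[OF Bb p(2)]] .
      then show "s = t" using p by simp
    qed
    fix s assume s: "s \<in> L c"
    then obtain p where p: "p \<in> B" "s = cmap c p $ 1" "vector [s, 0] = cmap c p" using LE by meson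
    have pc: "p \<in> cdom c" "p \<in> cdom d" "p \<in> surface_boundary \<A>" using p B Bb by auto
    have x: "cmap c p \<in> overlap c d" using pc by (auto simp: overlap_def)
    have LS: "vector [s, 0] \<in> overlap c d" if "s \<in> L c" for s
      using that B by (auto simp: overlap_def L_def)
    have der: "((\<lambda>z. tr c d z $ 1) has_derivative (\<lambda>v. jac c d (cmap c p) v $ 1)) (at (cmap c p) within overlap c d)"
      by (rule bounded_linear.has_derivative[OF bounded_linear_vec_nth])
         (rule has_derivative_subset[OF has_derivative_tr[OF c d x]], auto simp: overlap_def)
    have eqx: "0 + s *\<^sub>R axis 1 1 = cmap c p" using p(3) by (simp add: vector_s0)
    have "((\<lambda>s. tr c d (0 + s *\<^sub>R axis 1 1) $ 1) has_real_derivative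
      pd (overlap c d) 1 (\<lambda>z. tr c d z $ 1) (0 + s *\<^sub>R axis 1 1)) (at s within L c)"
    proof (rule has_real_derivative_line)
      show "(\<lambda>z. tr c d z $ 1) differentiable at (0 + s *\<^sub>R axis 1 1) within overlap c d"
        unfolding eqx using der by (rule differentiableI)
      show "0 + s *\<^sub>R axis 1 1 \<in> overlap c d" if "s \<in> L c" for s
        using LS[OF that] by (simp add: vector_s0)
    qed
    then show "(g has_real_derivative jac c d (vector [s, 0]) (axis 1 1) $ 1) (at s within L c)"
      unfolding eqx pd_eqI[OF half_open_overlap[OF c d] x der] p(3) by (simp add: g_def[abs_def] vector_s0)
    have "boundary_param c s = p" "boundary_param d (g s) = p"
      using cmap_boundary(3)[OF c pc(1,3)] cmap_boundary(3)[OF d pc(2,3)] p(2) g[OF p(1,3)] by auto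
    then show "boundary_weight c R s = \<bar>jac c d (vector [s, 0]) (axis 1 1) $ 1\<bar> * boundary_weight d R (g s)"
      unfolding boundary_weight_def p(3)
      by (simp add: pderiv_boundary_change_chart[OF R c d pc])
  qed
  then show ?thesis
    using emeasure_boundary_chart[OF R c B(1,2)] emeasure_boundary_chart[OF R d B(1,3)] im by (simp add: L_def)
qed

lemma boundary_length_measure:
  assumes R: "smooth_in_charts R"
  shows "sets (boundary_length_measure \<A> R) = sets (restrict_space borel (surface_boundary \<A>))"
    and "\<And>c B. c \<in> \<A> \<Longrightarrow> B \<in> sets (boundary_length_measure \<A> R) \<Longrightarrow> B \<subseteq> cdom c \<Longrightarrow>
      emeasure (boundary_length_measure \<A> R) B = emeasure (boundary_chart R c) B"
proof -
  obtain I where I: "finite I" "I \<subseteq> \<A>" "M \<subseteq> (\<Union>c\<in>I. cdom c)" by (rule finite_chart_cover)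
  have "\<exists>!\<mu>. sets \<mu> = sets (restrict_space borel (surface_boundary \<A>)) \<and>
    (\<forall>c\<in>\<A>. \<forall>B\<in>sets \<mu>. B \<subseteq> cdom c \<longrightarrow> emeasure \<mu> B = emeasure (boundary_chart R c) B)"
  proof (rule glue_measures[OF I(1,2)])
    show "space (restrict_space borel (surface_boundary \<A>)) \<subseteq> (\<Union>c\<in>I. cdom c)"
      using I(3) boundary_subset by (simp add: space_restrict_space)
    show "cdom c \<inter> space (restrict_space borel (surface_boundary \<A>)) \<in> sets (restrict_space borel (surface_boundary \<A>))"
      if "c \<in> \<A>" for c
      using cdom_sets[OF that boundary_subset] by (simp add: space_restrict_space)
  qed (simp add: boundary_chart_def, rule boundary_chart_compatible[OF R])
  note * = theI'[OF this]
  have "boundary_length_measure \<A> R = (THE \<mu>. sets \<mu> = sets (restrict_space borel (surface_boundary \<A>)) \<and>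
    (\<forall>c\<in>\<A>. \<forall>B\<in>sets \<mu>. B \<subseteq> cdom c \<longrightarrow> emeasure \<mu> B = emeasure (boundary_chart R c) B))"
    unfolding boundary_length_measure_def
    by (intro arg_cong[of _ _ The] ext conj_cong ball_cong imp_cong refl)
       (simp add: emeasure_boundary_chart[OF R] boundary_weight_def boundary_param_def)
  with * show "sets (boundary_length_measure \<A> R) = sets (restrict_space borel (surface_boundary \<A>))"
    and "\<And>c B. c \<in> \<A> \<Longrightarrow> B \<in> sets (boundary_length_measure \<A> R) \<Longrightarrow> B \<subseteq> cdom c \<Longrightarrow>
      emeasure (boundary_length_measure \<A> R) B = emeasure (boundary_chart R c) B" by auto
qed

lemma boundary_integral:
  fixes f :: "'a \<Rightarrow> real"
  assumes R: "smooth_in_charts R" and c: "c \<in> \<A>" and ab: "cbox a b \<subseteq> boundary_line c"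
    and f0: "\<And>p. p \<in> surface_boundary \<A> - boundary_param c ` cbox a b \<Longrightarrow> f p = 0"
    and fc: "continuous_on (cbox a b) (\<lambda>s. f (boundary_param c s))"
  shows "integrable (boundary_length_measure \<A> R) f"
    "integral\<^sup>L (boundary_length_measure \<A> R) f = integral (cbox a b) (\<lambda>s. f (boundary_param c s) * boundary_weight c R s)"
proof -
  have w: "0 \<le> boundary_weight c R x" for x by (simp add: boundary_weight_def)
  have D: "boundary_param c ` boundary_line c \<subseteq> cdom c" using boundary_lineD(1)[OF c] by auto
  note * = param_integral[OF borel_boundary_line[OF c] continuous_boundary_weight[OF R c] w continuous_boundary_param[OF c] boundary_param_image[OF c]
    boundary_length_measure(1)[OF R] cdom_sets[OF c boundary_subset] boundary_length_measure(2)[OF R c, unfolded boundary_chart_def] D inj_boundary_param[OF c] ab f0 fc]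
  from * show "integrable (boundary_length_measure \<A> R) f"
    "integral\<^sup>L (boundary_length_measure \<A> R) f = integral (cbox a b) (\<lambda>s. f (boundary_param c s) * boundary_weight c R s)"
    by auto
qed

end

section \<open>Curvature in coordinates\<close>

unbundle cross3_syntax

section \<open>Linear algebra of principal frames\<close>

text \<open>The expression \<open>b1 \<times> a2 + a1 \<times> b2\<close> is the derivative of
  \<open>a1 \<times> a2\<close> in the direction of the pair \<open>(b1, b2)\<close>, and so scales
  by the same determinant under a change of frame.\<close>

lemma cross_polarized_det:
  "(v1 *\<^sub>R b1 + v2 *\<^sub>R b2) \<times> (w1 *\<^sub>R a1 + w2 *\<^sub>R a2) + (v1 *\<^sub>R a1 + v2 *\<^sub>R a2) \<times> (w1 *\<^sub>R b1 + w2 *\<^sub>R b2)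
    = (v1 * w2 - v2 * w1) *\<^sub>R (b1 \<times> a2 + a1 \<times> b2)" for a1 a2 b1 b2 :: "real^3"
  by (simp add: cross3_simps)

lemma cross_det_vec2:
  "(v1 *\<^sub>R a1 + v2 *\<^sub>R a2) \<times> (w1 *\<^sub>R a1 + w2 *\<^sub>R a2) = (v1 * w2 - v2 * w1) *\<^sub>R (a1 \<times> a2)" for a1 a2 :: "real^3"
  by (simp add: cross3_simps)

text \<open>By Lagrange's identity, orthogonality to \<open>p\<close> and \<open>q\<close> makes
  \<open>x\<close> parallel to \<open>p \<times> q\<close>; the last hypothesis excludes every
  nonzero multiple.\<close>

lemma zero_of_orthogonal_basis:
  fixes x p q :: "real^3"
  assumes "p \<times> q \<noteq> 0" "x \<bullet> p = 0" "x \<bullet> q = 0" "x \<bullet> (p \<times> q) = 0"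
  shows "x = 0"
proof -
  have "x \<times> (p \<times> q) = (x \<bullet> q) *\<^sub>R p - (x \<bullet> p) *\<^sub>R q"
    by (rule Lagrange)
  then have "x \<times> (p \<times> q) = 0" using assms by simp
  then show ?thesis using norm_and_cross_eq_0 assms(1,4) by blast
qed

text \<open>In the principal frame \<open>p, q\<close> both cross products can be read off, and the
  return to \<open>a1, a2\<close> multiplies all terms by the same nonzero determinant. Hence the
  sum and the product of the principal curvatures are determined even where the frame is
  not.\<close>

lemma principal_identities:
  fixes a1 a2 N1 N2 :: "real^3" and v w :: "real^2"
  assumes n: "a1 \<times> a2 \<noteq> 0" and v: "v \<noteq> 0" and w: "w \<noteq> 0"
    and orth: "(v $ 1 *\<^sub>R a1 + v $ 2 *\<^sub>R a2) \<bullet> (w $ 1 *\<^sub>R a1 + w $ 2 *\<^sub>R a2) = 0"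
    and \<kappa>1: "v $ 1 *\<^sub>R N1 + v $ 2 *\<^sub>R N2 = - \<kappa>1 *\<^sub>R (v $ 1 *\<^sub>R a1 + v $ 2 *\<^sub>R a2)"
    and \<kappa>2: "w $ 1 *\<^sub>R N1 + w $ 2 *\<^sub>R N2 = - \<kappa>2 *\<^sub>R (w $ 1 *\<^sub>R a1 + w $ 2 *\<^sub>R a2)"
  shows "N1 \<times> a2 + a1 \<times> N2 = - (\<kappa>1 + \<kappa>2) *\<^sub>R (a1 \<times> a2)"
    and "N1 \<times> N2 = (\<kappa>1 * \<kappa>2) *\<^sub>R (a1 \<times> a2)"
proof -
  define \<Delta> where "\<Delta> = v $ 1 * w $ 2 - v $ 2 * w $ 1"
  define p where "p = v $ 1 *\<^sub>R a1 + v $ 2 *\<^sub>R a2"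
  define q where "q = w $ 1 *\<^sub>R a1 + w $ 2 *\<^sub>R a2"
  have pq: "p \<times> q = \<Delta> *\<^sub>R (a1 \<times> a2)"
    unfolding p_def q_def \<Delta>_def by (rule cross_det_vec2)
  have nz: "u $ 1 *\<^sub>R a1 + u $ 2 *\<^sub>R a2 \<noteq> 0" if "u \<noteq> 0" for u :: "real^2"
  proof
    assume 0: "u $ 1 *\<^sub>R a1 + u $ 2 *\<^sub>R a2 = 0"
    have "u $ 1 *\<^sub>R (a1 \<times> a2) = (u $ 1 *\<^sub>R a1 + u $ 2 *\<^sub>R a2) \<times> a2"
      "u $ 2 *\<^sub>R (a1 \<times> a2) = a1 \<times> (u $ 1 *\<^sub>R a1 + u $ 2 *\<^sub>R a2)"
      by (simp_all add: cross3_simps)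
    then have "u $ 1 = 0" "u $ 2 = 0" using 0 n by auto
    then show False using that by (simp add: vec_eq_iff forall_2)
  qed
  \<comment> \<open>Orthogonality turns \<open>norm (p \<times> q)\<close> into
    \<open>norm p * norm q\<close>, so the frame is nondegenerate.\<close>
  have "(norm (p \<times> q))\<^sup>2 = (norm p * norm q)\<^sup>2"
    using norm_cross_dot[of p q] orth by (simp add: p_def q_def)
  then have "p \<times> q \<noteq> 0" using nz[OF v] nz[OF w] unfolding p_def[symmetric] q_def[symmetric] by auto
  then have \<Delta>: "\<Delta> \<noteq> 0" using pq by auto
  have "\<Delta> *\<^sub>R (N1 \<times> a2 + a1 \<times> N2) = (- \<kappa>1 *\<^sub>R p) \<times> q + p \<times> (- \<kappa>2 *\<^sub>R q)"
    unfolding \<Delta>_def cross_polarized_det[symmetric] \<kappa>1 \<kappa>2 p_def q_def ..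
  also have "\<dots> = \<Delta> *\<^sub>R (- (\<kappa>1 + \<kappa>2) *\<^sub>R (a1 \<times> a2))"
    using pq by (simp add: cross_mult_left cross_mult_right algebra_simps)
  finally show "N1 \<times> a2 + a1 \<times> N2 = - (\<kappa>1 + \<kappa>2) *\<^sub>R (a1 \<times> a2)"
    unfolding scaleR_cancel_left using \<Delta> by blast
  have "\<Delta> *\<^sub>R (N1 \<times> N2) = (- \<kappa>1 *\<^sub>R p) \<times> (- \<kappa>2 *\<^sub>R q)"
    unfolding \<Delta>_def cross_det_vec2[symmetric] \<kappa>1 \<kappa>2 p_def q_def ..
  also have "\<dots> = \<Delta> *\<^sub>R ((\<kappa>1 * \<kappa>2) *\<^sub>R (a1 \<times> a2))"
    using pq by (simp add: cross_mult_left cross_mult_right algebra_simps)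
  finally show "N1 \<times> N2 = (\<kappa>1 * \<kappa>2) *\<^sub>R (a1 \<times> a2)"
    unfolding scaleR_cancel_left using \<Delta> by blast
qed

text \<open>The spectral theorem for the second fundamental form in dimension two, made explicit by
  rotating an orthonormal frame. The symmetry it rests on is
  \<open>N1 \<bullet> a2 = N2 \<bullet> a1\<close>.\<close>

lemma principal_curvatures_exist:
  fixes a1 a2 N1 N2 :: "real^3"
  assumes n: "a1 \<times> a2 \<noteq> 0" and N: "(a1 \<times> a2) \<bullet> N1 = 0" "(a1 \<times> a2) \<bullet> N2 = 0" and sym: "N1 \<bullet> a2 = N2 \<bullet> a1"
  obtains v w :: "real^2" and \<kappa>1 \<kappa>2 where "v \<noteq> 0" "w \<noteq> 0"
    "(v $ 1 *\<^sub>R a1 + v $ 2 *\<^sub>R a2) \<bullet> (w $ 1 *\<^sub>R a1 + w $ 2 *\<^sub>R a2) = 0"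
    "v $ 1 *\<^sub>R N1 + v $ 2 *\<^sub>R N2 = - \<kappa>1 *\<^sub>R (v $ 1 *\<^sub>R a1 + v $ 2 *\<^sub>R a2)"
    "w $ 1 *\<^sub>R N1 + w $ 2 *\<^sub>R N2 = - \<kappa>2 *\<^sub>R (w $ 1 *\<^sub>R a1 + w $ 2 *\<^sub>R a2)"
proof -
  define dR where "dR v = v $ 1 *\<^sub>R a1 + v $ 2 *\<^sub>R a2" for v :: "real^2"
  define dN where "dN v = v $ 1 *\<^sub>R N1 + v $ 2 *\<^sub>R N2" for v :: "real^2"
  have lin: "dR (s *\<^sub>R v + t *\<^sub>R w) = s *\<^sub>R dR v + t *\<^sub>R dR w" "dN (s *\<^sub>R v + t *\<^sub>R w) = s *\<^sub>R dN v + t *\<^sub>R dN w" for s t v w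
    by (simp_all add: dR_def dN_def algebra_simps)
  have sym': "dN v \<bullet> dR w = dN w \<bullet> dR v" for v w
    using sym by (simp add: dR_def dN_def inner_add_left inner_add_right algebra_simps)
  have a1: "a1 \<noteq> 0" using n by auto
  \<comment> \<open>Gram-Schmidt in coordinates: \<open>a2\<close> minus its projection onto
    \<open>a1\<close>.\<close>
  define b' :: "real^2" where "b' = vector [- (a1 \<bullet> a2) / (a1 \<bullet> a1), 1]"
  have "a1 \<times> dR b' = a1 \<times> a2" by (simp add: dR_def b'_def cross_add_right cross_mult_right Cross3.right_diff_distrib)
  then have b'0: "dR b' \<noteq> 0" using n by auto
  define a :: "real^2" where "a = inverse (norm a1) *\<^sub>R axis 1 1"
  define b where "b = inverse (norm (dR b')) *\<^sub>R b'"
  have dRa: "dR a = inverse (norm a1) *\<^sub>R a1" by (simp add: a_def dR_def axis_def)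
  have dRb: "dR b = inverse (norm (dR b')) *\<^sub>R dR b'" using lin(1)[of _ b' 0 0] by (simp add: b_def)
  have aa: "dR a \<bullet> dR a = 1" using a1 by (simp add: dRa norm_eq_sqrt_inner field_simps)
  have bb: "dR b \<bullet> dR b = 1" using b'0 by (simp add: dRb norm_eq_sqrt_inner field_simps)
  have "a1 \<bullet> dR b' = 0" using a1 by (simp add: dR_def b'_def inner_add_right inner_diff_right)
  then have ab: "dR a \<bullet> dR b = 0" by (simp add: dRa dRb)
  \<comment> \<open>Half the difference of the diagonal entries and the off-diagonal entry are put
    into polar form; by the double-angle formulas, rotation through half the polar angle annihilates
    the off-diagonal entry. At an umbilic \<open>r = 0\<close> and every angle serves.\<close>
  obtain r \<phi> where r: "(dN a \<bullet> dR a - dN b \<bullet> dR b) / 2 = r * cos \<phi>" "dN a \<bullet> dR b = r * sin \<phi>"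
    using polar_Ex by meson
  define c where "c = cos (\<phi> / 2)"
  define s where "s = sin (\<phi> / 2)"
  have cs: "c * c + s * s = 1" using sin_cos_squared_add3[of "\<phi>/2"] by (simp add: c_def s_def)
  have cos: "cos \<phi> = c * c - s * s" using cos_double[of "\<phi>/2"] by (simp add: c_def s_def power2_eq_square)
  have sin: "sin \<phi> = 2 * s * c" using sin_double[of "\<phi>/2"] by (simp add: c_def s_def)
  define v where "v = c *\<^sub>R a + s *\<^sub>R b"
  define w where "w = (- s) *\<^sub>R a + c *\<^sub>R b"
  have ba: "dR b \<bullet> dR a = 0" using ab by (simp add: inner_commute)
  have vv: "dR v \<bullet> dR v = 1" and ww: "dR w \<bullet> dR w = 1" and vw: "dR v \<bullet> dR w = 0"
    using cs unfolding v_def w_def lin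
    by (simp_all add: inner_add_left inner_add_right inner_diff_left inner_diff_right aa bb ab ba add.commute)
  have II: "dN v \<bullet> dR w = 0"
  proof -
    have "dN v \<bullet> dR w = (c * c - s * s) * (dN a \<bullet> dR b) - s * c * (dN a \<bullet> dR a - dN b \<bullet> dR b)"
      unfolding v_def w_def lin using sym'[of b a]
      by (simp add: inner_add_left inner_add_right algebra_simps)
    also have "\<dots> = cos \<phi> * (r * sin \<phi>) - s * c * (2 * (r * cos \<phi>))"
    proof -
      have "dN a \<bullet> dR a - dN b \<bullet> dR b = 2 * (r * cos \<phi>)" using r(1) by simp
      then show ?thesis using cos r(2) by metis
    qed
    also have "\<dots> = 0" unfolding sin by (simp add: algebra_simps)
    finally show ?thesis .
  qed
  have pq: "\<exists>k. dR x \<times> dR y = k *\<^sub>R (a1 \<times> a2)" for x y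
    unfolding dR_def cross_det_vec2 by blast
  have tang: "dN x \<bullet> (a1 \<times> a2) = 0" "dR x \<bullet> (a1 \<times> a2) = 0" for x
    
    using N by (simp_all add: dN_def dR_def inner_commute[of _ "a1 \<times> a2"] inner_add_right dot_cross_self)
  \<comment> \<open>\<open>dN x\<close> is tangential and orthogonal to the other vector of the
    orthonormal frame, hence a multiple of \<open>dR x\<close>.\<close>
  have key: "dN x = (dN x \<bullet> dR x) *\<^sub>R dR x" if x: "dR x \<bullet> dR x = 1" and y: "dR y \<bullet> dR y = 1" and xy: "dR x \<bullet> dR y = 0" "dN x \<bullet> dR y = 0" for x y
  proof -
    obtain k where k: "dR x \<times> dR y = k *\<^sub>R (a1 \<times> a2)" using pq by blast
    have "(norm (dR x \<times> dR y))\<^sup>2 = 1"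
      using norm_cross_dot[of "dR x" "dR y"] x y xy by (simp add: norm_eq_sqrt_inner)
    then have "dR x \<times> dR y \<noteq> 0" by auto
    then have "dN x - (dN x \<bullet> dR x) *\<^sub>R dR x = 0"
      by (rule zero_of_orthogonal_basis) (simp_all add: k inner_diff_left x xy tang)
    then show ?thesis by simp
  qed
  show ?thesis
  proof
    show "v \<noteq> 0" using vv by (auto simp: dR_def)
    show "w \<noteq> 0" using ww by (auto simp: dR_def)
    show "(v $ 1 *\<^sub>R a1 + v $ 2 *\<^sub>R a2) \<bullet> (w $ 1 *\<^sub>R a1 + w $ 2 *\<^sub>R a2) = 0"
      using vw by (simp add: dR_def)
    show "v $ 1 *\<^sub>R N1 + v $ 2 *\<^sub>R N2 = - (- (dN v \<bullet> dR v)) *\<^sub>R (v $ 1 *\<^sub>R a1 + v $ 2 *\<^sub>R a2)"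
      using key[OF vv ww vw II] by (simp add: dR_def dN_def)
    have wv: "dR w \<bullet> dR v = 0" "dN w \<bullet> dR v = 0" using vw II sym' by (simp_all add: inner_commute)
    show "w $ 1 *\<^sub>R N1 + w $ 2 *\<^sub>R N2 = - (- (dN w \<bullet> dR w)) *\<^sub>R (w $ 1 *\<^sub>R a1 + w $ 2 *\<^sub>R a2)"
      using key[OF ww vv wv] by (simp add: dR_def dN_def)
  qed
qed

section \<open>The normal of a parametrised patch\<close>

definition nrm :: "(real^2) set \<Rightarrow> (real^2 \<Rightarrow> real^3) \<Rightarrow> real^2 \<Rightarrow> real^3" where
  "nrm S r x = pd S 1 r x \<times> pd S 2 r x"

definition unrm :: "(real^2) set \<Rightarrow> (real^2 \<Rightarrow> real^3) \<Rightarrow> real^2 \<Rightarrow> real^3" where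
  "unrm S r x = inverse (norm (nrm S r x)) *\<^sub>R nrm S r x"

locale patch =
  fixes S :: "(real^2) set" and r :: "real^2 \<Rightarrow> real^3"
  assumes half_open_S: "half_open S" and Ck_r: "\<And>k. Ck k S r"
begin

abbreviation "n \<equiv> nrm S r"
abbreviation "N \<equiv> unrm S r"
abbreviation "a i \<equiv> pd S i r"

lemma Ck_a: "Ck k S (a i)" by (rule Ck_SucD(2)[OF Ck_r])

lemma Ck_n: "Ck k S n"
  unfolding nrm_def[abs_def] by (intro Ck_cross half_open_S Ck_a)

lemma pd_n:
  assumes x: "x \<in> S"
  shows "pd S i n x = pd S i (a 1) x \<times> a 2 x + a 1 x \<times> pd S i (a 2) x"
  unfolding nrm_def[abs_def]
  by (rule pd_bilinear[OF bounded_bilinear_cross half_open_S x Ck_SucD(1)[OF Ck_a x] Ck_SucD(1)[OF Ck_a x]])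

lemma n_a: "n x \<bullet> a i x = 0" 
  using exhaust_2[of i] by (auto simp: nrm_def dot_cross_self)

lemma a_commute: "x \<in> S \<Longrightarrow> pd S 1 (a 2) x = pd S 2 (a 1) x"
  by (rule pd_commute[OF half_open_S _ Ck_r])

context
  fixes x assumes x: "x \<in> S" and n0: "n x \<noteq> 0"
begin

abbreviation "\<phi> \<equiv> inverse (norm (n x))"

lemma phi_sq: "\<phi> * \<phi> * (n x \<bullet> n x) = 1" "\<phi> > 0"
  using n0 by (simp_all add: dot_square_norm power2_eq_square field_simps)

lemma N_differentiable: "N differentiable (at x within S)"
  unfolding unrm_def[abs_def]
  by (intro differentiable_bilinear[OF bounded_bilinear_scaleR] Ck_SucD(1)[OF Ck_n x]
     differentiableI[OF has_derivative_inverse_norm[OF n0 Ck_SucD(1)[OF Ck_n x, unfolded frechet_derivative_works]]])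

lemma pd_N: "pd S i N x = \<phi> *\<^sub>R pd S i n x - (\<phi> ^ 3 * (n x \<bullet> pd S i n x)) *\<^sub>R n x"
proof -
  have "pd S i N x = pd S i (\<lambda>x. inverse (norm (n x))) x *\<^sub>R n x + \<phi> *\<^sub>R pd S i n x"
    unfolding unrm_def[abs_def]
    by (rule pd_bilinear[OF bounded_bilinear_scaleR half_open_S x _ Ck_SucD(1)[OF Ck_n x]])
      (rule differentiableI[OF has_derivative_inverse_norm[OF n0 Ck_SucD(1)[OF Ck_n x, unfolded frechet_derivative_works]]])
  then show ?thesis
    using pd_inverse_norm[OF half_open_S x n0 Ck_SucD(1)[OF Ck_n x], of i] by simp
qed

lemma n_pd_N: "n x \<bullet> pd S i N x = 0"
proof -
  have "n x \<bullet> pd S i N x = \<phi> * (n x \<bullet> pd S i n x) * (1 - \<phi> * \<phi> * (n x \<bullet> n x))"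
    unfolding pd_N by (simp add: inner_diff_right power3_eq_cube algebra_simps)
  then show ?thesis using phi_sq by simp
qed

text \<open>Up to \<open>\<phi>\<close> both sides are triple products of \<open>a 1\<close>,
  \<open>a 2\<close> and a mixed second derivative of \<open>r\<close>, and the two mixed
  derivatives agree.\<close>

lemma pd_N_symmetric: "pd S 1 N x \<bullet> a 2 x = pd S 2 N x \<bullet> a 1 x"
proof -
  have "pd S 1 N x \<bullet> a 2 x = \<phi> * ((a 1 x \<times> pd S 1 (a 2) x) \<bullet> a 2 x)"
    "pd S 2 N x \<bullet> a 1 x = \<phi> * ((pd S 2 (a 1) x \<times> a 2 x) \<bullet> a 1 x)"
    unfolding pd_N pd_n[OF x] by (simp_all add: inner_diff_left inner_add_left n_a dot_cross_self)
  moreover have "(u \<times> v) \<bullet> w = (v \<times> w) \<bullet> u" for u v w :: "real^3"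
    by (simp add: cross3_simps)
  ultimately show ?thesis using a_commute[OF x] by metis
qed

text \<open>Passing from \<open>N\<close> to \<open>n\<close> changes the derivatives by the factor
  \<open>\<phi>\<close> and by multiples of \<open>n\<close>, and the latter drop out of triple
  products with \<open>n\<close>. The resulting quotient contains no square root.\<close>

lemma mean_curvature_density:
  assumes "pd S 1 N x \<times> a 2 x + a 1 x \<times> pd S 2 N x = - (2 * h) *\<^sub>R n x"
  shows "h * norm (n x) = - (n x \<bullet> (pd S 1 n x \<times> a 2 x + a 1 x \<times> pd S 2 n x)) / (2 * (n x \<bullet> n x))"
proof -
  have "\<phi> * (n x \<bullet> (pd S 1 n x \<times> a 2 x + a 1 x \<times> pd S 2 n x)) = n x \<bullet> (pd S 1 N x \<times> a 2 x + a 1 x \<times> pd S 2 N x)"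
    unfolding pd_N
    by (simp add: Cross3.left_diff_distrib Cross3.right_diff_distrib cross_mult_left cross_mult_right
      inner_add_right inner_diff_right dot_cross_self algebra_simps)
  also have "\<dots> = - (2 * h) * (n x \<bullet> n x)" unfolding assms by simp
  finally have "\<phi> * (n x \<bullet> (pd S 1 n x \<times> a 2 x + a 1 x \<times> pd S 2 n x)) = - (2 * h) * (n x \<bullet> n x)" .
  then have "norm (n x) * (\<phi> * (n x \<bullet> (pd S 1 n x \<times> a 2 x + a 1 x \<times> pd S 2 n x))) = norm (n x) * (- (2 * h) * (n x \<bullet> n x))"
    by (rule arg_cong)
  then have "n x \<bullet> (pd S 1 n x \<times> a 2 x + a 1 x \<times> pd S 2 n x) = norm (n x) * (- (2 * h) * (n x \<bullet> n x))"
    using n0 by (simp add: mult.assoc[symmetric])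
  then show ?thesis using n0 by (simp add: field_simps)
qed

end

end

section \<open>Curvatures of a surface, independently of the chart\<close>

context surface
begin

lemma chart_at: assumes "p \<in> M" shows "chart_at \<A> p \<in> \<A>" "p \<in> cdom (chart_at \<A> p)"
proof -
  have "\<exists>c. c \<in> \<A> \<and> p \<in> cdom c" using assms Union_cdom by blast
  from someI_ex[OF this] show "chart_at \<A> p \<in> \<A>" "p \<in> cdom (chart_at \<A> p)" by (simp_all add: chart_at_def)
qed

lemma patch_chart: "smooth_in_charts R \<Longrightarrow> c \<in> \<A> \<Longrightarrow> patch (cimg c) (R \<circ> cinv c)"
  by unfold_locales (auto intro: half_open_cimg smooth_rep)

lemma nrm_chart: "c \<in> \<A> \<Longrightarrow> x \<in> cimg c \<Longrightarrow> nrm (cimg c) (R \<circ> cinv c) x = coord_cross c R (cinv c x)"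
  by (simp add: coord_cross_cinv nrm_def)

lemma differential_pderiv:
  assumes "(f \<circ> cinv c) differentiable (at (cmap c p) within cimg c)"
  shows "differential c f p v = v $ 1 *\<^sub>R pderiv_in c 1 f p + v $ 2 *\<^sub>R pderiv_in c 2 f p"
  unfolding differential_def pderiv_in_def pd_def by (rule frechet_derivative_pd[OF assms, unfolded pd_def])

lemma pderiv_change_chart:
  assumes cd: "c \<in> \<A>" "d \<in> \<A>" and p: "p \<in> cdom c" "p \<in> cdom d"
    and f: "(f \<circ> cinv d) differentiable (at (cmap d p) within cimg d)"
  shows "pderiv_in c i f p = jac c d (cmap c p) (axis i 1) $ 1 *\<^sub>R pderiv_in d 1 f p + jac c d (cmap c p) (axis i 1) $ 2 *\<^sub>R pderiv_in d 2 f p"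
  using differential_change_chart[OF cd p f] differential_pderiv[OF f] by (simp add: pderiv_in_def[of c])

context
  fixes R :: "'a \<Rightarrow> real^3" assumes R: "smooth_in_charts R"
begin

text \<open>The Jacobian determinant is positive, so it cancels in the normalisation. Here the
  orientation of the atlas fixes the sign of the normal.\<close>

lemma unit_normal_chart:
  assumes c: "c \<in> \<A>" "p \<in> cdom c"
  shows "unit_normal \<A> R p = coord_cross c R p /\<^sub>R norm (coord_cross c R p)"
proof -
  have p: "p \<in> M" using c cdom_subset by blast
  note d = chart_at[OF p]
  have x: "cmap c p \<in> overlap c (chart_at \<A> p)" using c d by (auto simp: overlap_def)
  have "coord_cross c R p = det (matrix (jac c (chart_at \<A> p) (cmap c p))) *\<^sub>R coord_cross (chart_at \<A> p) R p"
    by (rule coord_cross_change_chart[OF c(1) d(1) c(2) d(2) smooth_rep_differentiable[OF R d]])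
  then show ?thesis
    using det_jac_pos[OF c(1) d(1) x] by (simp add: unit_normal_def)
qed

lemma unit_normal_rep:
  assumes c: "c \<in> \<A>" "x \<in> cimg c"
  shows "(unit_normal \<A> R \<circ> cinv c) x = unrm (cimg c) (R \<circ> cinv c) x"
  using unit_normal_chart[OF c(1) cinv_cdom[OF c]] nrm_chart[OF c] by (simp add: unrm_def)

lemma pderiv_unit_normal:
  assumes c: "c \<in> \<A>" "x \<in> cimg c"
  shows "pderiv_in c i (unit_normal \<A> R) (cinv c x) = pd (cimg c) i (unrm (cimg c) (R \<circ> cinv c)) x"
  unfolding pderiv_in_cinv[OF c] by (rule pd_cong[OF unit_normal_rep[OF c(1)] c(2)])

lemma unit_normal_differentiable:
  assumes c: "c \<in> \<A>" "p \<in> cdom c" and 0: "coord_cross c R p \<noteq> 0"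
  shows "(unit_normal \<A> R \<circ> cinv c) differentiable (at (cmap c p) within cimg c)"
proof -
  interpret patch "cimg c" "R \<circ> cinv c" by (rule patch_chart[OF R c(1)])
  have x: "cmap c p \<in> cimg c" using c by auto
  show ?thesis
    by (rule differentiable_cong_on[OF _ x N_differentiable[OF x]])
       (use nrm_chart[OF c(1) x] 0 cinv_cmap[OF c] unit_normal_rep[OF c(1)] in auto)
qed

lemma nondegenerate_chart_indep:
  assumes cd: "c \<in> \<A>" "d \<in> \<A>" and p: "p \<in> cdom c" "p \<in> cdom d" and 0: "coord_cross c R p \<noteq> 0"
  shows "coord_cross d R p \<noteq> 0"
  using coord_cross_change_chart[OF cd p smooth_rep_differentiable[OF R cd(2) p(2)]] 0 by auto

text \<open>Stated first in the chart to which the definitions refer. A principal frame exists, and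
  since \<open>coord_cross d R p\<close> is nonzero, \<open>principal_identities\<close> leaves one
  value for the sum and one for the product; so both definite descriptions denote.\<close>

lemma curvature_identities_chart_at:
  assumes p: "p \<in> M" and d: "d = chart_at \<A> p" and 0: "coord_cross d R p \<noteq> 0"
  shows "pderiv_in d 1 (unit_normal \<A> R) p \<times> pderiv_in d 2 R p + pderiv_in d 1 R p \<times> pderiv_in d 2 (unit_normal \<A> R) p
      = - (2 * mean_curvature \<A> R p) *\<^sub>R coord_cross d R p" (is ?H)
    and "pderiv_in d 1 (unit_normal \<A> R) p \<times> pderiv_in d 2 (unit_normal \<A> R) p
      = gaussian_curvature \<A> R p *\<^sub>R coord_cross d R p" (is ?K)
proof -
  have dA: "d \<in> \<A>" "p \<in> cdom d" using chart_at[OF p] d by auto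
  interpret patch "cimg d" "R \<circ> cinv d" by (rule patch_chart[OF R dA(1)])
  define x where "x = cmap d p"
  have x: "x \<in> cimg d" "cinv d x = p" using dA cinv_cmap by (auto simp: x_def)
  have n: "nrm (cimg d) (R \<circ> cinv d) x = coord_cross d R p" using nrm_chart[OF dA(1) x(1)] x(2) by simp
  have n0: "nrm (cimg d) (R \<circ> cinv d) x \<noteq> 0" using n 0 by simp
  define a1 a2 N1 N2 where "a1 = pderiv_in d 1 R p" and "a2 = pderiv_in d 2 R p"
    and "N1 = pderiv_in d 1 (unit_normal \<A> R) p" and "N2 = pderiv_in d 2 (unit_normal \<A> R) p"
  have a: "pderiv_in d i R p = pd (cimg d) i (R \<circ> cinv d) x" for i
    using pderiv_in_cinv[OF dA(1) x(1), of i R] x(2) by simp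
  have N: "pderiv_in d i (unit_normal \<A> R) p = pd (cimg d) i (unrm (cimg d) (R \<circ> cinv d)) x" for i
    using pderiv_unit_normal[OF dA(1) x(1), of i] x(2) by simp
  have cc: "coord_cross d R p = a1 \<times> a2" by (simp add: coord_cross_def a1_def a2_def)
  have pc: "principal_curvatures \<A> R p \<kappa>1 \<kappa>2 \<longleftrightarrow> (\<exists>(v::real^2) (w::real^2). v \<noteq> 0 \<and> w \<noteq> 0 \<and>
      (v $ 1 *\<^sub>R a1 + v $ 2 *\<^sub>R a2) \<bullet> (w $ 1 *\<^sub>R a1 + w $ 2 *\<^sub>R a2) = 0 \<and>
      v $ 1 *\<^sub>R N1 + v $ 2 *\<^sub>R N2 = - \<kappa>1 *\<^sub>R (v $ 1 *\<^sub>R a1 + v $ 2 *\<^sub>R a2) \<and>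
      w $ 1 *\<^sub>R N1 + w $ 2 *\<^sub>R N2 = - \<kappa>2 *\<^sub>R (w $ 1 *\<^sub>R a1 + w $ 2 *\<^sub>R a2))" for \<kappa>1 \<kappa>2
    unfolding principal_curvatures_def Let_def d[symmetric] a1_def a2_def N1_def N2_def
      differential_pderiv[OF smooth_rep_differentiable[OF R dA]] differential_pderiv[OF unit_normal_differentiable[OF dA 0]] ..
  have id: "N1 \<times> a2 + a1 \<times> N2 = - (\<kappa>1 + \<kappa>2) *\<^sub>R (a1 \<times> a2)" "N1 \<times> N2 = (\<kappa>1 * \<kappa>2) *\<^sub>R (a1 \<times> a2)"
    if "principal_curvatures \<A> R p \<kappa>1 \<kappa>2" for \<kappa>1 \<kappa>2
    using that principal_identities[of a1 a2] 0 unfolding pc cc by blast+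
  obtain \<kappa>1 \<kappa>2 where \<kappa>: "principal_curvatures \<A> R p \<kappa>1 \<kappa>2"
  proof (rule principal_curvatures_exist[of a1 a2 N1 N2])
    show "a1 \<times> a2 \<noteq> 0" using 0 cc by simp
    show "(a1 \<times> a2) \<bullet> N1 = 0" "(a1 \<times> a2) \<bullet> N2 = 0"
      using n_pd_N[OF x(1) n0] n cc by (simp_all add: N1_def N2_def N)
    show "N1 \<bullet> a2 = N2 \<bullet> a1"
      using pd_N_symmetric[OF x(1) n0] by (simp add: N1_def N2_def a1_def a2_def N a)
  qed (use pc in blast)
  have un: "\<kappa>1' + \<kappa>2' = \<kappa>1 + \<kappa>2 \<and> \<kappa>1' * \<kappa>2' = \<kappa>1 * \<kappa>2" if "principal_curvatures \<A> R p \<kappa>1' \<kappa>2'" for \<kappa>1' \<kappa>2'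
    using id[OF that] id[OF \<kappa>] 0 by (simp add: cc)
  have "mean_curvature \<A> R p = (\<kappa>1 + \<kappa>2) / 2"
    unfolding mean_curvature_def
  proof (rule the_equality)
    show "\<exists>\<kappa>1' \<kappa>2'. principal_curvatures \<A> R p \<kappa>1' \<kappa>2' \<and> (\<kappa>1 + \<kappa>2) / 2 = (\<kappa>1' + \<kappa>2') / 2"
      using \<kappa> by blast
    show "h = (\<kappa>1 + \<kappa>2) / 2" if "\<exists>\<kappa>1 \<kappa>2. principal_curvatures \<A> R p \<kappa>1 \<kappa>2 \<and> h = (\<kappa>1 + \<kappa>2) / 2" for h
      using that un by metis
  qed
  then have "2 * mean_curvature \<A> R p = \<kappa>1 + \<kappa>2" by simp
  then show ?H using id(1)[OF \<kappa>] by (simp only: cc a1_def a2_def N1_def N2_def)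
  have "gaussian_curvature \<A> R p = \<kappa>1 * \<kappa>2"
    unfolding gaussian_curvature_def
  proof (rule the_equality)
    show "\<exists>\<kappa>1' \<kappa>2'. principal_curvatures \<A> R p \<kappa>1' \<kappa>2' \<and> \<kappa>1 * \<kappa>2 = \<kappa>1' * \<kappa>2'"
      using \<kappa> by blast
    show "h = \<kappa>1 * \<kappa>2" if "\<exists>\<kappa>1 \<kappa>2. principal_curvatures \<A> R p \<kappa>1 \<kappa>2 \<and> h = \<kappa>1 * \<kappa>2" for h
      using that un by metis
  qed
  then show ?K using id(2)[OF \<kappa>] by (simp add: cc a1_def a2_def N1_def N2_def)
qed

text \<open>All terms are plain or polarised cross products, so passing from the chosen chart to
  \<open>c\<close> multiplies both sides by the same determinant.\<close>

lemma curvature_identities: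
  assumes c: "c \<in> \<A>" "p \<in> cdom c" and 0: "coord_cross c R p \<noteq> 0"
  shows "pderiv_in c 1 (unit_normal \<A> R) p \<times> pderiv_in c 2 R p + pderiv_in c 1 R p \<times> pderiv_in c 2 (unit_normal \<A> R) p
      = - (2 * mean_curvature \<A> R p) *\<^sub>R coord_cross c R p" (is ?H)
    and "pderiv_in c 1 (unit_normal \<A> R) p \<times> pderiv_in c 2 (unit_normal \<A> R) p
      = gaussian_curvature \<A> R p *\<^sub>R coord_cross c R p" (is ?K)
proof -
  have p: "p \<in> M" using c cdom_subset by blast
  define d where "d = chart_at \<A> p"
  have d: "d \<in> \<A>" "p \<in> cdom d" using chart_at[OF p] d_def by auto
  have d0: "coord_cross d R p \<noteq> 0" by (rule nondegenerate_chart_indep[OF c(1) d(1) c(2) d(2) 0])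
  define J where "J = jac c d (cmap c p)"
  have Rp: "pderiv_in c i R p = J (axis i 1) $ 1 *\<^sub>R pderiv_in d 1 R p + J (axis i 1) $ 2 *\<^sub>R pderiv_in d 2 R p" for i
    unfolding J_def by (rule pderiv_change_chart[OF c(1) d(1) c(2) d(2) smooth_rep_differentiable[OF R d]])
  have Np: "pderiv_in c i (unit_normal \<A> R) p = J (axis i 1) $ 1 *\<^sub>R pderiv_in d 1 (unit_normal \<A> R) p + J (axis i 1) $ 2 *\<^sub>R pderiv_in d 2 (unit_normal \<A> R) p" for i
    unfolding J_def by (rule pderiv_change_chart[OF c(1) d(1) c(2) d(2) unit_normal_differentiable[OF d d0]])
  have cc: "coord_cross c R p = det (matrix J) *\<^sub>R coord_cross d R p"
    unfolding J_def by (rule coord_cross_change_chart[OF c(1) d(1) c(2) d(2) smooth_rep_differentiable[OF R d]])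
  have det: "J (axis 1 1) $ 1 * J (axis 2 1) $ 2 - J (axis 1 1) $ 2 * J (axis 2 1) $ 1 = det (matrix J)"
    by (simp add: det_matrix_2)
  show ?H
    unfolding Rp Np cross_polarized_det det cc curvature_identities_chart_at(1)[OF p d_def d0] by simp
  show ?K
    unfolding Np cross_det_vec2 det cc curvature_identities_chart_at(2)[OF p d_def d0] by simp
qed

end

end

section \<open>Variation of the mean curvature density\<close>

text \<open>The mean curvature times the area density, expressed through the unnormalised normal: along
  \<open>r + t v\<close> it is a rational function of \<open>t\<close>.\<close>

definition curvature_density :: "(real^2) set \<Rightarrow> (real^2 \<Rightarrow> real^3) \<Rightarrow> real^2 \<Rightarrow> real" where
  "curvature_density S r x =
    - (nrm S r x \<bullet> (pd S 1 (nrm S r) x \<times> pd S 2 r x + pd S 1 r x \<times> pd S 2 (nrm S r) x)) / (2 * (nrm S r x \<bullet> nrm S r x))"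

section \<open>Vector identities in space\<close>

text \<open>Cramer's rule for the coordinates of \<open>x\<close> in the frame
  \<open>q, p, n\<close>. If \<open>x\<close> is orthogonal to \<open>q \<times> p\<close>, the last
  term drops out.\<close>

lemma cramer_cross:
  "((x \<times> p) \<bullet> n) *\<^sub>R q + ((q \<times> x) \<bullet> n) *\<^sub>R p + ((q \<times> p) \<bullet> x) *\<^sub>R n = ((q \<times> p) \<bullet> n) *\<^sub>R x" for x p q n :: "real^3"
  by (simp add: cross3_simps forall_3)

text \<open>The identity in the proof expands a multiple of \<open>N\<close> in the cross products
  of \<open>u, v, w\<close>, with \<open>N \<bullet> u\<close>, \<open>N \<bullet> v\<close> and
  \<open>N \<bullet> w\<close> as coefficients.\<close>

lemma triple_zero:
  fixes N u v w :: "real^3"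
  assumes "N \<noteq> 0" "N \<bullet> u = 0" "N \<bullet> v = 0" "N \<bullet> w = 0"
  shows "u \<bullet> (v \<times> w) = 0"
proof -
  have "(u \<bullet> (v \<times> w)) *\<^sub>R N = (N \<bullet> u) *\<^sub>R (v \<times> w) + (N \<bullet> v) *\<^sub>R (w \<times> u) + (N \<bullet> w) *\<^sub>R (u \<times> v)"
    by (simp add: cross3_simps forall_3)
  then show ?thesis using assms by simp
qed

lemma triple_rotate: "u \<bullet> (v \<times> w) = v \<bullet> (w \<times> u)" for u v w :: "real^3"
  by (simp add: cross3_simps)

text \<open>Here \<open>g\<close> plays the gradient of the normal component, \<open>Nd\<close> the
  varied normal, and \<open>a1 \<times> N\<close> is the conormal up to length. The two sides are
  linked by S J + J S = 2 h J, valid for the shape operator S and J the cross product with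
  \<open>N\<close> on the tangent plane.\<close>

lemma conormal_identity:
  fixes a1 a2 N1 N2 N Nd v b1 b2 \<eta> g :: "real^3"
  assumes n0: "a1 \<times> a2 \<noteq> 0" and N: "N = k *\<^sub>R (a1 \<times> a2)" "k \<noteq> 0"
    and NN: "N \<bullet> N1 = 0" "N \<bullet> N2 = 0" and sym: "N1 \<bullet> a2 = N2 \<bullet> a1"
    and H: "N1 \<times> a2 + a1 \<times> N2 = - (2 * h) *\<^sub>R (a1 \<times> a2)"
    and v: "v = \<eta> + vn *\<^sub>R N"
    and g: "g \<bullet> a1 = b1 \<bullet> N + v \<bullet> N1" "g \<bullet> a2 = b2 \<bullet> N + v \<bullet> N2"
    and Nd: "Nd \<bullet> a1 = - (b1 \<bullet> N)" "Nd \<bullet> a2 = - (b2 \<bullet> N)"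
  shows "((1/2) *\<^sub>R g + h *\<^sub>R \<eta>) \<bullet> (a1 \<times> N) = - (N \<bullet> (Nd \<times> a1) + N \<bullet> (v \<times> N1)) / 2"
proof -
  define m where "m = a1 \<times> N"
  have Na: "N \<bullet> a1 = 0" "N \<bullet> a2 = 0" by (simp_all add: N dot_cross_self)
  have Nm: "N \<bullet> m = 0" by (simp add: m_def dot_cross_self)
  obtain \<mu>1 \<mu>2 where \<mu>: "m = \<mu>1 *\<^sub>R a1 + \<mu>2 *\<^sub>R a2"
  proof -
    have "(a1 \<times> a2) \<bullet> m = 0" using Nm N by simp
    then have "((a1 \<times> a2) \<bullet> (a1 \<times> a2)) *\<^sub>R m = ((m \<times> a2) \<bullet> (a1 \<times> a2)) *\<^sub>R a1 + ((a1 \<times> m) \<bullet> (a1 \<times> a2)) *\<^sub>R a2"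
      using cramer_cross[of m a2 "a1 \<times> a2" a1] by simp
    then have "m = (((m \<times> a2) \<bullet> (a1 \<times> a2)) / ((a1 \<times> a2) \<bullet> (a1 \<times> a2))) *\<^sub>R a1 + (((a1 \<times> m) \<bullet> (a1 \<times> a2)) / ((a1 \<times> a2) \<bullet> (a1 \<times> a2))) *\<^sub>R a2"
      using n0 by (metis (no_types, lifting) divide_inverse_commute inner_eq_zero_iff real_vector_eq_affinity scaleR_add_right scaleR_one scaleR_scaleR left_inverse)
    then show ?thesis by (rule that)
  qed
  \<comment> \<open>\<open>Z = 0\<close> is this operator identity applied to \<open>a1\<close>:
    \<open>\<mu>1 *\<^sub>R N1 + \<mu>2 *\<^sub>R N2\<close> is the derivative of the normal along
    \<open>m\<close>. The component along \<open>a1\<close> vanishes by symmetry, the one along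
    \<open>a2\<close> by symmetry and the trace relation \<open>H\<close>.\<close>
  define Z where "Z = \<mu>1 *\<^sub>R N1 + \<mu>2 *\<^sub>R N2 + (2 * h) *\<^sub>R m + N1 \<times> N"
  have m1: "m \<bullet> a1 = 0" by (simp add: m_def dot_cross_self)
  have Xm: "X \<bullet> m = \<mu>1 * (X \<bullet> a1) + \<mu>2 * (X \<bullet> a2)" for X
    by (subst \<mu>) (simp add: inner_add_right)
  have "Z \<bullet> a1 = N1 \<bullet> m + (N1 \<times> N) \<bullet> a1"
    unfolding Z_def inner_add_left inner_scaleR_left m1 Xm[of N1] sym by simp
  also have "\<dots> = 0" by (simp add: m_def cross3_simps)
  finally have Z1: "Z \<bullet> a1 = 0" .
  have "Z \<bullet> a2 = N2 \<bullet> m + 2 * h * (m \<bullet> a2) + (N1 \<times> N) \<bullet> a2"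
    unfolding Z_def inner_add_left inner_scaleR_left Xm[of N2] sym by simp
  also have "2 * h * (m \<bullet> a2) = N \<bullet> (- (2 * h) *\<^sub>R (a1 \<times> a2))"
    by (simp add: m_def cross3_simps)
  also have "\<dots> = N \<bullet> (N1 \<times> a2 + a1 \<times> N2)" unfolding H ..
  also have "N2 \<bullet> m + N \<bullet> (N1 \<times> a2 + a1 \<times> N2) + (N1 \<times> N) \<bullet> a2 = 0"
    by (simp add: m_def cross3_simps)
  finally have Z2: "Z \<bullet> a2 = 0" .
  have "N \<bullet> Z = 0" unfolding Z_def inner_add_right inner_scaleR_right NN Nm by (simp add: dot_cross_self)
  then have Z3: "Z \<bullet> (a1 \<times> a2) = 0" using N by (simp add: inner_commute)
  have Z0: "Z = 0" by (rule zero_of_orthogonal_basis[OF n0 Z1 Z2 Z3])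
  \<comment> \<open>The terms with \<open>b1\<close> and \<open>b2\<close> cancel between
    \<open>g\<close> and \<open>Nd\<close>, which leaves \<open>v\<close> paired with the derivative
    of the normal along \<open>m\<close>.\<close>
  have "(g + Nd) \<bullet> m = v \<bullet> (\<mu>1 *\<^sub>R N1 + \<mu>2 *\<^sub>R N2)"
    by (subst \<mu>) (simp add: inner_add_left inner_add_right g Nd algebra_simps)
  also have "\<dots> = \<eta> \<bullet> (\<mu>1 *\<^sub>R N1 + \<mu>2 *\<^sub>R N2)"
    using NN by (simp add: v inner_add_left inner_add_right)
  also have "\<dots> = \<eta> \<bullet> Z - 2 * h * (\<eta> \<bullet> m) - \<eta> \<bullet> (N1 \<times> N)"
    by (simp add: Z_def inner_add_right)
  finally have *: "(g + Nd) \<bullet> m + 2 * h * (\<eta> \<bullet> m) = - (\<eta> \<bullet> (N1 \<times> N))"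
    unfolding Z0 by simp
  have "N \<bullet> (v \<times> N1) = \<eta> \<bullet> (N1 \<times> N)"
    unfolding v by (simp add: cross3_simps)
  moreover have "N \<bullet> (Nd \<times> a1) = Nd \<bullet> m" unfolding m_def by (rule triple_rotate)
  ultimately show ?thesis
    using * unfolding m_def[symmetric] by (simp add: inner_add_left)
qed

section \<open>The first variation of a patch, pointwise\<close>

locale patch_variation = patch +
  fixes v :: "real^2 \<Rightarrow> real^3"
  assumes Ck_v: "\<And>k. Ck k S v" and regular: "\<And>x. x \<in> S \<Longrightarrow> nrm S r x \<noteq> 0"
begin

abbreviation "b i \<equiv> pd S i v"

text \<open>The normal \<open>\<partial>\<^sub>1 \<times> \<partial>\<^sub>2\<close> of \<open>r + t v\<close> is \<open>n + t dn + t\<^sup>2 ddn\<close>, and \<open>\<psi> + t \<omega> + O(t\<^sup>2)\<close>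
  is its inverse length, so \<open>dN\<close> is the first variation of the unit normal.\<close>

definition dn :: "real^2 \<Rightarrow> real^3" where "dn x = a 1 x \<times> b 2 x + b 1 x \<times> a 2 x"
definition ddn :: "real^2 \<Rightarrow> real^3" where "ddn x = b 1 x \<times> b 2 x"
definition \<psi> :: "real^2 \<Rightarrow> real" where "\<psi> x = inverse (norm (n x))"
definition \<omega> :: "real^2 \<Rightarrow> real" where "\<omega> x = - (\<psi> x * (\<psi> x * \<psi> x) * (n x \<bullet> dn x))"
definition dN :: "real^2 \<Rightarrow> real^3" where "dN x = \<psi> x *\<^sub>R dn x + \<omega> x *\<^sub>R n x"
definition \<theta> :: "2 \<Rightarrow> real^2 \<Rightarrow> real" where
  "\<theta> i x = (1/2) * (N x \<bullet> (dN x \<times> a i x) + N x \<bullet> (v x \<times> pd S i N x))"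
text \<open>The product rule would add \<open>dN\<close> paired with
  \<open>pd S 1 N x \<times> a 2 x + a 1 x \<times> pd S 2 N x\<close>; this vector is normal and
  \<open>dN\<close> tangential, so that term is zero and left out.\<close>

definition d_density :: "real^2 \<Rightarrow> real" where
  "d_density x = - (N x \<bullet> (pd S 1 dN x \<times> a 2 x + a 1 x \<times> pd S 2 dN x + pd S 1 N x \<times> b 2 x + b 1 x \<times> pd S 2 N x)) / 2"

lemma Ck_b: "Ck k S (b i)" by (rule Ck_SucD(2)[OF Ck_v])

lemma Ck_dn: "Ck k S dn" and Ck_ddn: "Ck k S ddn"
  unfolding dn_def[abs_def] ddn_def[abs_def] by (intro Ck_add Ck_cross half_open_S Ck_a Ck_b)+

lemma Ck_psi: "Ck k S \<psi>"
  unfolding \<psi>_def[abs_def] by (intro Ck_inverse_norm half_open_S Ck_n regular)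

lemma Ck_chi: "Ck k S \<omega>"
proof -
  have "Ck k S (\<lambda>x. (-1) * (\<psi> x * (\<psi> x * \<psi> x) * (n x \<bullet> dn x)))"
    by (intro Ck_mult Ck_inner Ck_const half_open_S Ck_psi Ck_n Ck_dn)
  then show ?thesis by (rule Ck_cong[rotated]) (simp add: \<omega>_def)
qed

lemma Ck_N: "Ck k S N"
  unfolding unrm_def[abs_def] \<psi>_def[symmetric] by (intro Ck_scaleR half_open_S Ck_psi Ck_n)

lemma Ck_dN: "Ck k S dN"
  unfolding dN_def[abs_def] by (intro Ck_add Ck_scaleR half_open_S Ck_psi Ck_chi Ck_dn Ck_n)

lemma Ck_theta: "Ck k S (\<theta> i)"
  unfolding \<theta>_def[abs_def]
  by (intro Ck_mult Ck_const Ck_add Ck_inner Ck_cross half_open_S Ck_N Ck_dN Ck_a Ck_v Ck_SucD(2)[OF Ck_N])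

lemmas Ck_all = Ck_a Ck_b Ck_n Ck_dn Ck_ddn Ck_psi Ck_chi Ck_N Ck_dN Ck_v Ck_SucD(2)[OF Ck_N] Ck_theta
lemmas diff_all = Ck_all[of "Suc 0", THEN Ck_SucD(1)]

context
  fixes x assumes x: "x \<in> S"
begin

lemma psi_sq: "\<psi> x * \<psi> x * (n x \<bullet> n x) = 1"
  using phi_sq[OF x regular[OF x]] by (simp add: \<psi>_def)

lemma N_eq: "N x = \<psi> x *\<^sub>R n x" by (simp add: unrm_def \<psi>_def)

lemma N_nonzero: "N x \<noteq> 0"
  using regular[OF x] by (simp add: unrm_def)

lemma N_orth: "N x \<bullet> a i x = 0" "N x \<bullet> pd S i N x = 0" "N x \<bullet> dN x = 0"
proof -
  show "N x \<bullet> a i x = 0" by (simp add: N_eq n_a)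
  show "N x \<bullet> pd S i N x = 0" using n_pd_N[OF x regular[OF x]] by (simp add: N_eq)
  have "N x \<bullet> dN x = \<psi> x * \<psi> x * (n x \<bullet> dn x) * (1 - \<psi> x * \<psi> x * (n x \<bullet> n x))"
    by (simp add: N_eq dN_def \<omega>_def inner_add_right algebra_simps)
  then show "N x \<bullet> dN x = 0" using psi_sq by simp
qed

text \<open>This is the first variation of the orthogonality of N and R_i, read off here from the
  formula for \<open>dn\<close>.\<close>

lemma dN_a: "dN x \<bullet> a i x = - (b i x \<bullet> N x)"
proof -
  have "dn x \<bullet> a i x = - (b i x \<bullet> n x)"
    using exhaust_2[of i] by (auto simp: dn_def nrm_def cross3_simps)
  then show ?thesis by (simp add: dN_def N_eq inner_add_left n_a algebra_simps)
qed

lemma pd_theta: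
  "pd S j (\<theta> i) x = (1/2) * (pd S j N x \<bullet> (dN x \<times> a i x) + N x \<bullet> (pd S j dN x \<times> a i x) + N x \<bullet> (dN x \<times> pd S j (a i) x)
    + pd S j N x \<bullet> (v x \<times> pd S i N x) + N x \<bullet> (b j x \<times> pd S i N x) + N x \<bullet> (v x \<times> pd S j (pd S i N) x))"
proof -
  note diffs = diff_all x differentiable_bilinear[OF bounded_bilinear_cross] differentiable_bilinear[OF bounded_bilinear_inner]
  have "pd S j (\<theta> i) x = (1/2) * pd S j (\<lambda>x. N x \<bullet> (dN x \<times> a i x) + N x \<bullet> (v x \<times> pd S i N x)) x"
    unfolding \<theta>_def[abs_def]
    by (rule pd_linear[OF bounded_linear_mult_right half_open_S x]) (intro differentiable_add diffs)
  also have "pd S j (\<lambda>x. N x \<bullet> (dN x \<times> a i x) + N x \<bullet> (v x \<times> pd S i N x)) x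
    = pd S j (\<lambda>x. N x \<bullet> (dN x \<times> a i x)) x + pd S j (\<lambda>x. N x \<bullet> (v x \<times> pd S i N x)) x"
    by (intro pd_add half_open_S diffs)
  also have "pd S j (\<lambda>x. N x \<bullet> (dN x \<times> a i x)) x = pd S j N x \<bullet> (dN x \<times> a i x) + N x \<bullet> pd S j (\<lambda>x. dN x \<times> a i x) x"
    by (intro pd_bilinear[OF bounded_bilinear_inner] half_open_S diffs)
  also have "pd S j (\<lambda>x. dN x \<times> a i x) x = pd S j dN x \<times> a i x + dN x \<times> pd S j (a i) x"
    by (intro pd_bilinear[OF bounded_bilinear_cross] half_open_S diffs)
  also have "pd S j (\<lambda>x. N x \<bullet> (v x \<times> pd S i N x)) x = pd S j N x \<bullet> (v x \<times> pd S i N x) + N x \<bullet> pd S j (\<lambda>x. v x \<times> pd S i N x) x"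
    by (intro pd_bilinear[OF bounded_bilinear_inner] half_open_S diffs)
  also have "pd S j (\<lambda>x. v x \<times> pd S i N x) x = b j x \<times> pd S i N x + v x \<times> pd S j (pd S i N) x"
    by (intro pd_bilinear[OF bounded_bilinear_cross] half_open_S diffs)
  finally show ?thesis by (simp add: inner_add_right)
qed

lemma d_density_eq:
  "d_density x = - (v x \<bullet> (pd S 1 N x \<times> pd S 2 N x)) - (pd S 1 (\<theta> 2) x - pd S 2 (\<theta> 1) x)"
proof -
  have z: "pd S j N x \<bullet> (dN x \<times> a i x) = 0" for i j
    by (rule triple_zero[OF N_nonzero]) (rule N_orth)+
  \<comment> \<open>In the difference of the derivatives of \<open>\<theta>\<close> these two terms
    reinforce each other; the factor 1/2 in \<open>\<theta>\<close> reduces them to a single copy,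
    which the first term on the right-hand side offsets.\<close>
  have r: "pd S 1 N x \<bullet> (v x \<times> pd S 2 N x) = - (v x \<bullet> (pd S 1 N x \<times> pd S 2 N x))"
    "pd S 2 N x \<bullet> (v x \<times> pd S 1 N x) = v x \<bullet> (pd S 1 N x \<times> pd S 2 N x)"
    by (simp_all add: cross3_simps)
  have "pd S 2 (pd S 1 N) x = pd S 1 (pd S 2 N) x"
    by (rule pd_commute[OF half_open_S x Ck_N, symmetric])
  moreover have "pd S 2 (a 1) x = pd S 1 (a 2) x" by (rule a_commute[OF x, symmetric])
  moreover have "a 1 x \<times> pd S 2 dN x = - (pd S 2 dN x \<times> a 1 x)" "pd S 1 N x \<times> b 2 x = - (b 2 x \<times> pd S 1 N x)"
    by (rule cross_skew)+
  ultimately show ?thesis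
    unfolding pd_theta d_density_def z r
    by (simp add: inner_add_right inner_diff_right field_simps)
qed

lemma pd_psi: "pd S i \<psi> x = - (\<psi> x ^ 3 * (n x \<bullet> pd S i n x))"
  unfolding \<psi>_def[abs_def] by (rule pd_inverse_norm[OF half_open_S x regular[OF x] Ck_SucD(1)[OF Ck_n x]])

lemma pd_dN: "pd S i dN x = pd S i \<psi> x *\<^sub>R dn x + \<psi> x *\<^sub>R pd S i dn x + pd S i \<omega> x *\<^sub>R n x + \<omega> x *\<^sub>R pd S i n x"
proof -
  have "pd S i dN x = pd S i (\<lambda>x. \<psi> x *\<^sub>R dn x) x + pd S i (\<lambda>x. \<omega> x *\<^sub>R n x) x"
    unfolding dN_def[abs_def]
    by (intro pd_add half_open_S x diff_all differentiable_bilinear[OF bounded_bilinear_scaleR])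
  also have "pd S i (\<lambda>x. \<psi> x *\<^sub>R dn x) x = pd S i \<psi> x *\<^sub>R dn x + \<psi> x *\<^sub>R pd S i dn x"
    by (intro pd_bilinear[OF bounded_bilinear_scaleR] half_open_S x diff_all)
  also have "pd S i (\<lambda>x. \<omega> x *\<^sub>R n x) x = pd S i \<omega> x *\<^sub>R n x + \<omega> x *\<^sub>R pd S i n x"
    by (intro pd_bilinear[OF bounded_bilinear_scaleR] half_open_S x diff_all)
  finally show ?thesis by (simp add: add.assoc)
qed

lemma pd_N_psi: "pd S i N x = \<psi> x *\<^sub>R pd S i n x + pd S i \<psi> x *\<^sub>R n x"
  using pd_N[OF x regular[OF x], of i] by (simp add: pd_psi) (simp add: \<psi>_def)

text \<open>The right-hand side is the derivative at t = 0 of \<open>curvature_density\<close> along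
  \<open>r + t v\<close>. To match it with \<open>d_density\<close>, the derivatives of
  \<open>\<psi>\<close> must be eliminated, which succeeds because the vector \<open>AN\<close> has
  no tangential part.\<close>

lemma d_density_quotient:
  defines "A \<equiv> pd S 1 n x \<times> a 2 x + a 1 x \<times> pd S 2 n x"
  defines "P' \<equiv> dn x \<bullet> A + n x \<bullet> (pd S 1 dn x \<times> a 2 x + pd S 1 n x \<times> b 2 x + b 1 x \<times> pd S 2 n x + a 1 x \<times> pd S 2 dn x)"
  shows "d_density x = - (P' * (n x \<bullet> n x) - (n x \<bullet> A) * (2 * (n x \<bullet> dn x))) / (2 * ((n x \<bullet> n x) * (n x \<bullet> n x)))"
proof -
  define p where "p = \<psi> x"
  define Q where "Q = n x \<bullet> n x"
  have pQ: "p * p * Q = 1" using psi_sq by (simp add: p_def Q_def)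
  define AN where "AN = pd S 1 N x \<times> a 2 x + a 1 x \<times> pd S 2 N x"
  have AN: "AN = p *\<^sub>R A + pd S 1 \<psi> x *\<^sub>R (n x \<times> a 2 x) + pd S 2 \<psi> x *\<^sub>R (a 1 x \<times> n x)"
    unfolding AN_def A_def pd_N_psi p_def
    by (simp add: cross_add_left cross_add_right cross_mult_left cross_mult_right algebra_simps)
  have ANn: "AN \<bullet> n x = p * (n x \<bullet> A)"
    unfolding AN inner_commute[of _ "n x"] by (simp add: inner_add_right dot_cross_self)
  have ANa: "AN \<bullet> a 1 x = 0" "AN \<bullet> a 2 x = 0"
    using triple_zero[OF N_nonzero N_orth(1) N_orth(2) N_orth(1)] triple_zero[OF N_nonzero N_orth(1) N_orth(1) N_orth(2)]
    by (simp_all add: AN_def inner_add_left dot_cross_self inner_commute[of "_ \<times> _"])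
  \<comment> \<open>Triple products of tangential vectors vanish, so only the normal component of
    \<open>AN\<close> survives; \<open>p * p * Q = 1\<close> normalises it.\<close>
  have "AN - (p * p * (AN \<bullet> n x)) *\<^sub>R n x = 0"
  proof (rule zero_of_orthogonal_basis)
    show "a 1 x \<times> a 2 x \<noteq> 0" using regular[OF x] by (simp add: nrm_def)
    show "(AN - (p * p * (AN \<bullet> n x)) *\<^sub>R n x) \<bullet> a 1 x = 0" "(AN - (p * p * (AN \<bullet> n x)) *\<^sub>R n x) \<bullet> a 2 x = 0"
      using ANa by (simp_all add: inner_diff_left n_a)
    have "(AN - (p * p * (AN \<bullet> n x)) *\<^sub>R n x) \<bullet> n x = (AN \<bullet> n x) * (1 - p * p * Q)"
      by (simp add: inner_diff_left Q_def algebra_simps)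
    then show "(AN - (p * p * (AN \<bullet> n x)) *\<^sub>R n x) \<bullet> (a 1 x \<times> a 2 x) = 0"
      using pQ by (simp add: nrm_def)
  qed
  then have "AN = (p * p * p * (n x \<bullet> A)) *\<^sub>R n x" using ANn by simp
  then have dnAN: "dn x \<bullet> AN = p * p * p * (n x \<bullet> A) * (n x \<bullet> dn x)"
    by (simp add: inner_commute)
  \<comment> \<open>Comparing this with the previous value of \<open>dn x \<bullet> AN\<close>
    eliminates the derivatives of \<open>\<psi>\<close>, which occur below in exactly this
    combination.\<close>
  have dnAN': "dn x \<bullet> AN = p * (dn x \<bullet> A) - pd S 1 \<psi> x * (n x \<bullet> (dn x \<times> a 2 x)) - pd S 2 \<psi> x * (n x \<bullet> (a 1 x \<times> dn x))"
  proof -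
    have "dn x \<bullet> (n x \<times> a 2 x) = - (n x \<bullet> (dn x \<times> a 2 x))" "dn x \<bullet> (a 1 x \<times> n x) = - (n x \<bullet> (a 1 x \<times> dn x))"
      by (simp_all add: cross3_simps)
    then show ?thesis unfolding AN by (simp add: inner_add_right)
  qed
  define L where "L = n x \<bullet> (pd S 1 dn x \<times> a 2 x + pd S 1 n x \<times> b 2 x + b 1 x \<times> pd S 2 n x + a 1 x \<times> pd S 2 dn x)"
  have z: "n x \<bullet> (n x \<times> u) = 0" "n x \<bullet> (u \<times> n x) = 0" for u by (rule dot_cross_self)+
  have chi: "\<omega> x = - (p * p * p * (n x \<bullet> dn x))" by (simp add: \<omega>_def p_def)
  have "N x \<bullet> (pd S 1 dN x \<times> a 2 x + a 1 x \<times> pd S 2 dN x + pd S 1 N x \<times> b 2 x + b 1 x \<times> pd S 2 N x)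
    = p * (pd S 1 \<psi> x * (n x \<bullet> (dn x \<times> a 2 x)) + pd S 2 \<psi> x * (n x \<bullet> (a 1 x \<times> dn x)) + p * L + \<omega> x * (n x \<bullet> A))"
    unfolding N_eq pd_dN pd_N_psi L_def A_def p_def[symmetric]
    by (simp add: cross_add_left cross_add_right cross_mult_left cross_mult_right inner_add_right z algebra_simps)
  also have "\<dots> = p * (p * (dn x \<bullet> A) - p * p * p * (n x \<bullet> A) * (n x \<bullet> dn x) + p * L + \<omega> x * (n x \<bullet> A))"
    using dnAN dnAN' by (simp add: algebra_simps)
  also have "\<dots> = p * p * P' - 2 * (p * p) * (p * p) * (n x \<bullet> A) * (n x \<bullet> dn x)"
    unfolding chi P'_def L_def[symmetric] by (simp add: algebra_simps)
  also have "p * p = 1 / Q" using pQ by (metis nonzero_eq_divide_eq mult_zero_right zero_neq_one)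
  finally have "d_density x = - (1 / Q * P' - 2 * (1 / Q) * (1 / Q) * (n x \<bullet> A) * (n x \<bullet> dn x)) / 2"
    unfolding d_density_def by simp
  moreover have "Q \<noteq> 0" using pQ by auto
  ultimately show ?thesis unfolding Q_def[symmetric] by (simp add: field_simps)
qed

end

end

section \<open>Differentiation under the integral\<close>

lemma has_real_derivative_triple:
  assumes "(X has_vector_derivative X') (at t within T)"
    and "(Y1 has_vector_derivative Y1') (at t within T)" "(Y2 has_vector_derivative Y2') (at t within T)"
    and "(Z1 has_vector_derivative Z1') (at t within T)" "(Z2 has_vector_derivative Z2') (at t within T)"
  shows "((\<lambda>t. X t \<bullet> (Y1 t \<times> Z2 t + Z1 t \<times> Y2 t)) has_real_derivative
    X' \<bullet> (Y1 t \<times> Z2 t + Z1 t \<times> Y2 t) + X t \<bullet> (Y1' \<times> Z2 t + Y1 t \<times> Z2' + Z1' \<times> Y2 t + Z1 t \<times> Y2')) (at t within T)"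
proof -
  have "((\<lambda>t. Y1 t \<times> Z2 t + Z1 t \<times> Y2 t) has_vector_derivative
    (Y1 t \<times> Z2' + Y1' \<times> Z2 t) + (Z1 t \<times> Y2' + Z1' \<times> Y2 t)) (at t within T)"
    by (intro has_vector_derivative_add bounded_bilinear.has_vector_derivative[OF bounded_bilinear_cross] assms)
  from bounded_bilinear.has_vector_derivative[OF bounded_bilinear_inner assms(1) this]
  show ?thesis
    unfolding has_real_derivative_iff_has_vector_derivative by (simp add: algebra_simps)
qed

context patch_variation
begin

abbreviation deformed :: "real \<Rightarrow> real^2 \<Rightarrow> real^3" where
  "deformed t \<equiv> \<lambda>x. r x + t *\<^sub>R v x"

lemma pd_scaleR_const:
  assumes "x \<in> S" "f differentiable (at x within S)"
  shows "pd S i (\<lambda>x. t *\<^sub>R f x) x = t *\<^sub>R pd S i f x"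
  by (rule pd_linear[OF bounded_linear_scaleR_right half_open_S assms])

lemma differentiable_scaleR_const:
  "f differentiable (at x within S) \<Longrightarrow> (\<lambda>x. t *\<^sub>R f x) differentiable (at x within S)"
  by (rule differentiable_scaleR) simp_all

lemma pd_deformed: "x \<in> S \<Longrightarrow> pd S i (deformed t) x = a i x + t *\<^sub>R b i x"
  by (simp add: pd_add[OF half_open_S] pd_scaleR_const differentiable_scaleR_const
      Ck_SucD(1)[OF Ck_r] Ck_SucD(1)[OF Ck_v])

lemma nrm_deformed: "x \<in> S \<Longrightarrow> nrm S (deformed t) x = n x + t *\<^sub>R dn x + t\<^sup>2 *\<^sub>R ddn x"
  by (simp add: nrm_def pd_deformed dn_def ddn_def cross_add_left cross_add_right cross_mult_left
      cross_mult_right power2_eq_square algebra_simps)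

lemma pd_nrm_deformed:
  assumes x: "x \<in> S"
  shows "pd S i (nrm S (deformed t)) x = pd S i n x + t *\<^sub>R pd S i dn x + t\<^sup>2 *\<^sub>R pd S i ddn x"
proof -
  have "pd S i (nrm S (deformed t)) x = pd S i (\<lambda>x. n x + t *\<^sub>R dn x + t\<^sup>2 *\<^sub>R ddn x) x"
    by (rule pd_cong[OF nrm_deformed x])
  then show ?thesis
    using x by (simp add: pd_add[OF half_open_S] pd_scaleR_const differentiable_scaleR_const
      differentiable_add diff_all)
qed

text \<open>Let m be the minimum of \<open>norm (n x)\<close> on \<open>K\<close> and C a bound for
  \<open>norm (dn x) + norm (ddn x)\<close>. For \<bar>t\<bar> < min 1 (m / C) the change of the
  normal has norm below m; the bound 1 gives t^2 \<le> \<bar>t\<bar>.\<close>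

lemma regular_nearby:
  assumes K: "compact K" "K \<subseteq> S"
  obtains \<epsilon> where "\<epsilon> > 0" "\<And>t x. \<bar>t\<bar> < \<epsilon> \<Longrightarrow> x \<in> K \<Longrightarrow> nrm S (deformed t) x \<noteq> 0"
proof (cases "K = {}")
  case True
  then show ?thesis using that[of 1] by simp
next
  case False
  have cont: "continuous_on K (\<lambda>x. norm (n x))" "continuous_on K (\<lambda>x. norm (dn x) + norm (ddn x))"
    using continuous_on_subset[OF Ck_continuous[OF Ck_n] K(2)] continuous_on_subset[OF Ck_continuous[OF Ck_dn] K(2)]
      continuous_on_subset[OF Ck_continuous[OF Ck_ddn] K(2)] by (intro continuous_intros; simp)+
  obtain y where y: "y \<in> K" "\<And>x. x \<in> K \<Longrightarrow> norm (n y) \<le> norm (n x)"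
    using continuous_attains_inf[OF K(1) False cont(1)] by auto
  obtain z where z: "z \<in> K" "\<And>x. x \<in> K \<Longrightarrow> norm (dn x) + norm (ddn x) \<le> norm (dn z) + norm (ddn z)"
    using continuous_attains_sup[OF K(1) False cont(2)] by auto
  define m where "m = norm (n y)"
  \<comment> \<open>The summand 1 keeps C positive even if \<open>dn\<close> and \<open>ddn\<close>
    vanish on \<open>K\<close>.\<close>
  define C where "C = norm (dn z) + norm (ddn z) + 1"
  have m: "m > 0" using regular y(1) K(2) by (auto simp: m_def)
  have C: "C > 0" using norm_ge_zero[of "dn z"] norm_ge_zero[of "ddn z"] unfolding C_def by linarith
  show ?thesis
  proof (rule that[of "min 1 (m / C)"])
    show "0 < min 1 (m / C)" using m C by simp
    fix t x assume t: "\<bar>t\<bar> < min 1 (m / C)" and x: "x \<in> K"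
    show "nrm S (deformed t) x \<noteq> 0"
    proof
      assume "nrm S (deformed t) x = 0"
      then have "n x = - (t *\<^sub>R dn x + t\<^sup>2 *\<^sub>R ddn x)"
        using nrm_deformed[of x t] x K(2) by (auto simp: add_eq_0_iff2 add.assoc)
      then have "norm (n x) = norm (t *\<^sub>R dn x + t\<^sup>2 *\<^sub>R ddn x)" by (simp only: norm_minus_cancel)
      also have "\<dots> \<le> \<bar>t\<bar> * norm (dn x) + t\<^sup>2 * norm (ddn x)"
        by (rule order_trans[OF norm_triangle_ineq]) simp
      also have "t\<^sup>2 * norm (ddn x) \<le> \<bar>t\<bar> * norm (ddn x)"
      proof (rule mult_right_mono)
        have "\<bar>t\<bar> * \<bar>t\<bar> \<le> \<bar>t\<bar> * 1" using t by (intro mult_left_mono) auto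
        then show "t\<^sup>2 \<le> \<bar>t\<bar>" by (simp add: power2_eq_square)
      qed simp
      finally have "norm (n x) \<le> \<bar>t\<bar> * (norm (dn x) + norm (ddn x))" by (simp add: distrib_left)
      also have "\<dots> \<le> \<bar>t\<bar> * C" using z(2)[OF x] by (intro mult_left_mono) (auto simp: C_def)
      also have "\<dots> < m" using t C by (simp add: pos_less_divide_eq)
      finally show False using y(2)[OF x] by (simp add: m_def)
    qed
  qed
qed

text \<open>Box and weight stay fixed while t varies, and on the box the density is a quotient of
  polynomials in t whose denominator has no zero for t near 0. Its t-derivative is jointly
  continuous, which justifies the Leibniz rule.\<close>

lemma curvature_density_derivative:
  fixes c d :: "real^2"
  assumes cd: "cbox c d \<subseteq> S" and \<rho>: "continuous_on (cbox c d) \<rho>"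
  shows "((\<lambda>t. integral (cbox c d) (\<lambda>x. \<rho> x * curvature_density S (deformed t) x)) has_real_derivative
    integral (cbox c d) (\<lambda>x. \<rho> x * d_density x)) (at 0)"
proof -
  let ?K = "cbox c d"
  define X where "X t x = n x + t *\<^sub>R dn x + t\<^sup>2 *\<^sub>R ddn x" for t x
  define Y where "Y i t x = pd S i n x + t *\<^sub>R pd S i dn x + t\<^sup>2 *\<^sub>R pd S i ddn x" for i t x
  define Z where "Z i t x = a i x + t *\<^sub>R b i x" for i t x
  define X' where "X' t x = dn x + (2 * t) *\<^sub>R ddn x" for t x
  define Y' where "Y' i t x = pd S i dn x + (2 * t) *\<^sub>R pd S i ddn x" for i t x
  define P where "P t x = X t x \<bullet> (Y 1 t x \<times> Z 2 t x + Z 1 t x \<times> Y 2 t x)" for t x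
  define P' where "P' t x = X' t x \<bullet> (Y 1 t x \<times> Z 2 t x + Z 1 t x \<times> Y 2 t x)
    + X t x \<bullet> (Y' 1 t x \<times> Z 2 t x + Y 1 t x \<times> b 2 x + b 1 x \<times> Y 2 t x + Z 1 t x \<times> Y' 2 t x)" for t x
  define Q where "Q t x = X t x \<bullet> X t x" for t x
  \<comment> \<open>The t-derivative of the weighted density; at t = 0 its fraction becomes the one
    in \<open>d_density_quotient\<close>.\<close>
  define G where "G t x = \<rho> x * (- (P' t x * Q t x - P t x * (2 * (X t x \<bullet> X' t x))) / (2 * (Q t x * Q t x)))" for t x
  obtain \<epsilon> where \<epsilon>: "\<epsilon> > 0" "\<And>t x. \<bar>t\<bar> < \<epsilon> \<Longrightarrow> x \<in> ?K \<Longrightarrow> nrm S (deformed t) x \<noteq> 0"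
    by (rule regular_nearby[OF compact_cbox cd]) blast
  define U where "U = {-\<epsilon><..<\<epsilon>}"
  have Q0: "Q t x \<noteq> 0" if "t \<in> U" "x \<in> ?K" for t x
    using \<epsilon>(2)[of t x] that nrm_deformed[OF subsetD[OF cd that(2)], of t]
    by (simp add: Q_def X_def U_def abs_less_iff)
  have dens: "curvature_density S (deformed t) x = - P t x / (2 * Q t x)" if "x \<in> ?K" for t x
    using that cd by (auto simp: curvature_density_def nrm_deformed pd_nrm_deformed pd_deformed P_def Q_def X_def Y_def Z_def)
  have der: "((\<lambda>t. \<rho> x * (- P t x / (2 * Q t x))) has_real_derivative G t x) (at t within U)" if t: "t \<in> U" "x \<in> ?K" for t x
  proof -
    have sq: "((\<lambda>t. t\<^sup>2 *\<^sub>R u) has_vector_derivative (2 * t) *\<^sub>R u) (at t within U)" for u :: "real^3"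
      by (auto intro!: derivative_eq_intros)
    have X: "((\<lambda>t. X t x) has_vector_derivative X' t x) (at t within U)"
      unfolding X_def X'_def by (auto intro!: derivative_eq_intros sq)
    have Y: "((\<lambda>t. Y i t x) has_vector_derivative Y' i t x) (at t within U)" for i
      unfolding Y_def Y'_def by (auto intro!: derivative_eq_intros sq)
    have Z: "((\<lambda>t. Z i t x) has_vector_derivative b i x) (at t within U)" for i
      unfolding Z_def by (auto intro!: derivative_eq_intros)
    have P: "((\<lambda>t. P t x) has_real_derivative P' t x) (at t within U)"
      unfolding P_def P'_def by (intro has_real_derivative_triple X Y Z)
    have Q: "((\<lambda>t. Q t x) has_real_derivative 2 * (X t x \<bullet> X' t x)) (at t within U)"
      using bounded_bilinear.has_vector_derivative[OF bounded_bilinear_inner X X]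
      unfolding Q_def has_real_derivative_iff_has_vector_derivative by (simp add: inner_commute)
    have "((\<lambda>t. - P t x / (2 * Q t x)) has_real_derivative
      ((- P' t x) * (2 * Q t x) - (- P t x) * (2 * (2 * (X t x \<bullet> X' t x)))) / (2 * Q t x * (2 * Q t x))) (at t within U)"
      using Q0[OF t] by (intro DERIV_divide DERIV_minus DERIV_cmult P Q) simp
    from DERIV_cmult[OF this, of "\<rho> x"] show ?thesis
      by (rule DERIV_cong) (use Q0[OF t] in \<open>simp add: G_def field_simps\<close>)
  qed
  have cont: "continuous_on (SIGMA t:U. ?K) (\<lambda>p. f (snd p))" if "continuous_on S f" for f :: "real^2 \<Rightarrow> real^3"
    by (rule continuous_on_compose2[OF that continuous_on_snd[OF continuous_on_id]]) (use cd in auto)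
  have cont\<rho>: "continuous_on (SIGMA t:U. ?K) (\<lambda>p. \<rho> (snd p))"
    by (rule continuous_on_compose2[OF \<rho> continuous_on_snd[OF continuous_on_id]]) auto
  note C = cont[OF Ck_continuous[OF Ck_a]] cont[OF Ck_continuous[OF Ck_b]] cont[OF Ck_continuous[OF Ck_n]]
    cont[OF Ck_continuous[OF Ck_dn]] cont[OF Ck_continuous[OF Ck_ddn]] cont[OF Ck_continuous[OF Ck_SucD(2)[OF Ck_n]]]
    cont[OF Ck_continuous[OF Ck_SucD(2)[OF Ck_dn]]] cont[OF Ck_continuous[OF Ck_SucD(2)[OF Ck_ddn]]]
  have CX: "continuous_on (SIGMA t:U. ?K) (\<lambda>p. X (fst p) (snd p))"
    "continuous_on (SIGMA t:U. ?K) (\<lambda>p. X' (fst p) (snd p))"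
    unfolding X_def X'_def by (intro continuous_intros C)+
  have CY: "continuous_on (SIGMA t:U. ?K) (\<lambda>p. Y i (fst p) (snd p))"
    "continuous_on (SIGMA t:U. ?K) (\<lambda>p. Y' i (fst p) (snd p))" "continuous_on (SIGMA t:U. ?K) (\<lambda>p. Z i (fst p) (snd p))" for i
    unfolding Y_def Y'_def Z_def by (intro continuous_intros C)+
  have CP: "continuous_on (SIGMA t:U. ?K) (\<lambda>p. P (fst p) (snd p))" "continuous_on (SIGMA t:U. ?K) (\<lambda>p. P' (fst p) (snd p))"
    "continuous_on (SIGMA t:U. ?K) (\<lambda>p. Q (fst p) (snd p))"
    unfolding P_def P'_def Q_def by (intro continuous_intros continuous_on_cross CX CY C)+
  have contG: "continuous_on (SIGMA t:U. ?K) (\<lambda>(t, x). G t x)"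
    unfolding G_def split_beta using Q0 by (intro continuous_intros cont\<rho> CP CX) auto
  have int: "(\<lambda>x. \<rho> x * (- P t x / (2 * Q t x))) integrable_on ?K" if t: "t \<in> U" for t
  proof (rule integrable_continuous)
    have f: "continuous_on ?K (\<lambda>x. (t, x))" by (intro continuous_intros)
    have sub: "(\<lambda>x. (t, x)) ` ?K \<subseteq> (SIGMA t:U. ?K)" using t by auto
    have "continuous_on ?K (\<lambda>x. P t x)" "continuous_on ?K (\<lambda>x. Q t x)"
      using continuous_on_compose2[OF CP(1) f sub] continuous_on_compose2[OF CP(3) f sub] by simp_all
    then show "continuous_on ?K (\<lambda>x. \<rho> x * (- P t x / (2 * Q t x)))"
      using Q0[OF t] by (intro continuous_intros \<rho>) auto
  qed
  have U: "0 \<in> U" "convex U" "open U" using \<epsilon>(1) by (auto simp: U_def)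
  have "((\<lambda>t. integral ?K (\<lambda>x. \<rho> x * (- P t x / (2 * Q t x)))) has_real_derivative integral ?K (G 0)) (at 0 within U)"
    by (rule leibniz_rule_field_derivative[OF der int contG U(1,2)])
  also have "at 0 within U = at 0" by (rule at_within_open[OF U(1,3)])
  also have "(\<lambda>t. integral ?K (\<lambda>x. \<rho> x * (- P t x / (2 * Q t x)))) = (\<lambda>t. integral ?K (\<lambda>x. \<rho> x * curvature_density S (deformed t) x))"
    by (intro ext integral_cong) (simp add: dens)
  also have "integral ?K (G 0) = integral ?K (\<lambda>x. \<rho> x * d_density x)"
    using cd by (intro integral_cong)
      (auto simp: G_def d_density_quotient P_def P'_def Q_def X_def Y_def Z_def X'_def Y'_def)
  finally show ?thesis .
qed

end

section \<open>Stokes' theorem on a coordinate box\<close>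

lemma ex_2: "(\<exists>i::2. P i) \<longleftrightarrow> P 1 \<or> P 2"
  by (metis exhaust_2)

text \<open>Fubini's theorem concerns pairs of reals; the identification with \<open>real^2\<close>
  carries boxes to boxes of equal content, which transfers the integral.\<close>

lemma integral_real2_prod:
  fixes f :: "real^2 \<Rightarrow> real"
  assumes f: "continuous_on (cbox c d) f"
  shows "integral (cbox c d) f = integral (cbox (c $ 1, c $ 2) (d $ 1, d $ 2)) (\<lambda>p. f (vector [fst p, snd p]))"
proof -
  define g :: "real \<times> real \<Rightarrow> real^2" where "g = (\<lambda>p. vector [fst p, snd p])"
  define h :: "real^2 \<Rightarrow> real \<times> real" where "h = (\<lambda>x. (x $ 1, x $ 2))"
  have hg: "h (g p) = p" for p by (simp add: g_def h_def)
  have gh: "g (h x) = x" for x by (simp add: g_def h_def vec_eq_iff forall_2)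
  have gbox: "g ` cbox u v = cbox (g u) (g v)" for u v
  proof -
    have "g p \<in> cbox (g u) (g v)" if "p \<in> cbox u v" for p
      using that by (cases u; cases v; cases p) (auto simp: g_def mem_box_cart forall_2 cbox_Pair_eq)
    moreover have "h x \<in> cbox u v" if "x \<in> cbox (g u) (g v)" for x
      using that by (cases u; cases v) (auto simp: g_def h_def mem_box_cart forall_2 cbox_Pair_eq)
    ultimately show ?thesis using gh by (metis image_eqI image_subsetI subsetI subset_antisym)
  qed
  have hbox: "h ` cbox u v = cbox (h u) (h v)" for u v
  proof -
    have "cbox u v = g ` cbox (h u) (h v)" by (simp add: gbox gh)
    then show ?thesis by (simp add: image_image hg)
  qed
  have cont: "continuous (at x) g" for x
  proof -
    have "g = (\<lambda>p. fst p *\<^sub>R axis 1 1 + snd p *\<^sub>R axis 2 1)"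
      by (auto simp: g_def fun_eq_iff vec_eq_iff forall_2 axis_def)
    then show ?thesis by (auto intro!: continuous_intros)
  qed
  have content: "measure lborel (g ` cbox u v) = 1 * measure lborel (cbox u v)" for u v
  proof -
    obtain u1 u2 v1 v2 where uv: "u = (u1, u2)" "v = (v1, v2)" by (cases u; cases v)
    have "measure lborel (cbox (g u) (g v)) = (if u1 \<le> v1 \<and> u2 \<le> v2 then (v1 - u1) * (v2 - u2) else 0)"
      by (simp add: content_cbox_if_cart interval_eq_empty_cart uv g_def ex_2 UNIV_2 not_less)
    then show ?thesis unfolding gbox uv content_Pair by (auto simp: content_real_if)
  qed
  have "(f has_integral integral (cbox c d) f) (cbox c d)"
    using integrable_continuous[OF f] by (rule integrable_integral)
  moreover have "\<exists>w z. g ` cbox u v = cbox w z" for u v using gbox by blast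
  moreover have "\<exists>w z. h ` cbox u v = cbox w z" for u v using hbox by blast
  ultimately have "((\<lambda>p. f (g p)) has_integral (1 / 1) *\<^sub>R integral (cbox c d) f) (h ` cbox c d)"
    by (intro has_integral_twiddle zero_less_one hg gh cont content)
  then have "((\<lambda>p. f (g p)) has_integral integral (cbox c d) f) (h ` cbox c d)" by simp
  then show ?thesis unfolding hbox by (simp add: g_def h_def integral_unique)
qed

text \<open>The fundamental theorem of calculus along each coordinate line. The form vanishes on
  three sides, so only the lower side contributes; that side may lie on the boundary of the
  half-plane.\<close>

lemma box_stokes:
  fixes f1 f2 :: "real^2 \<Rightarrow> real"
  assumes S: "half_open S" and cd: "cbox c d \<subseteq> S" and le: "c $ 1 \<le> d $ 1" "c $ 2 \<le> d $ 2"
    and f: "Ck 1 S f1" "Ck 1 S f2"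
    and side: "\<And>x. x \<in> cbox c d \<Longrightarrow> x $ 1 = c $ 1 \<or> x $ 1 = d $ 1 \<or> x $ 2 = d $ 2 \<Longrightarrow> f1 x = 0 \<and> f2 x = 0"
  shows "integral (cbox c d) (\<lambda>x. pd S 1 f2 x - pd S 2 f1 x) = integral {c $ 1..d $ 1} (\<lambda>s. f1 (vector [s, c $ 2]))"
proof -
  have f': "Ck (Suc 0) S f1" "Ck (Suc 0) S f2" using f by (simp_all only: One_nat_def)
  have cont: "continuous_on (cbox c d) (pd S 1 f2)" "continuous_on (cbox c d) (pd S 2 f1)"
    using Ck_SucD(2)[OF f'(1), of 2] Ck_SucD(2)[OF f'(2), of 1] continuous_on_subset[OF _ cd] by simp_all
  have vec: "(vector [s, u] :: real^2) = s *\<^sub>R axis 1 1 + u *\<^sub>R axis 2 1" for s u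
    by (simp add: vec_eq_iff forall_2 axis_def)
  have inbox: "vector [s, u] \<in> cbox c d" if "s \<in> {c $ 1..d $ 1}" "u \<in> {c $ 2..d $ 2}" for s u
    using that by (simp add: mem_box_cart forall_2)
  have cont': "continuous_on (cbox (c $ 1, c $ 2) (d $ 1, d $ 2)) (\<lambda>p. g (vector [fst p, snd p]))"
    if "continuous_on (cbox c d) g" for g :: "real^2 \<Rightarrow> real"
    by (rule continuous_on_compose2[OF that]) (auto simp: vec intro!: continuous_intros, auto simp: vec[symmetric] cbox_Pair_eq intro!: inbox)
  have 1: "integral {c $ 1..d $ 1} (\<lambda>s. pd S 1 f2 (vector [s, u])) = 0" if u: "u \<in> {c $ 2..d $ 2}" for u
  proof -
    have "((\<lambda>s. f2 (vector [s, u])) has_vector_derivative pd S 1 f2 (vector [s, u])) (at s within {c $ 1..d $ 1})"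
      if s: "s \<in> {c $ 1..d $ 1}" for s
      using has_real_derivative_line[of f2 "u *\<^sub>R axis 2 1" s 1 S "{c $ 1..d $ 1}"]
        Ck_SucD(1)[OF f'(2) subsetD[OF cd inbox[OF s u]]] subsetD[OF cd inbox[OF _ u]]
      unfolding vec has_real_derivative_iff_has_vector_derivative by (simp add: add.commute)
    then have "((\<lambda>s. pd S 1 f2 (vector [s, u])) has_integral f2 (vector [d $ 1, u]) - f2 (vector [c $ 1, u])) {c $ 1..d $ 1}"
      by (rule fundamental_theorem_of_calculus[OF le(1)])
    then show ?thesis
      using side[OF inbox[OF _ u, of "d $ 1"]] side[OF inbox[OF _ u, of "c $ 1"]] le by (simp add: integral_unique)
  qed
  have 2: "integral {c $ 2..d $ 2} (\<lambda>u. pd S 2 f1 (vector [s, u])) = - f1 (vector [s, c $ 2])" if s: "s \<in> {c $ 1..d $ 1}" for s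
  proof -
    have "((\<lambda>u. f1 (vector [s, u])) has_vector_derivative pd S 2 f1 (vector [s, u])) (at u within {c $ 2..d $ 2})"
      if u: "u \<in> {c $ 2..d $ 2}" for u
      using has_real_derivative_line[of f1 "s *\<^sub>R axis 1 1" u 2 S "{c $ 2..d $ 2}"]
        Ck_SucD(1)[OF f'(1) subsetD[OF cd inbox[OF s u]]] subsetD[OF cd inbox[OF s]]
      unfolding vec has_real_derivative_iff_has_vector_derivative by simp
    then have "((\<lambda>u. pd S 2 f1 (vector [s, u])) has_integral f1 (vector [s, d $ 2]) - f1 (vector [s, c $ 2])) {c $ 2..d $ 2}"
      by (rule fundamental_theorem_of_calculus[OF le(2)])
    then show ?thesis
      using side[OF inbox[OF s, of "d $ 2"]] le by (simp add: integral_unique)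
  qed
  have "integral (cbox c d) (pd S 1 f2) = integral {c $ 2..d $ 2} (\<lambda>u. integral {c $ 1..d $ 1} (\<lambda>s. pd S 1 f2 (vector [s, u])))"
    using integral_real2_prod[OF cont(1)] integral_prod_continuous[OF cont'[OF cont(1)]]
      integral_swap_continuous[of "c $ 1" "c $ 2" "d $ 1" "d $ 2" "\<lambda>s u. pd S 1 f2 (vector [s, u])"] cont'[OF cont(1)]
    by (simp add: split_beta)
  also have "\<dots> = integral {c $ 2..d $ 2} (\<lambda>u. 0)" by (rule integral_cong) (rule 1)
  finally have i1: "integral (cbox c d) (pd S 1 f2) = 0" by simp
  have "integral (cbox c d) (pd S 2 f1) = integral {c $ 1..d $ 1} (\<lambda>s. integral {c $ 2..d $ 2} (\<lambda>u. pd S 2 f1 (vector [s, u])))"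
    using integral_real2_prod[OF cont(2)] integral_prod_continuous[OF cont'[OF cont(2)]] by simp
  also have "\<dots> = integral {c $ 1..d $ 1} (\<lambda>s. - f1 (vector [s, c $ 2]))" by (rule integral_cong) (rule 2)
  finally have i2: "integral (cbox c d) (pd S 2 f1) = - integral {c $ 1..d $ 1} (\<lambda>s. f1 (vector [s, c $ 2]))" by simp
  show ?thesis
    using i1 i2 by (simp add: integral_diff integrable_continuous cont)
qed

section \<open>A partition of unity\<close>

text \<open>Provides a continuously differentiable cutoff in closed form. One derivative suffices
  for the partition of unity, since Stokes' theorem differentiates \<rho> \<theta> once.\<close>

lemma DERIV_pos_part_square: "((\<lambda>y::real. (max 0 y)\<^sup>2) has_real_derivative 2 * max 0 y) (at y)"
proof (cases y "0::real" rule: linorder_cases)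
  case less
  have "((\<lambda>y. 0) has_real_derivative 2 * max 0 y) (at y)" using less by simp
  then show ?thesis
    by (rule DERIV_cong_ev[THEN iffD1, rotated -1])
       (use less in \<open>auto intro!: eventually_mono[OF eventually_nhds_in_open[of "{..<0}"]]\<close>)
next
  case greater
  have "((\<lambda>y. y\<^sup>2) has_real_derivative 2 * max 0 y) (at y)"
    using greater by (auto intro!: derivative_eq_intros)
  then show ?thesis
    by (rule DERIV_cong_ev[THEN iffD1, rotated -1])
       (use greater in \<open>auto intro!: eventually_mono[OF eventually_nhds_in_open[of "{0<..}"]]\<close>)
next
  case equal
  have "((\<lambda>h. (max 0 h)\<^sup>2 / h) \<longlongrightarrow> 0) (at (0::real))"
  proof (rule Lim_null_comparison)
    show "\<forall>\<^sub>F h in at 0. norm ((max 0 h)\<^sup>2 / h) \<le> \<bar>h::real\<bar>"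
      by (rule always_eventually) (auto simp: max_def power2_eq_square)
    show "((\<lambda>h::real. \<bar>h\<bar>) \<longlongrightarrow> 0) (at 0)" by (auto intro!: tendsto_eq_intros)
  qed
  then show ?thesis using equal by (simp add: DERIV_def)
qed

lemma Ck_compose_real:
  fixes f :: "real^2 \<Rightarrow> real" and g g' :: "real \<Rightarrow> real"
  assumes g: "\<And>y. (g has_real_derivative g' y) (at y)" "continuous_on UNIV g'"
    and S: "half_open S" and f: "Ck 1 S f"
  shows "Ck 1 S (\<lambda>x. g (f x))"
proof -
  have f': "Ck (Suc 0) S f" using f by simp
  have der: "((\<lambda>x. g (f x)) has_derivative (\<lambda>v. frechet_derivative f (at x within S) v * g' (f x))) (at x within S)" if "x \<in> S" for x
    using DERIV_compose_FDERIV[OF g(1)] Ck_SucD(1)[OF f' that] by (simp add: frechet_derivative_works)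
  have "Ck 0 S (pd S i (\<lambda>x. g (f x)))" for i
  proof (rule Ck_cong)
    have "continuous_on S (\<lambda>x. g' (f x))"
      by (rule continuous_on_compose2[OF g(2) Ck_continuous[OF f]]) simp
    then show "Ck 0 S (\<lambda>x. pd S i f x * g' (f x))"
      using Ck_SucD(2)[OF f', of i] by (auto intro!: continuous_intros)
    show "pd S i f x * g' (f x) = pd S i (\<lambda>x. g (f x)) x" if "x \<in> S" for x
      using pd_eqI[OF S that der[OF that]] by (simp add: pd_def)
  qed
  then show ?thesis using der by (auto simp: differentiable_def)
qed

text \<open>A product of one-variable cutoffs, so that the support is a square with sides parallel
  to the axes, the shape on which \<open>box_stokes\<close> works.\<close>

definition bump :: "real^2 \<Rightarrow> real \<Rightarrow> real^2 \<Rightarrow> real" where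
  "bump x0 r y = (max 0 (r\<^sup>2 - (y $ 1 - x0 $ 1)\<^sup>2))\<^sup>2 * (max 0 (r\<^sup>2 - (y $ 2 - x0 $ 2)\<^sup>2))\<^sup>2"

lemma bump_nonneg: "0 \<le> bump x0 r y" by (simp add: bump_def)

lemma bump_center: "r > 0 \<Longrightarrow> 0 < bump x0 r x0" by (simp add: bump_def)

lemma bump_nonzero:
  assumes "bump x0 r y \<noteq> 0" "r > 0"
  shows "\<bar>y $ i - x0 $ i\<bar> < r"
proof -
  have *: "(y $ i - x0 $ i)\<^sup>2 < r\<^sup>2" using assms exhaust_2[of i] by (auto simp: bump_def max_def split: if_splits)
  then show ?thesis using power2_less_imp_less[of "\<bar>y $ i - x0 $ i\<bar>" r] assms(2) by simp
qed

lemma Ck_bump: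
  assumes S: "half_open S" and g: "Ck 1 S g"
  shows "Ck 1 S (\<lambda>x. bump x0 r (g x))"
proof -
  have "Ck 1 S (\<lambda>x. g x $ i)" for i by (rule Ck_linear[OF bounded_linear_vec_nth S g])
  then have "Ck 1 S (\<lambda>x. r\<^sup>2 + (-1) * ((g x $ i + (- (x0 $ i))) * (g x $ i + (- (x0 $ i)))))" for i
    by (intro Ck_add Ck_mult Ck_const S)
  then have "Ck 1 S (\<lambda>x. r\<^sup>2 - (g x $ i - x0 $ i)\<^sup>2)" for i
    by (rule Ck_cong[rotated]) (simp add: power2_eq_square)
  then have "Ck 1 S (\<lambda>x. (max 0 (r\<^sup>2 - (g x $ i - x0 $ i)\<^sup>2))\<^sup>2)" for i
    by (intro Ck_compose_real[OF DERIV_pos_part_square _ S] continuous_intros)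
  then show ?thesis unfolding bump_def by (intro Ck_mult S)
qed

context surface
begin

text \<open>The last conjunct leaves a box free to have one side on the boundary line of the half-plane,
  where the function need not vanish.\<close>

definition supported :: "'a coords \<Rightarrow> real^2 \<Rightarrow> real^2 \<Rightarrow> ('a \<Rightarrow> real) \<Rightarrow> bool" where
  "supported c l u \<rho> \<longleftrightarrow> c \<in> \<A> \<and> cbox l u \<subseteq> cimg c \<and> l $ 1 \<le> u $ 1 \<and> l $ 2 \<le> u $ 2 \<and>
    (\<forall>q\<in>M - cinv c ` cbox l u. \<rho> q = 0) \<and> (\<forall>d\<in>\<A>. Ck 1 (cimg d) (\<rho> \<circ> cinv d)) \<and>
    (\<forall>x\<in>cbox l u. x $ 1 = l $ 1 \<or> x $ 1 = u $ 1 \<or> x $ 2 = u $ 2 \<or> x $ 2 = l $ 2 \<and> 0 < l $ 2 \<longrightarrow> \<rho> (cinv c x) = 0)"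

lemma compact_box_image:
  assumes "c \<in> \<A>" "cbox l u \<subseteq> cimg c"
  shows "compact (cinv c ` cbox l u)"
  by (intro compact_continuous_image continuous_on_subset[OF continuous_cinv[OF assms(1)] assms(2)]) simp

text \<open>The image of the box is compact, hence closed in the Hausdorff space, and its preimage
  in any other chart is relatively closed.\<close>

lemma openin_off_box:
  assumes "c \<in> \<A>" "cbox l u \<subseteq> cimg c" "d \<in> \<A>"
  shows "openin (top_of_set (cimg d)) {x \<in> cimg d. cinv d x \<notin> cinv c ` cbox l u}"
proof -
  have "open (- cinv c ` cbox l u)"
    using compact_imp_closed[OF compact_box_image[OF assms(1,2)]] by (simp add: open_Compl)
  from continuous_openin_preimage_gen[OF continuous_cinv[OF assms(3)] this] show ?thesis
    by (rule back_subst[of "openin _"]) auto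
qed

text \<open>In another chart the function is the bump composed with the transition on the overlap,
  and zero off the compact image of the box. These two relatively open sets cover the chart, so
  \<open>Ck_local\<close> applies.\<close>

lemma local_bump:
  assumes p: "p \<in> M"
  obtains c l u \<psi> where "supported c l u \<psi>" "\<psi> p > 0" "\<And>q. q \<in> M \<Longrightarrow> 0 \<le> \<psi> q"
    "openin (top_of_set M) {q \<in> M. 0 < \<psi> q}"
proof -
  define c where "c = chart_at \<A> p"
  have c: "c \<in> \<A>" "p \<in> cdom c" using chart_at[OF p] by (simp_all add: c_def)
  define x0 where "x0 = cmap c p"
  have x0: "x0 \<in> cimg c" using c by (simp add: x0_def)
  obtain e where e: "e > 0" "\<And>y. 0 \<le> y $ 2 \<Longrightarrow> dist y x0 < e \<Longrightarrow> y \<in> cimg c"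
    by (rule half_open_ball[OF half_open_cimg[OF c(1)] x0]) blast
  \<comment> \<open>Half-sides of length e / 3 keep the square within distance 2 e / 3 < e of its
    centre.\<close>
  define r where "r = e / 3"
  have r: "r > 0" using e by (simp add: r_def)
  \<comment> \<open>The square is cut off at height 0. If \<open>l $ 2 = 0\<close>, the lower side
    lies on the boundary line and the bump need not vanish there; otherwise all four sides are at
    distance \<open>r\<close> from the centre, where it vanishes.\<close>
  define l u :: "real^2" where "l = vector [x0 $ 1 - r, max 0 (x0 $ 2 - r)]" and "u = vector [x0 $ 1 + r, x0 $ 2 + r]"
  have x02: "0 \<le> x0 $ 2" by (rule half_open_nonneg[OF half_open_cimg[OF c(1)] x0])
  have box: "y \<in> cbox l u \<longleftrightarrow> 0 \<le> y $ 2 \<and> \<bar>y $ 1 - x0 $ 1\<bar> \<le> r \<and> \<bar>y $ 2 - x0 $ 2\<bar> \<le> r" for y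
    unfolding mem_box_cart forall_2 l_def u_def vector_2 by (auto simp: abs_le_iff)
  have sub: "cbox l u \<subseteq> cimg c"
  proof
    fix y assume y: "y \<in> cbox l u"
    have "norm (y - x0) \<le> \<bar>(y - x0) $ 1\<bar> + \<bar>(y - x0) $ 2\<bar>"
      using norm_le_l1_cart[of "y - x0"] by (simp add: sum_2)
    also have "\<dots> < e" using y e(1) by (simp add: box r_def)
    finally show "y \<in> cimg c" using y e(2)[of y] by (simp add: box dist_norm)
  qed
  define \<psi> where "\<psi> q = (if q \<in> cdom c then bump x0 r (cmap c q) else 0)" for q
  have bump_box: "y \<in> cbox l u" if "bump x0 r y \<noteq> 0" "y \<in> cimg c" for y
    using bump_nonzero[OF that(1) r, of 1] bump_nonzero[OF that(1) r, of 2] half_open_nonneg[OF half_open_cimg[OF c(1)] that(2)]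
    by (simp add: box less_imp_le)
  have off: "\<psi> q = 0" if "q \<notin> cinv c ` cbox l u" for q
  proof (rule ccontr)
    assume "\<psi> q \<noteq> 0"
    then have q: "q \<in> cdom c" "bump x0 r (cmap c q) \<noteq> 0" by (auto simp: \<psi>_def split: if_splits)
    then have "cmap c q \<in> cbox l u" using bump_box by blast
    then have "cinv c (cmap c q) \<in> cinv c ` cbox l u" by (rule imageI)
    then show False using that cinv_cmap[OF c(1) q(1)] by simp
  qed
  have Ck\<psi>: "Ck 1 (cimg d) (\<psi> \<circ> cinv d)" if d: "d \<in> \<A>" for d
  proof (rule Ck_local)
    fix y assume y: "y \<in> cimg d"
    show "\<exists>T. openin (top_of_set (cimg d)) T \<and> y \<in> T \<and> Ck 1 T (\<psi> \<circ> cinv d)"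
    proof (cases "cinv d y \<in> cdom c")
      case True
      let ?T = "overlap d c"
      have "y \<in> ?T" using cmap_overlap[OF cinv_cdom[OF d y] True] cmap_cinv[OF d y] by simp
      moreover have "Ck 1 ?T (\<psi> \<circ> cinv d)"
      proof (rule Ck_cong)
        show "Ck 1 ?T (\<lambda>x. bump x0 r (tr d c x))"
          by (rule Ck_bump[OF half_open_overlap[OF d c(1)] smooth_tr[OF d c(1)]])
        show "bump x0 r (tr d c x) = (\<psi> \<circ> cinv d) x" if "x \<in> ?T" for x
          by (rule overlapE[OF that]) (simp add: \<psi>_def tr_cmap[OF d c(1)] cinv_cmap[OF d])
      qed
      ultimately show ?thesis using openin_overlap[OF d c(1)] by blast
    next
      case False
      let ?T = "{x \<in> cimg d. cinv d x \<notin> cinv c ` cbox l u}"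
      have T: "openin (top_of_set (cimg d)) ?T" by (rule openin_off_box[OF c(1) sub d])
      have "cinv d y \<notin> cinv c ` cbox l u"
        using False sub cinv_cdom[OF c(1)] by (auto dest: subsetD)
      then have "y \<in> ?T" using y by simp
      moreover have "Ck 1 ?T (\<psi> \<circ> cinv d)"
        by (rule Ck_cong[OF _ Ck_const[OF openin_trans[OF T half_open_cimg[OF d]], of 1 0]]) (simp add: off)
      ultimately show ?thesis using T by blast
    qed
  qed
  show ?thesis
  proof
    show "supported c l u \<psi>"
      unfolding supported_def
    proof (intro conjI ballI impI)
      fix x assume x: "x \<in> cbox l u" and side: "x $ 1 = l $ 1 \<or> x $ 1 = u $ 1 \<or> x $ 2 = u $ 2 \<or> x $ 2 = l $ 2 \<and> 0 < l $ 2"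
      have "bump x0 r x = 0"
      proof (rule ccontr)
        assume b: "bump x0 r x \<noteq> 0"
        show False
          using bump_nonzero[OF b r, of 1] bump_nonzero[OF b r, of 2] side by (auto simp: l_def u_def max_def split: if_splits)
      qed
      then show "\<psi> (cinv c x) = 0" using sub x cmap_cinv[OF c(1)] by (auto simp: \<psi>_def)
    qed (use c(1) sub off Ck\<psi> r x02 in \<open>auto simp: l_def u_def\<close>)
    show "\<psi> p > 0" using c(2) bump_center[OF r, of x0] by (simp add: \<psi>_def x0_def)
    show "0 \<le> \<psi> q" for q by (simp add: \<psi>_def bump_nonneg)
    have "continuous_on (cdom c) (cmap c)" using chart_homeomorphism[OF c(1)] by (simp add: homeomorphism_def)
    then have "continuous_on (cdom c) (\<lambda>q. bump x0 r (cmap c q))"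
      unfolding bump_def by (intro continuous_intros)
    from continuous_openin_preimage_gen[OF this, of "{0<..}"]
    have "openin (top_of_set (cdom c)) (cdom c \<inter> (\<lambda>q. bump x0 r (cmap c q)) -` {0<..})" by simp
    moreover have "cdom c \<inter> (\<lambda>q. bump x0 r (cmap c q)) -` {0<..} = {q \<in> M. 0 < \<psi> q}"
      using cdom_subset[OF c(1)] by (auto simp: \<psi>_def)
    ultimately show "openin (top_of_set M) {q \<in> M. 0 < \<psi> q}"
      using openin_trans[OF _ openin_cdom[OF c(1)]] by simp
  qed
qed

text \<open>Compactness selects finitely many bumps with positive sum; division by the sum preserves
  their zeros, hence also the conditions on supports and sides.\<close>

lemma partition_of_unity:
  obtains I :: "'a set" and c l u \<rho> where "finite I" "\<And>p. p \<in> I \<Longrightarrow> supported (c p) (l p) (u p) (\<rho> p)"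
    "\<And>q. q \<in> M \<Longrightarrow> (\<Sum>p\<in>I. \<rho> p q) = 1"
proof -
  define Q where "Q p c l u \<psi> \<longleftrightarrow> supported c l u \<psi> \<and> \<psi> p > 0 \<and> (\<forall>q\<in>M. 0 \<le> \<psi> q) \<and>
    openin (top_of_set M) {q \<in> M. 0 < \<psi> q}" for p c l u and \<psi> :: "'a \<Rightarrow> real"
  have "\<forall>p\<in>M. \<exists>c l u \<psi>. Q p c l u \<psi>"
  proof
    fix p assume "p \<in> M"
    then show "\<exists>c l u \<psi>. Q p c l u \<psi>"
      unfolding Q_def by (rule local_bump) blast
  qed
  from bchoice[OF this] obtain c where "\<forall>p\<in>M. \<exists>l u \<psi>. Q p (c p) l u \<psi>" by (rule exE)
  from bchoice[OF this] obtain l where "\<forall>p\<in>M. \<exists>u \<psi>. Q p (c p) (l p) u \<psi>" by (rule exE)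
  from bchoice[OF this] obtain u where "\<forall>p\<in>M. \<exists>\<psi>. Q p (c p) (l p) (u p) \<psi>" by (rule exE)
  from bchoice[OF this] obtain \<psi> where "\<forall>p\<in>M. Q p (c p) (l p) (u p) (\<psi> p)" by (rule exE)
  then have \<psi>: "\<And>p. p \<in> M \<Longrightarrow> supported (c p) (l p) (u p) (\<psi> p)" "\<And>p. p \<in> M \<Longrightarrow> \<psi> p p > 0"
    "\<And>p q. p \<in> M \<Longrightarrow> q \<in> M \<Longrightarrow> 0 \<le> \<psi> p q" "\<And>p. p \<in> M \<Longrightarrow> openin (top_of_set M) {q \<in> M. 0 < \<psi> p q}"
    unfolding Q_def by simp_all
  define \<U> where "\<U> = (\<lambda>p. {q \<in> M. 0 < \<psi> p q}) ` M"
  have "\<forall>U\<in>\<U>. openin (top_of_set M) U" using \<psi>(4) by (auto simp: \<U>_def)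
  moreover have "M \<subseteq> \<Union>\<U>" using \<psi>(2) by (auto simp: \<U>_def)
  ultimately have "\<exists>D\<subseteq>\<U>. finite D \<and> M \<subseteq> \<Union>D"
    by (intro compact_M[unfolded compact_eq_openin_cover, THEN spec, THEN mp] conjI)
  then obtain D where D: "D \<subseteq> \<U>" "finite D" "M \<subseteq> \<Union>D" by (elim exE conjE)
  from finite_subset_image[OF D(2) D(1)[unfolded \<U>_def]]
  obtain I where I: "I \<subseteq> M" "finite I" "D = (\<lambda>p. {q \<in> M. 0 < \<psi> p q}) ` I" by (elim exE conjE)
  define \<sigma> where "\<sigma> q = (\<Sum>p\<in>I. \<psi> p q)" for q
  have \<sigma>: "\<sigma> q > 0" if q: "q \<in> M" for q
  proof -
    obtain p where p: "p \<in> I" "0 < \<psi> p q" using D(3) I(3) q by auto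
    show ?thesis unfolding \<sigma>_def by (rule sum_pos2[OF I(2) p(1), of "\<lambda>p. \<psi> p q", OF p(2)]) (use \<psi>(3) I(1) q in auto)
  qed
  \<comment> \<open>On \<open>M\<close> the norm changes nothing, since \<open>\<sigma>\<close> is
    positive there; it brings the quotient into the form treated by
    \<open>Ck_inverse_norm\<close>.\<close>
  define \<rho> where "\<rho> p q = \<psi> p q * inverse (norm (\<sigma> q))" for p q
  have Ck\<psi>: "Ck 1 (cimg d) (\<psi> p \<circ> cinv d)" if "d \<in> \<A>" "p \<in> I" for d p
    using \<psi>(1) that I(1) by (auto simp: supported_def)
  have Ck\<rho>: "Ck 1 (cimg d) (\<rho> p \<circ> cinv d)" if d: "d \<in> \<A>" and p: "p \<in> I" for d p
  proof -
    have "Ck 1 (cimg d) (\<lambda>x. \<Sum>p\<in>I. (\<psi> p \<circ> cinv d) x)"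
      by (intro Ck_sum half_open_cimg Ck\<psi> d)
    then have "Ck 1 (cimg d) (\<lambda>x. \<sigma> (cinv d x))" by (simp add: \<sigma>_def)
    moreover have "\<sigma> (cinv d x) \<noteq> 0" if "x \<in> cimg d" for x
      using \<sigma>[OF subsetD[OF cinv_image_subset[OF d] imageI[OF that]]] by simp
    ultimately have "Ck 1 (cimg d) (\<lambda>x. inverse (norm (\<sigma> (cinv d x))))"
      by (intro Ck_inverse_norm half_open_cimg d)
    then have "Ck 1 (cimg d) (\<lambda>x. (\<psi> p \<circ> cinv d) x * inverse (norm (\<sigma> (cinv d x))))"
      by (intro Ck_mult half_open_cimg d Ck\<psi> p)
    then show ?thesis by (simp add: \<rho>_def o_def)
  qed
  show ?thesis
  proof (rule that[OF I(2)])
    fix p assume p: "p \<in> I"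
    then have "supported (c p) (l p) (u p) (\<psi> p)" using \<psi>(1) I(1) by auto
    then show "supported (c p) (l p) (u p) (\<rho> p)"
      using Ck\<rho>[OF _ p] unfolding supported_def by (simp add: \<rho>_def)
  next
    fix q assume "q \<in> M"
    then show "(\<Sum>p\<in>I. \<rho> p q) = 1"
      using \<sigma>[of q] by (simp add: \<rho>_def sum_distrib_right[symmetric] \<sigma>_def[symmetric])
  qed
qed

end

section \<open>The first variation formula\<close>

lemma (in patch) continuous_curvature_density:
  assumes "K \<subseteq> S" "\<And>x. x \<in> K \<Longrightarrow> n x \<noteq> 0"
  shows "continuous_on K (curvature_density S r)"
  unfolding curvature_density_def[abs_def] using assms(2)
  by (intro continuous_intros continuous_on_cross continuous_on_subset[OF _ assms(1)] Ck_continuous[OF Ck_n]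
      Ck_continuous[OF Ck_a] Ck_continuous[OF Ck_SucD(2)[OF Ck_n]]) auto

section \<open>Integrals of the mean curvature\<close>

context surface
begin

lemma curvature_rep:
  assumes R: "smooth_in_charts R" and c: "c \<in> \<A>" and x: "x \<in> cimg c" and n0: "nrm (cimg c) (R \<circ> cinv c) x \<noteq> 0"
  defines "N \<equiv> unrm (cimg c) (R \<circ> cinv c)"
  shows "pd (cimg c) 1 N x \<times> pd (cimg c) 2 (R \<circ> cinv c) x + pd (cimg c) 1 (R \<circ> cinv c) x \<times> pd (cimg c) 2 N x
      = - (2 * mean_curvature \<A> R (cinv c x)) *\<^sub>R nrm (cimg c) (R \<circ> cinv c) x"
    and "pd (cimg c) 1 N x \<times> pd (cimg c) 2 N x = gaussian_curvature \<A> R (cinv c x) *\<^sub>R nrm (cimg c) (R \<circ> cinv c) x"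
proof -
  have "pd (cimg c) i N x = pd (cimg c) i (unit_normal \<A> R \<circ> cinv c) x" for i
    unfolding N_def by (rule pd_cong[OF unit_normal_rep[OF R c, symmetric] x])
  then show "pd (cimg c) 1 N x \<times> pd (cimg c) 2 (R \<circ> cinv c) x + pd (cimg c) 1 (R \<circ> cinv c) x \<times> pd (cimg c) 2 N x
      = - (2 * mean_curvature \<A> R (cinv c x)) *\<^sub>R nrm (cimg c) (R \<circ> cinv c) x"
    and "pd (cimg c) 1 N x \<times> pd (cimg c) 2 N x = gaussian_curvature \<A> R (cinv c x) *\<^sub>R nrm (cimg c) (R \<circ> cinv c) x"
    using curvature_identities[OF R c cinv_cdom[OF c x] n0[unfolded nrm_chart[OF c x]]]
    by (simp_all add: nrm_chart[OF c x] pderiv_in_cinv[OF c x])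
qed

text \<open>Nondegeneracy on the box is enough, since \<open>\<rho>\<close> vanishes on the rest of
  \<open>M\<close> whatever value \<open>mean_curvature\<close> takes there. Continuity of the mean
  curvature on the box comes from dividing the explicit density by the area weight.\<close>

lemma mean_curvature_integral:
  assumes R: "smooth_in_charts R" and \<rho>: "supported c l u \<rho>"
    and n0: "\<And>x. x \<in> cbox l u \<Longrightarrow> nrm (cimg c) (R \<circ> cinv c) x \<noteq> 0"
  shows "integrable (area_measure M \<A> R) (\<lambda>q. \<rho> q * mean_curvature \<A> R q)"
    "(\<integral>q. \<rho> q * mean_curvature \<A> R q \<partial>area_measure M \<A> R)
      = integral (cbox l u) (\<lambda>x. \<rho> (cinv c x) * curvature_density (cimg c) (R \<circ> cinv c) x)"
proof -
  let ?n = "nrm (cimg c) (R \<circ> cinv c)" and ?h = "curvature_density (cimg c) (R \<circ> cinv c)"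
  have c: "c \<in> \<A>" and box: "cbox l u \<subseteq> cimg c" and off: "\<And>q. q \<in> M - cinv c ` cbox l u \<Longrightarrow> \<rho> q = 0"
    and Ck\<rho>: "Ck 1 (cimg c) (\<rho> \<circ> cinv c)"
    using \<rho> by (auto simp: supported_def)
  interpret patch "cimg c" "R \<circ> cinv c" by (rule patch_chart[OF R c])
  have w: "area_weight c R x = norm (?n x)" if "x \<in> cbox l u" for x
    using nrm_chart[OF c subsetD[OF box that]] by (simp add: area_weight_def)
  have H: "mean_curvature \<A> R (cinv c x) * norm (?n x) = ?h x" if "x \<in> cbox l u" for x
    using mean_curvature_density[OF subsetD[OF box that] n0[OF that] curvature_rep(1)[OF R c subsetD[OF box that] n0[OF that]]]
    by (simp add: curvature_density_def)
  have "continuous_on (cbox l u) (\<lambda>x. (\<rho> \<circ> cinv c) x * (?h x / norm (?n x)))"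
    using n0 by (intro continuous_intros continuous_curvature_density[OF box] continuous_on_subset[OF Ck_continuous[OF Ck_n] box]
      continuous_on_subset[OF Ck_continuous[OF Ck\<rho>] box]) auto
  then have "continuous_on (cbox l u) (\<lambda>x. \<rho> (cinv c x) * mean_curvature \<A> R (cinv c x))"
    by (rule continuous_on_eq) (use n0 in \<open>simp add: H[symmetric]\<close>)
  note * = area_integral[OF R c box _ this]
  show "integrable (area_measure M \<A> R) (\<lambda>q. \<rho> q * mean_curvature \<A> R q)"
    by (rule *(1)) (simp add: off)
  have "(\<integral>q. \<rho> q * mean_curvature \<A> R q \<partial>area_measure M \<A> R)
    = integral (cbox l u) (\<lambda>x. \<rho> (cinv c x) * mean_curvature \<A> R (cinv c x) * area_weight c R x)"
    by (rule *(2)) (simp add: off)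
  also have "\<dots> = integral (cbox l u) (\<lambda>x. \<rho> (cinv c x) * ?h x)"
    by (rule integral_cong) (simp add: w H[symmetric])
  finally show "(\<integral>q. \<rho> q * mean_curvature \<A> R q \<partial>area_measure M \<A> R)
      = integral (cbox l u) (\<lambda>x. \<rho> (cinv c x) * ?h x)" .
qed

lemma space_area: "smooth_in_charts R \<Longrightarrow> space (area_measure M \<A> R) = M"
  using sets_eq_imp_space_eq[OF area_measure(1)[of R]] by (simp add: space_restrict_space)

lemma space_boundary: "smooth_in_charts R \<Longrightarrow> space (boundary_length_measure \<A> R) = surface_boundary \<A>"
  using sets_eq_imp_space_eq[OF boundary_length_measure(1)[of R]] by (simp add: space_restrict_space)

lemma integral_partition:
  fixes f :: "'a \<Rightarrow> real"
  assumes "\<And>p. p \<in> I \<Longrightarrow> integrable \<mu> (\<lambda>q. \<rho> p q * f q)" "\<And>q. q \<in> M \<Longrightarrow> (\<Sum>p\<in>I. \<rho> p q) = 1" "space \<mu> \<subseteq> M"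
  shows "integral\<^sup>L \<mu> f = (\<Sum>p\<in>I. \<integral>q. \<rho> p q * f q \<partial>\<mu>)"
proof -
  have "integral\<^sup>L \<mu> f = (\<integral>q. (\<Sum>p\<in>I. \<rho> p q * f q) \<partial>\<mu>)"
    using assms(2,3) by (intro Bochner_Integration.integral_cong) (auto simp: sum_distrib_right[symmetric])
  also have "\<dots> = (\<Sum>p\<in>I. \<integral>q. \<rho> p q * f q \<partial>\<mu>)"
    by (rule Bochner_Integration.integral_sum) (rule assms(1))
  finally show ?thesis .
qed

end

section \<open>The 1-form and its independence of the chart\<close>

locale surface_variation = surface M \<A> for M :: "'a::t2_space set" and \<A> +
  fixes R V :: "'a \<Rightarrow> real^3"
  assumes R: "smooth_in_charts R" and V: "smooth_in_charts V"
    and nondegenerate: "\<And>c p. c \<in> \<A> \<Longrightarrow> p \<in> cdom c \<Longrightarrow> coord_cross c R p \<noteq> 0"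
begin

lemma patch_variation_chart: "c \<in> \<A> \<Longrightarrow> patch_variation (cimg c) (R \<circ> cinv c) (V \<circ> cinv c)"
  by (intro patch_variation.intro patch_variation_axioms.intro patch_chart R smooth_rep V)
     (use nrm_chart[of c _ R] nondegenerate cinv_cdom[of c] in auto)

definition form :: "'a coords \<Rightarrow> 2 \<Rightarrow> real^2 \<Rightarrow> real" where
  "form c = patch_variation.\<theta> (cimg c) (R \<circ> cinv c) (V \<circ> cinv c)"

text \<open>The ratio of the 2-form \<open>d\<rho> \<and> \<theta>\<close> to the area form.\<close>

definition wedge :: "'a coords \<Rightarrow> ('a \<Rightarrow> real) \<Rightarrow> 'a \<Rightarrow> real" where
  "wedge c \<rho> q = (pderiv_in c 1 \<rho> q * form c 2 (cmap c q) - pderiv_in c 2 \<rho> q * form c 1 (cmap c q)) / norm (coord_cross c R q)"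

text \<open>Under a change of chart \<open>n\<close> and \<open>dn\<close> scale by the determinant
  \<open>D\<close>, \<open>\<psi>\<close> and \<open>\<omega>\<close> by its inverse, so N, dN and V
  are unchanged. Only the derivatives of R and N transform as covectors, and \<open>\<theta>\<close>
  is linear in them.\<close>

lemma form_change_chart:
  assumes cd: "c \<in> \<A>" "d \<in> \<A>" and q: "q \<in> cdom c" "q \<in> cdom d"
  defines "J \<equiv> jac c d (cmap c q)"
  shows "form c i (cmap c q) = J (axis i 1) $ 1 * form d 1 (cmap d q) + J (axis i 1) $ 2 * form d 2 (cmap d q)"
proof -
  interpret c: patch_variation "cimg c" "R \<circ> cinv c" "V \<circ> cinv c" by (rule patch_variation_chart[OF cd(1)])
  interpret d: patch_variation "cimg d" "R \<circ> cinv d" "V \<circ> cinv d" by (rule patch_variation_chart[OF cd(2)])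
  define x y where "x = cmap c q" and "y = cmap d q"
  have xy: "x \<in> cimg c" "y \<in> cimg d" "cinv c x = q" "cinv d y = q"
    using q cinv_cmap[OF cd(1)] cinv_cmap[OF cd(2)] by (auto simp: x_def y_def)
  have pdc: "pd (cimg c) i (f \<circ> cinv c) x = pderiv_in c i f q" for f :: "'a \<Rightarrow> real^3" and i
    using pderiv_in_cinv[OF cd(1) xy(1), of i f] xy(3) by simp
  have pdd: "pd (cimg d) i (f \<circ> cinv d) y = pderiv_in d i f q" for f :: "'a \<Rightarrow> real^3" and i
    using pderiv_in_cinv[OF cd(2) xy(2), of i f] xy(4) by simp
  have a: "pd (cimg c) i (R \<circ> cinv c) x = J (axis i 1) $ 1 *\<^sub>R pd (cimg d) 1 (R \<circ> cinv d) y + J (axis i 1) $ 2 *\<^sub>R pd (cimg d) 2 (R \<circ> cinv d) y" for i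
    unfolding pdc pdd J_def by (rule pderiv_change_chart[OF cd q smooth_rep_differentiable[OF R cd(2) q(2)]])
  have b: "pd (cimg c) i (V \<circ> cinv c) x = J (axis i 1) $ 1 *\<^sub>R pd (cimg d) 1 (V \<circ> cinv d) y + J (axis i 1) $ 2 *\<^sub>R pd (cimg d) 2 (V \<circ> cinv d) y" for i
    unfolding pdc pdd J_def by (rule pderiv_change_chart[OF cd q smooth_rep_differentiable[OF V cd(2) q(2)]])
  have Nc: "pd (cimg c) i (unrm (cimg c) (R \<circ> cinv c)) x = pderiv_in c i (unit_normal \<A> R) q" for i
    using pderiv_unit_normal[OF R cd(1) xy(1), of i] xy(3) by simp
  have Nd: "pd (cimg d) i (unrm (cimg d) (R \<circ> cinv d)) y = pderiv_in d i (unit_normal \<A> R) q" for i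
    using pderiv_unit_normal[OF R cd(2) xy(2), of i] xy(4) by simp
  have Ni: "pd (cimg c) i (unrm (cimg c) (R \<circ> cinv c)) x = J (axis i 1) $ 1 *\<^sub>R pd (cimg d) 1 (unrm (cimg d) (R \<circ> cinv d)) y
    + J (axis i 1) $ 2 *\<^sub>R pd (cimg d) 2 (unrm (cimg d) (R \<circ> cinv d)) y" for i
    unfolding Nc Nd J_def by (rule pderiv_change_chart[OF cd q unit_normal_differentiable[OF R cd(2) q(2) nondegenerate[OF cd(2) q(2)]]])
  define D where "D = J (axis 1 1) $ 1 * J (axis 2 1) $ 2 - J (axis 1 1) $ 2 * J (axis 2 1) $ 1"
  have "D = det (matrix J)" by (simp add: D_def det_matrix_2)
  then have D: "D > 0" using det_jac_pos[OF cd cmap_overlap[OF q]] by (simp add: J_def)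
  have n: "nrm (cimg c) (R \<circ> cinv c) x = D *\<^sub>R nrm (cimg d) (R \<circ> cinv d) y"
    unfolding nrm_def a D_def by (rule cross_det_vec2)
  have dn: "c.dn x = D *\<^sub>R d.dn y"
    unfolding c.dn_def d.dn_def a b using cross_polarized_det by (metis D_def add.commute)
  have psi: "D * c.\<psi> x = d.\<psi> y" unfolding c.\<psi>_def d.\<psi>_def n using D by simp
  have N: "unrm (cimg c) (R \<circ> cinv c) x = unrm (cimg d) (R \<circ> cinv d) y"
    using D by (simp add: unrm_def n)
  have "D * c.\<omega> x = d.\<omega> y"
    unfolding c.\<omega>_def d.\<omega>_def psi[symmetric] n dn by (simp add: algebra_simps)
  then have dN: "c.dN x = d.dN y"
    unfolding c.dN_def d.dN_def n dn psi[symmetric] by (simp add: mult.commute[of D])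
  have v: "(V \<circ> cinv c) x = (V \<circ> cinv d) y" using xy by simp
  show ?thesis
    unfolding form_def x_def[symmetric] y_def[symmetric] c.\<theta>_def d.\<theta>_def N dN v a[of i] Ni[of i]
    by (simp add: cross_add_right cross_mult_right inner_add_right algebra_simps)
qed

text \<open>Numerator and area density both scale by the Jacobian determinant; as it is positive,
  the norm in the denominator introduces no sign.\<close>

lemma wedge_change_chart:
  assumes cd: "c \<in> \<A>" "d \<in> \<A>" and q: "q \<in> cdom c" "q \<in> cdom d"
    and \<rho>: "Ck 1 (cimg d) (\<rho> \<circ> cinv d)"
  shows "wedge c \<rho> q = wedge d \<rho> q"
proof -
  define J where "J = jac c d (cmap c q)"
  have "(\<rho> \<circ> cinv d) differentiable (at (cmap d q) within cimg d)"
    using Ck_SucD(1)[of 0 "cimg d" "\<rho> \<circ> cinv d"] \<rho> q by simp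
  note p = pderiv_change_chart[OF cd q this, folded J_def]
  have cc: "coord_cross c R q = det (matrix J) *\<^sub>R coord_cross d R q"
    unfolding J_def by (rule coord_cross_change_chart[OF cd q smooth_rep_differentiable[OF R cd(2) q(2)]])
  have det: "det (matrix J) > 0" unfolding J_def by (rule det_jac_pos[OF cd cmap_overlap[OF q]])
  have "pderiv_in c 1 \<rho> q * form c 2 (cmap c q) - pderiv_in c 2 \<rho> q * form c 1 (cmap c q)
    = det (matrix J) * (pderiv_in d 1 \<rho> q * form d 2 (cmap d q) - pderiv_in d 2 \<rho> q * form d 1 (cmap d q))"
    unfolding form_change_chart[OF cd q, folded J_def] p det_matrix_2 by (simp add: algebra_simps)
  then show ?thesis using det unfolding wedge_def cc by simp
qed

text \<open>Off the box \<open>\<rho>\<close> vanishes on a relatively open set, so its derivatives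
  vanish there too.\<close>

lemma wedge_off_box:
  assumes \<rho>: "supported c l u \<rho>" and d: "d \<in> \<A>" "q \<in> cdom d" and q: "q \<in> M - cinv c ` cbox l u"
  shows "wedge d \<rho> q = 0"
proof -
  have c: "c \<in> \<A>" and box: "cbox l u \<subseteq> cimg c" and off: "\<And>q. q \<in> M - cinv c ` cbox l u \<Longrightarrow> \<rho> q = 0"
    using \<rho> by (auto simp: supported_def)
  let ?T = "{x \<in> cimg d. cinv d x \<notin> cinv c ` cbox l u}"
  have T: "openin (top_of_set (cimg d)) ?T" by (rule openin_off_box[OF c box d(1)])
  have x: "cmap d q \<in> ?T" using q d cinv_cmap[OF d] by auto
  have "pderiv_in d i \<rho> q = 0" for i
  proof -
    have "pderiv_in d i \<rho> q = pd (cimg d) i (\<rho> \<circ> cinv d) (cmap d q)"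
      by (simp add: pderiv_in_def differential_def pd_def)
    also have "\<dots> = pd ?T i (\<rho> \<circ> cinv d) (cmap d q)" by (rule pd_openin[OF T x, symmetric])
    also have "\<dots> = pd ?T i (\<lambda>x. 0) (cmap d q)"
      by (rule pd_cong[OF _ x]) (use off cinv_image_subset[OF d(1)] in auto)
    also have "\<dots> = 0" by (rule pd_const[OF openin_trans[OF T half_open_cimg[OF d(1)]] x])
    finally show ?thesis .
  qed
  then show ?thesis by (simp add: wedge_def)
qed

text \<open>With one fixed chart for all summands the wedge is linear in the derivatives of
  \<open>\<rho> p\<close>, and these add up to the derivative of the constant 1.\<close>

lemma wedge_partition:
  assumes \<rho>: "\<And>p. p \<in> I \<Longrightarrow> supported (c p) (l p) (u p) (\<rho> p)" "\<And>q. q \<in> M \<Longrightarrow> (\<Sum>p\<in>I. \<rho> p q) = 1"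
    and d: "d \<in> \<A>" "q \<in> cdom d"
  shows "(\<Sum>p\<in>I. wedge d (\<rho> p) q) = 0"
proof -
  have x: "cmap d q \<in> cimg d" using d by auto
  have pd: "pderiv_in d i f q = pd (cimg d) i (f \<circ> cinv d) (cmap d q)" for i and f :: "'a \<Rightarrow> real"
    by (simp add: pderiv_in_def differential_def pd_def)
  have diff: "(\<rho> p \<circ> cinv d) differentiable (at (cmap d q) within cimg d)" if "p \<in> I" for p
    using \<rho>(1)[OF that] Ck_SucD(1)[of 0 "cimg d" "\<rho> p \<circ> cinv d", OF _ x] d(1) by (simp add: supported_def)
  have "(\<Sum>p\<in>I. pderiv_in d i (\<rho> p) q) = 0" for i
  proof -
    have "((\<lambda>x. \<Sum>p\<in>I. (\<rho> p \<circ> cinv d) x) has_derivative (\<lambda>v. \<Sum>p\<in>I. frechet_derivative (\<rho> p \<circ> cinv d) (at (cmap d q) within cimg d) v)) (at (cmap d q) within cimg d)"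
      by (intro has_derivative_sum diff[unfolded frechet_derivative_works])
    from pd_eqI[OF half_open_cimg[OF d(1)] x this, of i]
    have "(\<Sum>p\<in>I. pderiv_in d i (\<rho> p) q) = pd (cimg d) i (\<lambda>x. \<Sum>p\<in>I. (\<rho> p \<circ> cinv d) x) (cmap d q)"
      by (simp add: pd pd_def)
    also have "\<dots> = pd (cimg d) i (\<lambda>x. 1) (cmap d q)"
      by (rule pd_cong[OF _ x]) (use \<rho>(2) cinv_image_subset[OF d(1)] in auto)
    also have "\<dots> = 0" by (rule pd_const[OF half_open_cimg[OF d(1)] x])
    finally show ?thesis .
  qed
  then show ?thesis
    by (simp add: wedge_def sum_divide_distrib[symmetric] sum_subtractf sum_distrib_right[symmetric])
qed

lemma deformed_smooth: "smooth_in_charts (\<lambda>q. R q + t *\<^sub>R V q)"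
proof -
  have "Ck k (cimg c) (\<lambda>x. (R \<circ> cinv c) x + t *\<^sub>R (V \<circ> cinv c) x)" if "c \<in> \<A>" for k c
    by (intro Ck_add Ck_linear[OF bounded_linear_scaleR_right] half_open_cimg that smooth_rep R V)
  then show ?thesis by (simp add: smooth_in_charts_def o_def)
qed

lemma deformed_rep: "(\<lambda>q. R q + t *\<^sub>R V q) \<circ> cinv c = (\<lambda>x. (R \<circ> cinv c) x + t *\<^sub>R (V \<circ> cinv c) x)"
  by (simp add: o_def)

end

section \<open>Conormal and gradient in coordinates\<close>

text \<open>In the plane orthogonal to \<open>a \<times> m\<close> there are two unit vectors
  orthogonal to \<open>a\<close>; the sign of the cross product with \<open>a\<close> selects one.
  In the proof \<open>x - k *\<^sub>R m\<close> is both parallel and orthogonal to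
  \<open>a\<close>.\<close>

lemma cross_pos_unique:
  fixes a m x :: "real^3"
  assumes am: "a \<times> m \<noteq> 0" and m: "m \<bullet> a = 0" "norm m = 1"
    and x: "x \<bullet> a = 0" "norm x = 1" "x \<bullet> (a \<times> m) = 0" "a \<times> x = k *\<^sub>R (a \<times> m)" "k > 0"
  shows "x = m"
proof -
  have "x - k *\<^sub>R m = 0"
  proof (rule zero_of_orthogonal_basis[OF am])
    show "(x - k *\<^sub>R m) \<bullet> a = 0" using x m by (simp add: inner_diff_left)
    show "(x - k *\<^sub>R m) \<bullet> (a \<times> m) = 0" using x by (simp add: inner_diff_left dot_cross_self)
    have "a \<times> (x - k *\<^sub>R m) = 0" using x by (simp add: Cross3.right_diff_distrib cross_mult_right)
    then have "(norm a * norm (x - k *\<^sub>R m))\<^sup>2 = (a \<bullet> (x - k *\<^sub>R m))\<^sup>2"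
      using norm_cross_dot[of a "x - k *\<^sub>R m"] by simp
    also have "\<dots> = 0" using x m by (simp add: inner_diff_right inner_commute[of a])
    finally have "x - k *\<^sub>R m = 0" using am by auto
    then show "(x - k *\<^sub>R m) \<bullet> m = 0" by simp
  qed
  then have "x = k *\<^sub>R m" by simp
  then show ?thesis using x(2,5) m(2) by auto
qed

context surface_variation
begin

lemma tangent_normal:
  assumes d: "d \<in> \<A>" "q \<in> cdom d"
  shows "differential d R q v = v $ 1 *\<^sub>R pderiv_in d 1 R q + v $ 2 *\<^sub>R pderiv_in d 2 R q"
  by (rule differential_pderiv[OF smooth_rep_differentiable[OF R d]])

lemma tangent_exists:
  assumes d: "d \<in> \<A>" "q \<in> cdom d" and x: "x \<bullet> coord_cross d R q = 0"
  obtains v where "x = differential d R q v"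
proof -
  define a1 a2 where "a1 = pderiv_in d 1 R q" and "a2 = pderiv_in d 2 R q"
  define n where "n = a1 \<times> a2"
  have n: "coord_cross d R q = n" by (simp add: coord_cross_def n_def a1_def a2_def)
  have n0: "n \<bullet> n \<noteq> 0" using nondegenerate[OF d] n by simp
  have "(n \<bullet> n) *\<^sub>R x = ((x \<times> a2) \<bullet> n) *\<^sub>R a1 + ((a1 \<times> x) \<bullet> n) *\<^sub>R a2"
    using cramer_cross[of x a2 n a1] x n by (simp add: n_def[symmetric] inner_commute)
  then have "x = (1 / (n \<bullet> n)) *\<^sub>R (((x \<times> a2) \<bullet> n) *\<^sub>R a1 + ((a1 \<times> x) \<bullet> n) *\<^sub>R a2)"
    using n0 by (metis divide_self scaleR_one scaleR_scaleR times_divide_eq_left mult_1)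
  also have "\<dots> = differential d R q (vector [((x \<times> a2) \<bullet> n) / (n \<bullet> n), ((a1 \<times> x) \<bullet> n) / (n \<bullet> n)])"
    unfolding tangent_normal[OF d] by (simp add: a1_def a2_def scaleR_add_right)
  finally show ?thesis by (rule that)
qed

text \<open>In the chart used by the definition, the cross product of \<open>a1\<close> with
  \<open>differential d R q v\<close> is \<open>v $ 2\<close> times the normal, so the direction
  relative to the boundary can be read from a cross product; this identifies the conormal as
  \<open>a1 \<times> N\<close> over the norm of \<open>a1\<close>. Passing to \<open>c\<close>
  rescales the boundary tangent by a positive factor, which the norm on the left absorbs.\<close>

lemma outward_conormal_chart:
  assumes c: "c \<in> \<A>" "q \<in> cdom c" and q: "q \<in> surface_boundary \<A>"
  shows "norm (pderiv_in c 1 R q) *\<^sub>R outward_conormal \<A> R q = pderiv_in c 1 R q \<times> unit_normal \<A> R q"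
proof -
  have qM: "q \<in> M" using c cdom_subset by blast
  define d where "d = chart_at \<A> q"
  have d: "d \<in> \<A>" "q \<in> cdom d" using chart_at[OF qM] by (simp_all add: d_def)
  define N a1 a2 n where "N = unit_normal \<A> R q" and "a1 = pderiv_in d 1 R q" and "a2 = pderiv_in d 2 R q"
    and "n = coord_cross d R q"
  have n: "n = a1 \<times> a2" by (simp add: coord_cross_def n_def a1_def a2_def)
  have n0: "n \<noteq> 0" using nondegenerate[OF d] by (simp add: n_def)
  have N: "N = inverse (norm n) *\<^sub>R n" unfolding N_def n_def by (rule unit_normal_chart[OF R d])
  have NN: "N \<bullet> N = 1" using n0 by (simp add: N dot_square_norm power2_eq_square)
  have Na: "N \<bullet> a1 = 0" by (simp add: N n dot_cross_self)
  have a0: "a1 \<noteq> 0" using n0 n by auto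
  define m where "m = (1 / norm a1) *\<^sub>R (a1 \<times> N)"
  have m1: "norm m = 1"
  proof -
    have "(norm (a1 \<times> N))\<^sup>2 = (norm a1)\<^sup>2"
      using norm_cross_dot[of a1 N] Na NN by (simp add: inner_commute[of a1 N] norm_eq_1)
    then have "norm (a1 \<times> N) = norm a1" by simp
    then show ?thesis using a0 by (simp add: m_def)
  qed
  have ma: "m \<bullet> a1 = 0" by (simp add: m_def dot_cross_self)
  have aaN: "a1 \<times> (a1 \<times> N) = - ((a1 \<bullet> a1) *\<^sub>R N)" using Na by (simp add: Lagrange inner_commute[of a1 N])
  have am: "a1 \<times> m = - (norm a1 * inverse (norm n)) *\<^sub>R n"
  proof -
    have "a1 \<bullet> a1 = norm a1 * norm a1" by (simp add: dot_square_norm power2_eq_square)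
    then have "a1 \<times> m = - (norm a1 *\<^sub>R N)"
      using a0 aaN by (simp add: m_def cross_mult_right)
    then show ?thesis by (simp add: N)
  qed
  define K where "K = norm a1 * inverse (norm n)"
  have K: "K > 0" using a0 n0 by (simp add: K_def)
  have mn: "m \<bullet> n = 0" using n0 by (simp add: m_def N cross_mult_right dot_cross_self)
  have cross: "a1 \<times> differential d R q v = v $ 2 *\<^sub>R n" for v
    unfolding tangent_normal[OF d] a1_def[symmetric] a2_def[symmetric] n
    by (simp add: cross_add_right cross_mult_right)
  have "outward_conormal \<A> R q = m"
    unfolding outward_conormal_def d_def[symmetric] a1_def[symmetric]
  proof (rule the_equality)
    obtain v where v: "m = differential d R q v"
      using tangent_exists[OF d] mn by (metis n_def)
    have "v $ 2 *\<^sub>R n = - K *\<^sub>R n" using cross[of v] am v by (simp add: K_def)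
    then have "v $ 2 = - K" unfolding scaleR_cancel_right using n0 by simp
    then have "v $ 2 < 0" using K by simp
    then show "norm m = 1 \<and> m \<bullet> a1 = 0 \<and> (\<exists>v. v $ 2 < 0 \<and> m = differential d R q v)"
      using m1 ma v by blast
  next
    fix x assume x: "norm x = 1 \<and> x \<bullet> a1 = 0 \<and> (\<exists>v. v $ 2 < 0 \<and> x = differential d R q v)"
    then obtain v where v: "v $ 2 < 0" "x = differential d R q v" by blast
    have amK: "a1 \<times> m = - K *\<^sub>R n" using am by (simp add: K_def)
    show "x = m"
    proof (rule cross_pos_unique)
      show "a1 \<times> m \<noteq> 0" using amK K n0 by simp
      show "x \<bullet> (a1 \<times> m) = 0"
        unfolding amK v(2) tangent_normal[OF d] a1_def[symmetric] a2_def[symmetric]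
        by (simp add: n inner_add_right inner_commute[of _ "a1 \<times> a2"] dot_cross_self)
      \<comment> \<open>Both cross products are negative multiples of \<open>n\<close>, so their
        ratio is positive.\<close>
      show "a1 \<times> x = (- v $ 2 / K) *\<^sub>R (a1 \<times> m)"
        unfolding amK v(2) cross using K by simp
      show "- v $ 2 / K > 0" using v(1) K by (simp add: divide_neg_pos)
    qed (use m1 ma x in auto)
  qed
  moreover have "pderiv_in c 1 R q = (jac c d (cmap c q) (axis 1 1) $ 1) *\<^sub>R a1"
    unfolding a1_def by (rule pderiv_boundary_change_chart[OF R c(1) d(1) c(2) d(2) q])
  moreover have "0 < jac c d (cmap c q) (axis 1 1) $ 1"
    using jac_boundary(2)[OF c(1) d(1) c(2) d(2)] boundary_iff[OF c] q by simp
  ultimately show ?thesis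
    using a0 unfolding N_def[symmetric] by (simp add: m_def cross_mult_left)
qed

text \<open>The gradient is written in the dual basis of the tangent plane,
  \<open>a2 \<times> n\<close> and \<open>n \<times> a1\<close> divided by
  \<open>n \<bullet> n\<close>. The differentials of R and f transform by the same Jacobian, so the
  defining relation passes from the chosen chart to any other.\<close>

lemma gradient_chart:
  assumes f: "\<And>d. d \<in> \<A> \<Longrightarrow> q \<in> cdom d \<Longrightarrow> (f \<circ> cinv d) differentiable (at (cmap d q) within cimg d)"
    and c: "c \<in> \<A>" "q \<in> cdom c"
  shows "surface_gradient \<A> R f q \<bullet> pderiv_in c i R q = pderiv_in c i f q"
proof -
  have qM: "q \<in> M" using c cdom_subset by blast
  define d where "d = chart_at \<A> q"
  have d: "d \<in> \<A>" "q \<in> cdom d" using chart_at[OF qM] by (simp_all add: d_def)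
  define a1 a2 n where "a1 = pderiv_in d 1 R q" and "a2 = pderiv_in d 2 R q" and "n = coord_cross d R q"
  have n: "n = a1 \<times> a2" by (simp add: coord_cross_def n_def a1_def a2_def)
  have n0: "n \<noteq> 0" using nondegenerate[OF d] by (simp add: n_def)
  define P where "P g \<longleftrightarrow> g \<in> tangent_plane \<A> R q \<and> (\<forall>v. g \<bullet> differential d R q v = differential d f q v)" for g
  define g where "g = (1 / (n \<bullet> n)) *\<^sub>R (pderiv_in d 1 f q *\<^sub>R (a2 \<times> n) + pderiv_in d 2 f q *\<^sub>R (n \<times> a1))"
  have tr: "(a2 \<times> n) \<bullet> a1 = n \<bullet> n" "(n \<times> a1) \<bullet> a2 = n \<bullet> n" "(a2 \<times> n) \<bullet> a2 = 0" "(n \<times> a1) \<bullet> a1 = 0"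
    unfolding n by (simp_all add: dot_cross_self) (simp_all add: cross3_simps)
  have ga: "g \<bullet> a1 = pderiv_in d 1 f q" "g \<bullet> a2 = pderiv_in d 2 f q"
    using n0 by (simp_all add: g_def inner_add_left tr)
  have gv: "g \<bullet> differential d R q v = differential d f q v" for v
    unfolding tangent_normal[OF d] differential_pderiv[OF f[OF d]] a1_def[symmetric] a2_def[symmetric]
    by (simp add: inner_add_right ga)
  have "g \<bullet> n = 0" by (simp add: g_def inner_add_left dot_cross_self)
  then have "P g"
    using tangent_exists[OF d, of g] gv unfolding P_def tangent_plane_def d_def[symmetric] n_def by (metis rangeI)
  moreover have "g' = g" if g': "P g'" for g'
  proof -
    obtain v where v: "g' = differential d R q v" using g' by (auto simp: P_def tangent_plane_def d_def[symmetric])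
    have "differential d R q v \<bullet> n = 0"
      unfolding tangent_normal[OF d] a1_def[symmetric] a2_def[symmetric] n
      by (simp add: inner_add_left dot_cross_self)
    moreover have "g' \<bullet> differential d R q (axis j 1) = g \<bullet> differential d R q (axis j 1)" for j
      using g' gv by (simp add: P_def)
    then have "g' \<bullet> a1 = g \<bullet> a1" "g' \<bullet> a2 = g \<bullet> a2"
      by (simp_all add: a1_def a2_def pderiv_in_def)
    ultimately have "g' - g = 0"
      using n0 \<open>g \<bullet> n = 0\<close> v unfolding n
      by (intro zero_of_orthogonal_basis[of a1 a2]) (simp_all add: inner_diff_left)
    then show ?thesis by simp
  qed
  ultimately have "surface_gradient \<A> R f q = g"
    unfolding surface_gradient_def d_def[symmetric] P_def[symmetric] by (rule the_equality)
  then show ?thesis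
    unfolding pderiv_in_def differential_change_chart[OF c(1) d(1) c(2) d(2) smooth_rep_differentiable[OF R d]]
      differential_change_chart[OF c(1) d(1) c(2) d(2) f[OF d]] using gv by simp
qed

section \<open>The variation box by box, and its reassembly\<close>

definition boundary_density :: "('a \<Rightarrow> real^3) \<Rightarrow> ('a \<Rightarrow> real) \<Rightarrow> 'a \<Rightarrow> real" where
  "boundary_density \<eta> vn p =
    ((1/2) *\<^sub>R surface_gradient \<A> R vn p + mean_curvature \<A> R p *\<^sub>R \<eta> p) \<bullet> outward_conormal \<A> R p"

context
  fixes \<eta> :: "'a \<Rightarrow> real^3" and vn :: "'a \<Rightarrow> real"
  assumes split: "\<And>p. p \<in> M \<Longrightarrow> V p = \<eta> p + vn p *\<^sub>R unit_normal \<A> R p"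
    and vn: "\<And>p. p \<in> M \<Longrightarrow> vn p = V p \<bullet> unit_normal \<A> R p"
begin

lemma vn_rep:
  assumes c: "c \<in> \<A>" and x: "x \<in> cimg c"
  shows "(vn \<circ> cinv c) x = (V \<circ> cinv c) x \<bullet> unrm (cimg c) (R \<circ> cinv c) x"
  using vn[OF subsetD[OF cinv_image_subset[OF c] imageI[OF x]]] unit_normal_rep[OF R c x] by simp

text \<open>An instance of \<open>conormal_identity\<close> with the gradient of \<open>vn\<close>
  for \<open>g\<close>. Differentiability of \<open>vn\<close> is derived in every chart around
  \<open>q\<close>, because the gradient is defined in the chosen chart while the formula is needed
  in \<open>c\<close>.\<close>

lemma boundary_density_form:
  assumes c: "c \<in> \<A>" "q \<in> cdom c" and q: "q \<in> surface_boundary \<A>"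
  shows "boundary_density \<eta> vn q * norm (pderiv_in c 1 R q) = - form c 1 (cmap c q)"
proof -
  interpret patch_variation "cimg c" "R \<circ> cinv c" "V \<circ> cinv c" by (rule patch_variation_chart[OF c(1)])
  define x where "x = cmap c q"
  have x: "x \<in> cimg c" "cinv c x = q" using c cinv_cmap by (auto simp: x_def)
  have qM: "q \<in> M" using c cdom_subset by blast
  have pd: "pderiv_in c i f q = pd (cimg c) i (f \<circ> cinv c) x" for i and f :: "'a \<Rightarrow> 'b::real_normed_vector"
    by (simp add: pderiv_in_def differential_def pd_def x_def)
  have vdiff: "(vn \<circ> cinv d) differentiable (at (cmap d q) within cimg d)"
    and vpd: "pd (cimg d) i (vn \<circ> cinv d) (cmap d q) =
      pd (cimg d) i (V \<circ> cinv d) (cmap d q) \<bullet> unrm (cimg d) (R \<circ> cinv d) (cmap d q)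
      + (V \<circ> cinv d) (cmap d q) \<bullet> pd (cimg d) i (unrm (cimg d) (R \<circ> cinv d)) (cmap d q)"
    if d: "d \<in> \<A>" "q \<in> cdom d" for d i
  proof -
    interpret d: patch_variation "cimg d" "R \<circ> cinv d" "V \<circ> cinv d" by (rule patch_variation_chart[OF d(1)])
    have y: "cmap d q \<in> cimg d" using d by auto
    show "(vn \<circ> cinv d) differentiable (at (cmap d q) within cimg d)"
      by (rule differentiable_cong_on[OF vn_rep[OF d(1), symmetric] y differentiable_bilinear[OF bounded_bilinear_inner d.diff_all(10)[OF y] d.diff_all(8)[OF y]]])
    have "pd (cimg d) i (vn \<circ> cinv d) (cmap d q) = pd (cimg d) i (\<lambda>x. (V \<circ> cinv d) x \<bullet> unrm (cimg d) (R \<circ> cinv d) x) (cmap d q)"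
      by (rule pd_cong[OF vn_rep[OF d(1)] y])
    also have "\<dots> = pd (cimg d) i (V \<circ> cinv d) (cmap d q) \<bullet> unrm (cimg d) (R \<circ> cinv d) (cmap d q)
      + (V \<circ> cinv d) (cmap d q) \<bullet> pd (cimg d) i (unrm (cimg d) (R \<circ> cinv d)) (cmap d q)"
      by (rule pd_bilinear[OF bounded_bilinear_inner half_open_cimg[OF d(1)] y d.diff_all(10)[OF y] d.diff_all(8)[OF y]])
    finally show "pd (cimg d) i (vn \<circ> cinv d) (cmap d q) =
      pd (cimg d) i (V \<circ> cinv d) (cmap d q) \<bullet> unrm (cimg d) (R \<circ> cinv d) (cmap d q)
      + (V \<circ> cinv d) (cmap d q) \<bullet> pd (cimg d) i (unrm (cimg d) (R \<circ> cinv d)) (cmap d q)" .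
  qed
  have Nq: "unit_normal \<A> R q = N x" using unit_normal_rep[OF R c(1) x(1)] x(2) by simp
  have grad: "surface_gradient \<A> R vn q \<bullet> a i x = b i x \<bullet> N x + V q \<bullet> pd (cimg c) i N x" for i
    using gradient_chart[OF vdiff c, of i] vpd[OF c, of i] x(2) by (simp add: pd x_def[symmetric])
  have n0: "n x \<noteq> 0" "n x = a 1 x \<times> a 2 x"
    using patch_variation.regular[OF patch_variation_chart[OF c(1)] x(1)] by (simp_all add: nrm_def)
  have "((1/2) *\<^sub>R surface_gradient \<A> R vn q + mean_curvature \<A> R q *\<^sub>R \<eta> q) \<bullet> (a 1 x \<times> N x)
    = - (N x \<bullet> (dN x \<times> a 1 x) + N x \<bullet> (V q \<times> pd (cimg c) 1 N x)) / 2"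
  proof (rule conormal_identity)
    show "a 1 x \<times> a 2 x \<noteq> 0" using n0 by simp
    show "N x = \<psi> x *\<^sub>R (a 1 x \<times> a 2 x)" using N_eq[OF x(1)] n0(2) by simp
    show "\<psi> x \<noteq> 0" using n0(1) by (simp add: \<psi>_def)
    show "pd (cimg c) 1 N x \<bullet> a 2 x = pd (cimg c) 2 N x \<bullet> a 1 x"
      by (rule pd_N_symmetric[OF x(1) n0(1)])
    show "pd (cimg c) 1 N x \<times> a 2 x + a 1 x \<times> pd (cimg c) 2 N x = - (2 * mean_curvature \<A> R q) *\<^sub>R (a 1 x \<times> a 2 x)"
      using curvature_rep(1)[OF R c(1) x(1) n0(1)] x(2) n0(2) by simp
    show "V q = \<eta> q + vn q *\<^sub>R N x" using split[OF qM] Nq by simp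
  qed (use N_orth[OF x(1)] dN_a[OF x(1)] grad in auto)
  also have "\<dots> = - form c 1 x" unfolding form_def \<theta>_def o_apply x(2) by linarith
  also have "a 1 x \<times> N x = norm (pderiv_in c 1 R q) *\<^sub>R outward_conormal \<A> R q"
    using outward_conormal_chart[OF c q] Nq by (simp add: pd)
  finally show ?thesis by (simp add: boundary_density_def x_def mult.commute)
qed

text \<open>If the box rests on the boundary line, the length integral becomes an integral over its
  lower side. If it lies higher, both sides of the equation are zero: \<rho> vanishes on the
  boundary of the surface as well as on the lower side of the box.\<close>

lemma boundary_partition_integral:
  assumes \<rho>: "supported c l u \<rho>"
  shows "integrable (boundary_length_measure \<A> R) (\<lambda>q. \<rho> q * boundary_density \<eta> vn q)"
    "(\<integral>q. \<rho> q * boundary_density \<eta> vn q \<partial>boundary_length_measure \<A> R)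
      = - integral {l $ 1..u $ 1} (\<lambda>s. \<rho> (cinv c (vector [s, l $ 2])) * form c 1 (vector [s, l $ 2]))"
proof -
  have c: "c \<in> \<A>" and box: "cbox l u \<subseteq> cimg c" and off: "\<And>q. q \<in> M - cinv c ` cbox l u \<Longrightarrow> \<rho> q = 0"
    and Ck\<rho>: "Ck 1 (cimg c) (\<rho> \<circ> cinv c)" and le: "l $ 1 \<le> u $ 1" "l $ 2 \<le> u $ 2"
    and side: "\<And>x. x \<in> cbox l u \<Longrightarrow> x $ 2 = l $ 2 \<Longrightarrow> 0 < l $ 2 \<Longrightarrow> \<rho> (cinv c x) = 0"
    using \<rho> by (auto simp: supported_def)
  interpret patch_variation "cimg c" "R \<circ> cinv c" "V \<circ> cinv c" by (rule patch_variation_chart[OF c])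
  have edge: "vector [s, l $ 2] \<in> cbox l u" if "s \<in> {l $ 1..u $ 1}" for s
    using that le by (simp add: mem_box_cart forall_2)
  have l2: "0 \<le> l $ 2" using half_open_nonneg[OF half_open_cimg[OF c] subsetD[OF box edge[of "l $ 1"]]] le by simp
  let ?f = "\<lambda>q. \<rho> q * boundary_density \<eta> vn q" and ?\<mu> = "boundary_length_measure \<A> R"
  have "integrable ?\<mu> ?f \<and> integral\<^sup>L ?\<mu> ?f
    = - integral {l $ 1..u $ 1} (\<lambda>s. \<rho> (cinv c (vector [s, l $ 2])) * form c 1 (vector [s, l $ 2]))"
  proof (cases "l $ 2 = 0")
    case True
    have sub: "cbox (l $ 1) (u $ 1) \<subseteq> boundary_line c" using edge box by (auto simp: boundary_line_def True)
    have bd: "boundary_density \<eta> vn (boundary_param c s) * boundary_weight c R s = - form c 1 (vector [s, 0])"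
      and w0: "boundary_weight c R s \<noteq> 0" if "s \<in> cbox (l $ 1) (u $ 1)" for s
    proof -
      note s = boundary_lineD[OF c subsetD[OF sub that]]
      show "boundary_density \<eta> vn (boundary_param c s) * boundary_weight c R s = - form c 1 (vector [s, 0])"
        using boundary_density_form[OF c s(1,3)] s(2) by (simp add: boundary_weight_def)
      show "boundary_weight c R s \<noteq> 0"
        using nondegenerate[OF c s(1)] by (auto simp: boundary_weight_def coord_cross_def)
    qed
    have off': "?f p = 0" if p: "p \<in> surface_boundary \<A> - boundary_param c ` cbox (l $ 1) (u $ 1)" for p
    proof -
      have "p \<notin> cinv c ` cbox l u"
      proof
        assume "p \<in> cinv c ` cbox l u"
        then obtain x where x: "x \<in> cbox l u" "p = cinv c x" by auto
        have xc: "p \<in> cdom c" "cmap c p = x" using x box cinv_cdom[OF c] cmap_cinv[OF c] by auto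
        have "x $ 1 \<in> cbox (l $ 1) (u $ 1)" using x(1) by (simp add: mem_box_cart forall_2)
        moreover have "boundary_param c (x $ 1) = p" using cmap_boundary(3)[OF c xc(1)] xc(2) p by auto
        ultimately show False using p by blast
      qed
      then show ?thesis using off[of p] p boundary_subset by auto
    qed
    have vc: "continuous_on (cbox (l $ 1) (u $ 1)) (\<lambda>s. g (vector [s, 0]))" if "continuous_on (cimg c) g" for g :: "real^2 \<Rightarrow> real"
      by (rule continuous_on_compose2[OF that continuous_on_vector_s0]) (use sub in \<open>auto simp: boundary_line_def\<close>)
    have "continuous_on (cbox (l $ 1) (u $ 1)) (\<lambda>s. (\<rho> \<circ> cinv c) (vector [s, 0]) * (- form c 1 (vector [s, 0]) / boundary_weight c R s))"
      unfolding form_def using w0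
      by (intro continuous_intros vc[OF Ck_continuous[OF Ck\<rho>]] vc[OF Ck_continuous[OF Ck_theta]]
        continuous_on_subset[OF continuous_boundary_weight[OF R c] sub]) auto
    then have "continuous_on (cbox (l $ 1) (u $ 1)) (\<lambda>s. ?f (boundary_param c s))"
      by (rule continuous_on_eq) (use w0 in \<open>simp add: bd[symmetric] boundary_param_def[symmetric]\<close>)
    note * = boundary_integral[OF R c sub off' this]
    have "integral\<^sup>L ?\<mu> ?f = integral (cbox (l $ 1) (u $ 1)) (\<lambda>s. ?f (boundary_param c s) * boundary_weight c R s)"
      by (rule *(2))
    also have "\<dots> = integral (cbox (l $ 1) (u $ 1)) (\<lambda>s. - (\<rho> (cinv c (vector [s, 0])) * form c 1 (vector [s, 0])))"
      by (rule integral_cong) (simp add: bd mult.assoc, simp add: boundary_param_def)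
    finally show ?thesis using *(1) by (simp add: True)
  next
    case False
    then have l2: "0 < l $ 2" using l2 by simp
    have f0: "?f p = 0" if p: "p \<in> surface_boundary \<A>" for p
    proof -
      have "p \<notin> cinv c ` cbox l u"
      proof
        assume "p \<in> cinv c ` cbox l u"
        then obtain x where x: "x \<in> cbox l u" "p = cinv c x" by auto
        have xc: "p \<in> cdom c" "cmap c p = x" using x box cinv_cdom[OF c] cmap_cinv[OF c] by auto
        have "x $ 2 = 0" using boundary_iff[OF c xc(1)] xc(2) p by simp
        then show False using x(1) l2 by (simp add: mem_box_cart forall_2)
      qed
      then show ?thesis using off[of p] p boundary_subset by auto
    qed
    have "integrable ?\<mu> ?f \<longleftrightarrow> integrable ?\<mu> (\<lambda>q. 0 :: real)"
      by (rule Bochner_Integration.integrable_cong) (use f0 space_boundary[OF R] in auto)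
    moreover have "integral\<^sup>L ?\<mu> ?f = integral\<^sup>L ?\<mu> (\<lambda>q. 0)"
      by (rule Bochner_Integration.integral_cong) (use f0 space_boundary[OF R] in auto)
    moreover have "integral {l $ 1..u $ 1} (\<lambda>s. \<rho> (cinv c (vector [s, l $ 2])) * form c 1 (vector [s, l $ 2])) = integral {l $ 1..u $ 1} (\<lambda>s. 0)"
      by (rule integral_cong) (use side[OF edge _ l2] in simp)
    ultimately show ?thesis by simp
  qed
  then show "integrable ?\<mu> ?f" "integral\<^sup>L ?\<mu> ?f
      = - integral {l $ 1..u $ 1} (\<lambda>s. \<rho> (cinv c (vector [s, l $ 2])) * form c 1 (vector [s, l $ 2]))"
    by auto
qed

text \<open>Integrates the Leibniz rule, by which \<rho> times \<open>d_density\<close> is - \<rho>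
  V \<bullet> (N_1 \<times> N_2) - d(\<rho> \<theta>) + d\<rho> \<and> \<theta>; Stokes' theorem
  turns the middle term into the boundary integral. The error is kept as an integral over
  \<open>M\<close> of a chart-free function, so that errors from different boxes can be
  added.\<close>

lemma interior_partition_integral:
  assumes \<rho>: "supported c l u \<rho>"
  defines "K \<equiv> \<lambda>q. gaussian_curvature \<A> R q * vn q" and "w \<equiv> \<lambda>q. wedge (chart_at \<A> q) \<rho> q"
  shows "integrable (area_measure M \<A> R) (\<lambda>q. \<rho> q * K q)" "integrable (area_measure M \<A> R) w"
    "integral (cbox l u) (\<lambda>x. \<rho> (cinv c x) * patch_variation.d_density (cimg c) (R \<circ> cinv c) (V \<circ> cinv c) x)
      = - (\<integral>q. \<rho> q * K q \<partial>area_measure M \<A> R)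
        + (\<integral>q. \<rho> q * boundary_density \<eta> vn q \<partial>boundary_length_measure \<A> R) + integral\<^sup>L (area_measure M \<A> R) w"
proof -
  have c: "c \<in> \<A>" and box: "cbox l u \<subseteq> cimg c" and off: "\<And>q. q \<in> M - cinv c ` cbox l u \<Longrightarrow> \<rho> q = 0"
    and Ck\<rho>: "\<And>d. d \<in> \<A> \<Longrightarrow> Ck 1 (cimg d) (\<rho> \<circ> cinv d)" and le: "l $ 1 \<le> u $ 1" "l $ 2 \<le> u $ 2"
    and side: "\<And>x. x \<in> cbox l u \<Longrightarrow> x $ 1 = l $ 1 \<or> x $ 1 = u $ 1 \<or> x $ 2 = u $ 2 \<Longrightarrow> \<rho> (cinv c x) = 0"
    using \<rho> by (auto simp: supported_def)
  let ?S = "cimg c" and ?A = "area_measure M \<A> R"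
  interpret patch_variation ?S "R \<circ> cinv c" "V \<circ> cinv c" by (rule patch_variation_chart[OF c])
  define r where "r = \<rho> \<circ> cinv c"
  have Ckr: "Ck 1 ?S r" "Ck (Suc 0) ?S r" using Ck\<rho>[OF c] by (simp_all add: r_def)
  have cont: "continuous_on (cbox l u) f" if "continuous_on ?S f" for f :: "real^2 \<Rightarrow> 'b::real_normed_vector"
    by (rule continuous_on_subset[OF that box])
  have n0: "n x \<noteq> 0" if "x \<in> cbox l u" for x
    using patch_variation.regular[OF patch_variation_chart[OF c]] that box by auto
  have aw: "area_weight c R x = norm (n x)" if "x \<in> cbox l u" for x
    using nrm_chart[OF c subsetD[OF box that]] by (simp add: area_weight_def)
  define G where "G x = (V \<circ> cinv c) x \<bullet> (pd ?S 1 N x \<times> pd ?S 2 N x)" for x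
  have G: "K (cinv c x) * norm (n x) = G x" if x: "x \<in> cbox l u" for x
  proof -
    have "vn (cinv c x) * norm (n x) = (V \<circ> cinv c) x \<bullet> n x"
      using vn_rep[OF c subsetD[OF box x]] n0[OF x] by (simp add: unrm_def)
    then show ?thesis
      using curvature_rep(2)[OF R c subsetD[OF box x] n0[OF x]] by (simp add: G_def K_def)
  qed
  have contG: "continuous_on (cbox l u) G"
    unfolding G_def by (intro continuous_intros continuous_on_cross cont Ck_continuous[OF Ck_v] Ck_continuous[OF Ck_SucD(2)[OF Ck_N]])
  have contn: "continuous_on (cbox l u) (\<lambda>x. norm (n x))"
    by (intro continuous_intros cont Ck_continuous[OF Ck_n])
  have contr: "continuous_on (cbox l u) r" by (rule cont[OF Ck_continuous[OF Ckr(1)]])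
  have "continuous_on (cbox l u) (\<lambda>x. r x * (G x / norm (n x)))"
    using n0 by (intro continuous_intros contr contG contn) auto
  then have "continuous_on (cbox l u) (\<lambda>x. \<rho> (cinv c x) * K (cinv c x))"
    by (rule continuous_on_eq) (use n0 in \<open>simp add: G[symmetric] r_def\<close>)
  note int = area_integral[OF R c box _ this]
  show "integrable ?A (\<lambda>q. \<rho> q * K q)" by (rule int(1)) (simp add: off)
  have "(\<integral>q. \<rho> q * K q \<partial>?A) = integral (cbox l u) (\<lambda>x. \<rho> (cinv c x) * K (cinv c x) * area_weight c R x)"
    by (rule int(2)) (simp add: off)
  also have "\<dots> = integral (cbox l u) (\<lambda>x. r x * G x)"
    by (rule integral_cong) (simp add: aw G[symmetric] r_def)
  finally have intK: "(\<integral>q. \<rho> q * K q \<partial>?A) = integral (cbox l u) (\<lambda>x. r x * G x)" .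
  define W where "W x = pd ?S 1 r x * form c 2 x - pd ?S 2 r x * form c 1 x" for x
  have contW: "continuous_on (cbox l u) W"
    unfolding W_def form_def
    using Ck_SucD(2)[OF Ckr(2)] by (intro continuous_intros cont Ck_continuous[OF Ck_theta]) auto
  have W: "w (cinv c x) * norm (n x) = W x" if x: "x \<in> cbox l u" for x
  proof -
    have xc: "cinv c x \<in> cdom c" "cmap c (cinv c x) = x" using cinv_cdom[OF c] cmap_cinv[OF c] x box by auto
    have xM: "cinv c x \<in> M" using xc cdom_subset[OF c] by auto
    have "w (cinv c x) = wedge c \<rho> (cinv c x)"
      unfolding w_def by (rule wedge_change_chart[OF chart_at(1)[OF xM] c chart_at(2)[OF xM] xc(1) Ck\<rho>[OF c]])
    then show ?thesis
      using n0[OF x] nrm_chart[OF c subsetD[OF box x], of R] pderiv_in_cinv[OF c subsetD[OF box x], of _ \<rho>]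
      by (simp add: wedge_def xc W_def r_def)
  qed
  have w0: "w q = 0" if "q \<in> M - cinv c ` cbox l u" for q
    unfolding w_def using wedge_off_box[OF \<rho> chart_at[of q] that] that by simp
  have "continuous_on (cbox l u) (\<lambda>x. W x / norm (n x))"
    using n0 by (intro continuous_intros contW contn) auto
  then have "continuous_on (cbox l u) (\<lambda>x. w (cinv c x))"
    by (rule continuous_on_eq) (use n0 in \<open>simp add: W[symmetric]\<close>)
  note intw = area_integral[OF R c box w0 this]
  show "integrable ?A w" by (rule intw(1))
  have "integral\<^sup>L ?A w = integral (cbox l u) (\<lambda>x. w (cinv c x) * area_weight c R x)" by (rule intw(2))
  also have "\<dots> = integral (cbox l u) W" by (rule integral_cong) (simp add: aw W)
  finally have intW: "integral\<^sup>L ?A w = integral (cbox l u) W" .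
  define T where "T x = pd ?S 1 (\<lambda>x. r x * \<theta> 2 x) x - pd ?S 2 (\<lambda>x. r x * \<theta> 1 x) x" for x
  have Ckr\<theta>: "Ck 1 ?S (\<lambda>x. r x * \<theta> i x)" for i by (intro Ck_mult half_open_S Ckr Ck_theta)
  have contT: "continuous_on (cbox l u) T"
    unfolding T_def using Ck_SucD(2)[of 0, OF Ckr\<theta>[unfolded One_nat_def]] by (intro continuous_intros cont) auto
  have stokes: "integral (cbox l u) T = integral {l $ 1..u $ 1} (\<lambda>s. r (vector [s, l $ 2]) * \<theta> 1 (vector [s, l $ 2]))"
    unfolding T_def by (rule box_stokes[OF half_open_S box le Ckr\<theta> Ckr\<theta>]) (use side in \<open>auto simp: r_def\<close>)
  have bd: "(\<integral>q. \<rho> q * boundary_density \<eta> vn q \<partial>boundary_length_measure \<A> R) = - integral (cbox l u) T"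
    unfolding boundary_partition_integral(2)[OF \<rho>] stokes by (simp add: r_def form_def)
  have dens: "r x * d_density x = - (r x * G x) - T x + W x" if x: "x \<in> cbox l u" for x
  proof -
    have xS: "x \<in> ?S" using x box by auto
    have "pd ?S i (\<lambda>x. r x * \<theta> j x) x = pd ?S i r x * \<theta> j x + r x * pd ?S i (\<theta> j) x" for i j
      by (rule pd_bilinear[OF bounded_bilinear_mult half_open_S xS Ck_SucD(1)[OF Ckr(2) xS] diff_all(12)[OF xS]])
    then show ?thesis
      unfolding d_density_eq[OF xS] T_def W_def G_def form_def by (simp add: algebra_simps)
  qed
  have "integral (cbox l u) (\<lambda>x. r x * d_density x) = integral (cbox l u) (\<lambda>x. - (r x * G x) - T x + W x)"
    by (rule integral_cong) (rule dens)
  also have "\<dots> = - integral (cbox l u) (\<lambda>x. r x * G x) - integral (cbox l u) T + integral (cbox l u) W"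
    using contr contG contT contW
    by (simp add: integral_add integral_diff integrable_continuous continuous_intros)
  finally show "integral (cbox l u) (\<lambda>x. \<rho> (cinv c x) * d_density x)
      = - (\<integral>q. \<rho> q * K q \<partial>?A) + (\<integral>q. \<rho> q * boundary_density \<eta> vn q \<partial>boundary_length_measure \<A> R) + integral\<^sup>L ?A w"
    unfolding intK intW bd by (simp add: r_def)
qed

text \<open>In coordinates neither the boxes nor the functions \<rho> depend on t, so the variation
  is computed box by box although the area measure itself varies.\<close>

lemma first_variation:
  "((\<lambda>t. \<integral>p. mean_curvature \<A> (\<lambda>q. R q + t *\<^sub>R V q) p \<partial>area_measure M \<A> (\<lambda>q. R q + t *\<^sub>R V q))
    has_real_derivative
      - (\<integral>p. gaussian_curvature \<A> R p * vn p \<partial>area_measure M \<A> R)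
      + (\<integral>p. boundary_density \<eta> vn p \<partial>boundary_length_measure \<A> R)) (at 0)"
proof -
  obtain I :: "'a set" and c l u \<rho> where I: "finite I" "\<And>p. p \<in> I \<Longrightarrow> supported (c p) (l p) (u p) (\<rho> p)"
    "\<And>q. q \<in> M \<Longrightarrow> (\<Sum>p\<in>I. \<rho> p q) = 1"
    by (rule partition_of_unity) blast
  have c: "c p \<in> \<A>" and box: "cbox (l p) (u p) \<subseteq> cimg (c p)" if "p \<in> I" for p
    using I(2)[OF that] by (auto simp: supported_def)
  let ?R = "\<lambda>p. R \<circ> cinv (c p)" and ?V = "\<lambda>p. V \<circ> cinv (c p)"
  let ?Rt = "\<lambda>t q. R q + t *\<^sub>R V q"
  define h where "h p t = integral (cbox (l p) (u p)) (\<lambda>x. \<rho> p (cinv (c p) x) * curvature_density (cimg (c p)) (\<lambda>x. ?R p x + t *\<^sub>R ?V p x) x)" for p t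
  define h' where "h' p = integral (cbox (l p) (u p)) (\<lambda>x. \<rho> p (cinv (c p) x) * patch_variation.d_density (cimg (c p)) (?R p) (?V p) x)" for p
  have der: "(h p has_real_derivative h' p) (at 0)" if p: "p \<in> I" for p
  proof -
    interpret patch_variation "cimg (c p)" "?R p" "?V p" by (rule patch_variation_chart[OF c[OF p]])
    have "Ck 1 (cimg (c p)) (\<rho> p \<circ> cinv (c p))" using I(2)[OF p] by (auto simp: supported_def)
    then have "continuous_on (cbox (l p) (u p)) (\<lambda>x. \<rho> p (cinv (c p) x))"
      using continuous_on_subset[OF Ck_continuous box[OF p]] by (metis (no_types, lifting) comp_apply continuous_on_cong)
    from curvature_density_derivative[OF box[OF p] this] show ?thesis by (simp add: h_def[abs_def] h'_def)
  qed
  have "\<forall>p\<in>I. \<exists>\<epsilon>>0. \<forall>t x. \<bar>t\<bar> < \<epsilon> \<longrightarrow> x \<in> cbox (l p) (u p) \<longrightarrow> nrm (cimg (c p)) (\<lambda>x. ?R p x + t *\<^sub>R ?V p x) x \<noteq> 0"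
  proof
    fix p assume p: "p \<in> I"
    interpret patch_variation "cimg (c p)" "?R p" "?V p" by (rule patch_variation_chart[OF c[OF p]])
    show "\<exists>\<epsilon>>0. \<forall>t x. \<bar>t\<bar> < \<epsilon> \<longrightarrow> x \<in> cbox (l p) (u p) \<longrightarrow> nrm (cimg (c p)) (\<lambda>x. ?R p x + t *\<^sub>R ?V p x) x \<noteq> 0"
      by (rule regular_nearby[OF compact_cbox box[OF p]]) blast
  qed
  from bchoice[OF this] obtain e where e: "\<And>p. p \<in> I \<Longrightarrow> e p > 0"
    "\<And>p t x. p \<in> I \<Longrightarrow> \<bar>t\<bar> < e p \<Longrightarrow> x \<in> cbox (l p) (u p) \<Longrightarrow> nrm (cimg (c p)) (\<lambda>x. ?R p x + t *\<^sub>R ?V p x) x \<noteq> 0"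
    by blast
  \<comment> \<open>The element 1 keeps the set nonempty when \<open>I\<close> is empty, which can
    occur only for empty \<open>M\<close>.\<close>
  define \<epsilon> where "\<epsilon> = Min (insert 1 (e ` I))"
  have \<epsilon>: "\<epsilon> > 0" "\<And>p. p \<in> I \<Longrightarrow> \<epsilon> \<le> e p" using I(1) e(1) by (auto simp: \<epsilon>_def)
  have eq: "(\<integral>p. mean_curvature \<A> (?Rt t) p \<partial>area_measure M \<A> (?Rt t)) = (\<Sum>p\<in>I. h p t)" if t: "t \<in> {-\<epsilon><..<\<epsilon>}" for t
  proof -
    have n0: "nrm (cimg (c p)) (?Rt t \<circ> cinv (c p)) x \<noteq> 0" if "p \<in> I" "x \<in> cbox (l p) (u p)" for p x
      unfolding deformed_rep using e(2)[OF that(1) _ that(2)] \<epsilon>(2)[OF that(1)] t by auto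
    note mci = mean_curvature_integral[OF deformed_smooth I(2) n0]
    have "(\<integral>p. mean_curvature \<A> (?Rt t) p \<partial>area_measure M \<A> (?Rt t))
      = (\<Sum>p\<in>I. \<integral>q. \<rho> p q * mean_curvature \<A> (?Rt t) q \<partial>area_measure M \<A> (?Rt t))"
      by (rule integral_partition[OF mci(1) I(3)]) (simp_all add: space_area[OF deformed_smooth])
    also have "\<dots> = (\<Sum>p\<in>I. h p t)"
      by (rule sum.cong[OF refl]) (simp add: mci(2) deformed_rep h_def)
    finally show ?thesis .
  qed
  have "((\<lambda>t. \<Sum>p\<in>I. h p t) has_real_derivative (\<Sum>p\<in>I. h' p)) (at 0)"
    by (rule DERIV_sum) (rule der)
  \<comment> \<open>The identity with the sum of box integrals is known only for t near 0, which
    suffices for a derivative at 0.\<close>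
  then have D: "((\<lambda>t. \<integral>p. mean_curvature \<A> (?Rt t) p \<partial>area_measure M \<A> (?Rt t)) has_real_derivative (\<Sum>p\<in>I. h' p)) (at 0)"
    by (rule has_field_derivative_transform_within_open[of _ _ _ "{-\<epsilon><..<\<epsilon>}"]) (use \<epsilon>(1) eq in auto)
  let ?K = "\<lambda>q. gaussian_curvature \<A> R q * vn q" and ?A = "area_measure M \<A> R" and ?B = "boundary_length_measure \<A> R"
  let ?w = "\<lambda>p q. wedge (chart_at \<A> q) (\<rho> p) q"
  have "(\<Sum>p\<in>I. h' p) = (\<Sum>p\<in>I. - (\<integral>q. \<rho> p q * ?K q \<partial>?A) + (\<integral>q. \<rho> p q * boundary_density \<eta> vn q \<partial>?B) + integral\<^sup>L ?A (?w p))"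
    unfolding h'_def by (rule sum.cong[OF refl]) (rule interior_partition_integral(3)[OF I(2)])
  also have "\<dots> = - (\<Sum>p\<in>I. \<integral>q. \<rho> p q * ?K q \<partial>?A) + (\<Sum>p\<in>I. \<integral>q. \<rho> p q * boundary_density \<eta> vn q \<partial>?B) + (\<Sum>p\<in>I. integral\<^sup>L ?A (?w p))"
    by (simp add: sum.distrib sum_negf sum_subtractf)
  also have "(\<Sum>p\<in>I. \<integral>q. \<rho> p q * ?K q \<partial>?A) = integral\<^sup>L ?A ?K"
    by (rule integral_partition[OF interior_partition_integral(1)[OF I(2)] I(3), symmetric]) (simp_all add: space_area[OF R])
  also have "(\<Sum>p\<in>I. \<integral>q. \<rho> p q * boundary_density \<eta> vn q \<partial>?B) = integral\<^sup>L ?B (boundary_density \<eta> vn)"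
    by (rule integral_partition[OF boundary_partition_integral(1)[OF I(2)] I(3), symmetric])
       (simp_all add: space_boundary[OF R] boundary_subset)
  \<comment> \<open>At each \<open>q\<close> all error terms are now expressed in the same chart
    \<open>chart_at \<A> q\<close>, so they can be added under one integral and
    \<open>wedge_partition\<close> applies pointwise.\<close>
  also have "(\<Sum>p\<in>I. integral\<^sup>L ?A (?w p)) = (\<integral>q. (\<Sum>p\<in>I. ?w p q) \<partial>?A)"
    by (rule Bochner_Integration.integral_sum[symmetric]) (rule interior_partition_integral(2)[OF I(2)])
  also have "\<dots> = (\<integral>q. 0 \<partial>?A)"
    by (rule Bochner_Integration.integral_cong)
       (use wedge_partition[OF I(2,3) chart_at] in \<open>simp_all add: space_area[OF R]\<close>)
  finally show ?thesis using D by simp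
qed

end

end

text \<open>If the cross product vanished, expanding \<open>a2 \<times> (a1 \<times> a2)\<close> by
  Lagrange's identity would exhibit a vector in the kernel of the differential. Injectivity forces
  it to be zero, hence \<open>a2 = 0\<close>, and then the second axis lies in the kernel.\<close>

lemma (in surface) immersion_nondegenerate:
  assumes R: "immersion \<A> R" and c: "c \<in> \<A>" "p \<in> cdom c"
  shows "coord_cross c R p \<noteq> 0"
proof
  define a1 a2 where "a1 = pderiv_in c 1 R p" and "a2 = pderiv_in c 2 R p"
  assume "coord_cross c R p = 0"
  then have n: "a1 \<times> a2 = 0" by (simp add: coord_cross_def a1_def a2_def)
  have Rs: "smooth_in_charts R" using R by (simp add: immersion_def smooth_on_surface_in_charts)
  have inj: "inj (differential c R p)" using R c by (auto simp: immersion_def)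
  have dR: "differential c R p v = v $ 1 *\<^sub>R a1 + v $ 2 *\<^sub>R a2" for v
    unfolding a1_def a2_def by (rule differential_pderiv[OF smooth_rep_differentiable[OF Rs c]])
  have zero: "v = 0" if "differential c R p v = 0" for v
    using injD[OF inj, of v 0] that by (simp add: dR)
  have "differential c R p (vector [a2 \<bullet> a2, - (a2 \<bullet> a1)]) = a2 \<times> (a1 \<times> a2)"
    by (simp add: dR Lagrange)
  then have "(vector [a2 \<bullet> a2, - (a2 \<bullet> a1)] :: real^2) = 0" using zero n by simp
  then have "a2 \<bullet> a2 = 0" by (metis vector_2(1) zero_index)
  then have "differential c R p (axis 2 1) = 0" by (simp add: dR axis_def)
  from zero[OF this] show False by (simp add: axis_eq_0_iff)
qed

theorem theorem6p4:
  fixes M :: "'a::t2_space set" and \<A> :: "'a coords set"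
    and R V \<eta> :: "'a \<Rightarrow> real^3" and vn :: "'a \<Rightarrow> real"
  assumes "compact_oriented_surface M \<A>"
    and "immersion \<A> R"
    and "\<forall>p\<in>M. \<exists>c. p \<in> cdom c \<and> curvature_line_coords M \<A> R c"
    and "smooth_on_surface \<A> V"
    and "\<forall>p\<in>M. V p = \<eta> p + vn p *\<^sub>R unit_normal \<A> R p"
    and "\<forall>p\<in>M. \<eta> p \<in> tangent_plane \<A> R p"
    and "\<forall>p\<in>M. vn p = V p \<bullet> unit_normal \<A> R p"
  shows "((\<lambda>t. \<integral>p. mean_curvature \<A> (\<lambda>q. R q + t *\<^sub>R V q) p
                 \<partial>area_measure M \<A> (\<lambda>q. R q + t *\<^sub>R V q))
          has_real_derivative
            - (\<integral>p. gaussian_curvature \<A> R p * vn p \<partial>area_measure M \<A> R)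
            + (\<integral>p. ((1/2) *\<^sub>R surface_gradient \<A> R vn p + mean_curvature \<A> R p *\<^sub>R \<eta> p)
                      \<bullet> outward_conormal \<A> R p \<partial>boundary_length_measure \<A> R)) (at 0)"
proof -
  interpret surface M \<A> by unfold_locales (rule assms(1))
  interpret surface_variation M \<A> R V
    using assms(2,4) immersion_nondegenerate[OF assms(2)]
    by unfold_locales (simp_all add: immersion_def smooth_on_surface_in_charts)
  show ?thesis
    using first_variation[of \<eta> vn] assms(5,7) unfolding boundary_density_def[abs_def] by blast
qed

end
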